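(* Let $w$ be a majorant and let $E\subset\partial\mathbb{D}$ be a set of positive Lebesgue measure. Then there exists a unique (modulo sets of Lebesgue measure zero) partition of $E$ into measurable subsets $A,S$, depending only on $E$ and $w$, for which the following hold: (i) $A$ is a set of rigidity for $\mathcal{B}_0(w)$. (ii) $S$ satisfies the SA-property with respect to $\mathcal{B}_0(w)$. Moreover, the following isomorphic identification holds: $$\mathcal{P}_E(\mathcal{B}_0(w))\cong \mathcal{P}_A(\mathcal{B}_0(w))\oplus L^\infty(S),$$ via $(f,g)\mapsto((f,g|_A),g|_S)$. Finally, modulo sets of Lebesgue measure zero, $A$ and $S$ are conformally invariant: for any conformal automorphism $\varphi$ of $\mathbb{D}$, $\varphi(A)$ is a set of rigidity for $\mathcal{B}_0(w)$ and $\varphi(S)$ satisfies the SA-property with respect to $\mathcal{B}_0(w)$.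
   Context: $\mathbb{D}$ is the open unit disc, $\partial\mathbb{D}$ the unit circle, $m$ normalized Lebesgue measure on $\partial\mathbb{D}$. "Set" means Lebesgue measurable subset of $\partial\mathbb{D}$; $A$ or $S$ may have measure zero. $L^\infty(E)$ is the space of essentially bounded functions on $E$, with its weak-star topology as dual of $L^1(E)$. The symbol $\cong$ means isomorphic as Banach spaces with equivalent norms. A majorant is a continuous non-decreasing function $w$ on $[0,1]$, positive on $(0,1]$, for which there is a number $0<\alpha<1$ such that $w(t)/t^\alpha$ increases up to $\infty$ as $t\to0+$ (constants are allowed). $\mathcal{B}_0(w)$ is the Banach space of holomorphic $f$ in $\mathbb{D}$ with $\lim_{|z|\to1-}\frac{1-|z|}{w(1-|z|)}f'(z)=0$, with norm $\|f\|_{\mathcal{B}(w)}=|f(0)|+\sup_{z\in\mathbb{D}}\frac{1-|z|}{w(1-|z|)}|f'(z)|$. For $X=\mathcal{B}_0(w)$ and a set $E\subseteq\partial\mathbb{D}$, $\mathcal{P}_E(X)$ is the closure of $\{(Q,Q):Q\text{ analytic polynomial}\}$ in $X\oplus L^\infty(E)$, with the norm topology on $X$ and the weak-star topology on $L^\infty(E)$. $E$ satisfies the SA-property with respect to $X$ if $\mathcal{P}_E(X)=X\oplus L^\infty(E)$. $E$ is a set of rigidity for $X$ if the projection $X\oplus L^\infty(E)\to X$ restricted to $\mathcal{P}_E(X)$ is injective.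
   Formalization: Uniqueness is stated among partitions satisfying (i), (ii) and the displayed identification; from (i), (ii) alone it fails, e.g. w=1, E=∂D: both (E,∅) and (E∖S',S') qualify for a closed SA-set S' of positive measure. *)

theory Defs
  imports "HOL-Complex_Analysis.Complex_Analysis" "HOL-Probability.Probability_Measure"
begin

subsection \<open>Complex normed spaces with an explicit carrier\<close>

text \<open>The spaces below depend on a set \<open>E\<close> and a weight \<open>w\<close>, hence they are values and
  not types.\<close>

record 'a normed_space =
  carr :: "'a set"
  add :: "'a \<Rightarrow> 'a \<Rightarrow> 'a"
  smul :: "complex \<Rightarrow> 'a \<Rightarrow> 'a"
  nrm :: "'a \<Rightarrow> real"

text \<open>The locale \<open>Metric_space\<close> wants a symmetric and nonnegative distance on the whole
  type, hence the value \<open>0\<close> off the carrier.\<close>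

definition norm_dist :: "'a normed_space \<Rightarrow> 'a \<Rightarrow> 'a \<Rightarrow> real" where
  "norm_dist V x y =
     (if x \<in> carr V \<and> y \<in> carr V then nrm V (add V x (smul V (-1) y)) else 0)"

definition norm_topology :: "'a normed_space \<Rightarrow> 'a topology" where
  "norm_topology V = Metric_space.mtopology (carr V) (norm_dist V)"

definition direct_sum :: "'a normed_space \<Rightarrow> 'b normed_space \<Rightarrow> ('a \<times> 'b) normed_space"
    (infixr "\<oplus>\<^sub>N" 65) where
  "V \<oplus>\<^sub>N W = \<lparr> carr = carr V \<times> carr W,
     add = (\<lambda>(x, y) (x', y'). (add V x x', add W y y')),
     smul = (\<lambda>c (x, y). (smul V c x, smul W c y)),
     nrm = (\<lambda>(x, y). nrm V x + nrm W y) \<rparr>"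

definition banach_isomorphism :: "('a \<Rightarrow> 'b) \<Rightarrow> 'a normed_space \<Rightarrow> 'b normed_space \<Rightarrow> bool" where
  "banach_isomorphism T V W \<longleftrightarrow>
     bij_betw T (carr V) (carr W) \<and>
     (\<forall>x\<in>carr V. \<forall>y\<in>carr V. T (add V x y) = add W (T x) (T y)) \<and>
     (\<forall>c. \<forall>x\<in>carr V. T (smul V c x) = smul W c (T x)) \<and>
     (\<exists>c>0. \<exists>C>0. \<forall>x\<in>carr V. c * nrm V x \<le> nrm W (T x) \<and> nrm W (T x) \<le> C * nrm V x)"

subsection \<open>Lebesgue measure on the unit circle and \<open>L\<^sup>\<infinity>(E)\<close>\<close>

definition circle :: "complex measure" where
  "circle = completion (distr (uniform_measure lborel {0..1})
     (restrict_space borel (sphere 0 1)) (\<lambda>t. cis (2 * pi * t)))"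

abbreviation circle_on :: "complex set \<Rightarrow> complex measure" where
  "circle_on E \<equiv> restrict_space circle E"

text \<open>Only the values on \<open>E\<close> of a representative matter: \<open>ae_eq E\<close> identifies functions
  that agree almost everywhere on \<open>E\<close>, whatever they do off \<open>E\<close>.\<close>

definition ess_bdd_on :: "complex set \<Rightarrow> (complex \<Rightarrow> complex) set" where
  "ess_bdd_on E = {g \<in> borel_measurable (circle_on E). \<exists>C. AE x in circle_on E. cmod (g x) \<le> C}"

definition ae_eq :: "complex set \<Rightarrow> ((complex \<Rightarrow> complex) \<times> (complex \<Rightarrow> complex)) set" where
  "ae_eq E = {(g, h). g \<in> ess_bdd_on E \<and> h \<in> ess_bdd_on E \<and> (AE x in circle_on E. g x = h x)}"

lemma equiv_ae_eq: "equiv (ess_bdd_on E) (ae_eq E)"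
proof (rule equivI)
  show "ae_eq E \<subseteq> ess_bdd_on E \<times> ess_bdd_on E" "refl_on (ess_bdd_on E) (ae_eq E)" "sym (ae_eq E)"
    by (auto simp: ae_eq_def refl_on_def sym_def)
  show "trans (ae_eq E)"
  proof (rule transI)
    fix f g h assume *: "(f, g) \<in> ae_eq E" "(g, h) \<in> ae_eq E"
    then have "AE x in circle_on E. f x = g x" "AE x in circle_on E. g x = h x"
      by (auto simp: ae_eq_def)
    then have "AE x in circle_on E. f x = h x"
      by eventually_elim simp
    with * show "(f, h) \<in> ae_eq E"
      by (auto simp: ae_eq_def)
  qed
qed

definition Linf :: "complex set \<Rightarrow> (complex \<Rightarrow> complex) set normed_space" where
  "Linf E = \<lparr> carr = ess_bdd_on E // ae_eq E,
     add = (\<lambda>G H. \<Union>g\<in>G. \<Union>h\<in>H. ae_eq E `` {\<lambda>x. g x + h x}),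
     smul = (\<lambda>c G. \<Union>g\<in>G. ae_eq E `` {\<lambda>x. c * g x}),
     nrm = (\<lambda>G. Inf {C. 0 \<le> C \<and> (\<exists>g\<in>G. AE x in circle_on E. cmod (g x) \<le> C)}) \<rparr>"

text \<open>For a class \<open>G\<close> in \<open>L\<^sup>\<infinity>(E)\<close> and \<open>A \<subseteq> E\<close>, this is the class of \<open>g|A\<close>, \<open>g \<in> G\<close>.\<close>

definition restr :: "complex set \<Rightarrow> (complex \<Rightarrow> complex) set \<Rightarrow> (complex \<Rightarrow> complex) set" where
  "restr A G = ae_eq A `` G"

text \<open>The subbasic open sets are the preimages of open sets under the functionals
  \<open>G \<mapsto> \<integral>\<^sub>E g h dm\<close> with \<open>g \<in> G\<close> and \<open>h \<in> L\<^sup>1(E)\<close>; the integral does not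
  depend on the choice of \<open>g \<in> G\<close>.\<close>

definition weakstar_topology :: "complex set \<Rightarrow> (complex \<Rightarrow> complex) set topology" where
  "weakstar_topology E = topology_generated_by
     {{G \<in> carr (Linf E). \<forall>g\<in>G. (LINT x|circle_on E. g x * h x) \<in> U} | h U.
        integrable (circle_on E) h \<and> open U}"

subsection \<open>Majorants and the Bloch-type spaces\<close>

definition majorant :: "(real \<Rightarrow> real) \<Rightarrow> bool" where
  "majorant w \<longleftrightarrow>
     continuous_on {0..1} w \<and> mono_on {0..1} w \<and> (\<forall>t\<in>{0<..1}. w t > 0) \<and>
     (\<exists>\<alpha>. 0 < \<alpha> \<and> \<alpha> < 1 \<and>
        monotone_on {0<..1} (\<le>) (\<ge>) (\<lambda>t. w t / t powr \<alpha>) \<and>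
        filterlim (\<lambda>t. w t / t powr \<alpha>) at_top (at_right 0))"

definition bloch_weight :: "(real \<Rightarrow> real) \<Rightarrow> complex \<Rightarrow> real" where
  "bloch_weight w z = (1 - cmod z) / w (1 - cmod z)"

text \<open>Functions on the disc are encoded as total functions that vanish off the disc.
  \<open>filtercomap cmod (at_left 1)\<close> is the filter of \<open>|z| \<rightarrow> 1-\<close>.\<close>

definition B0 :: "(real \<Rightarrow> real) \<Rightarrow> (complex \<Rightarrow> complex) normed_space" where
  "B0 w = \<lparr> carr = {f. f holomorphic_on ball 0 1 \<and> (\<forall>z. z \<notin> ball 0 1 \<longrightarrow> f z = 0) \<and>
       ((\<lambda>z. complex_of_real (bloch_weight w z) * deriv f z) \<longlongrightarrow> 0) (filtercomap cmod (at_left 1))},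
     add = (\<lambda>f g z. f z + g z),
     smul = (\<lambda>c f z. c * f z),
     nrm = (\<lambda>f. cmod (f 0) + (SUP z\<in>ball 0 1. bloch_weight w z * cmod (deriv f z))) \<rparr>"

lemma bloch_weight_pos:
  assumes "majorant w" "z \<in> ball 0 1"
  shows "bloch_weight w z > 0"
  using assms by (auto simp: bloch_weight_def majorant_def)

lemma bloch_weight_continuous:
  assumes "majorant w"
  shows "continuous_on (ball 0 1) (bloch_weight w)"
proof -
  have "continuous_on {0..1} w"
    using assms by (simp add: majorant_def)
  then have "continuous_on (ball 0 1) (\<lambda>z::complex. w (1 - cmod z))"
    by (rule continuous_on_compose2) (auto intro!: continuous_intros)
  moreover have "w (1 - cmod z) \<noteq> 0" if "z \<in> ball 0 1" for z
    using bloch_weight_pos[OF assms that] by (auto simp: bloch_weight_def)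
  ultimately show ?thesis
    unfolding bloch_weight_def by (intro continuous_intros) auto
qed

lemma B0_bdd:
  assumes w: "majorant w" and f: "f \<in> carr (B0 w)"
  shows "bdd_above ((\<lambda>z. bloch_weight w z * cmod (deriv f z)) ` ball 0 1)"
proof -
  let ?h = "\<lambda>z. bloch_weight w z * cmod (deriv f z)"
  have "((\<lambda>z. complex_of_real (bloch_weight w z) * deriv f z) \<longlongrightarrow> 0) (filtercomap cmod (at_left 1))"
    using f by (simp add: B0_def)
  then have "\<forall>\<^sub>F z in filtercomap cmod (at_left 1).
      cmod (complex_of_real (bloch_weight w z) * deriv f z) < 1"
    by (auto dest: tendstoD[of _ 0 _ 1] simp: dist_norm)
  then obtain P where P: "eventually P (at_left 1)"
      "\<And>z. P (cmod z) \<Longrightarrow> cmod (complex_of_real (bloch_weight w z) * deriv f z) < 1"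
    by (auto simp: eventually_filtercomap)
  from P(1) obtain b where b: "b < 1" "\<And>y. b < y \<Longrightarrow> y < 1 \<Longrightarrow> P y"
    by (auto simp: eventually_at_left_field)
  define r where "r = (max b 0)"
  have r: "r < 1" "b \<le> r" using b(1) by (auto simp: r_def)
  have "deriv f holomorphic_on ball 0 1"
    using f by (auto simp: B0_def intro: holomorphic_deriv)
  then have "continuous_on (ball 0 1) ?h"
    by (intro continuous_intros bloch_weight_continuous w holomorphic_on_imp_continuous_on)
  then have "continuous_on (cball 0 r) ?h"
    by (rule continuous_on_subset) (use r in auto)
  then have "bdd_above (?h ` cball 0 r)"
    by (intro bounded_imp_bdd_above compact_imp_bounded compact_continuous_image) auto
  then obtain M where M: "\<And>z. z \<in> cball 0 r \<Longrightarrow> ?h z \<le> M"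
    unfolding bdd_above_def by blast
  show ?thesis
  proof (rule bdd_aboveI2)
    fix z :: complex assume z: "z \<in> ball 0 1"
    show "?h z \<le> max M 1"
    proof (cases "z \<in> cball 0 r")
      case True then show ?thesis using M by (simp add: le_max_iff_disj)
    next
      case False
      then have "P (cmod z)" using b r z by auto
      then have "cmod (complex_of_real (bloch_weight w z) * deriv f z) < 1" by (rule P(2))
      then show ?thesis
        using bloch_weight_pos[OF w z] by (simp add: norm_mult less_eq_real_def max_def)
    qed
  qed
qed

lemma B0_comb:
  assumes f: "f \<in> carr (B0 w)" and g: "g \<in> carr (B0 w)"
  shows "(\<lambda>z. f z + c * g z) \<in> carr (B0 w)"
    and "z \<in> ball 0 1 \<Longrightarrow> deriv (\<lambda>z. f z + c * g z) z = deriv f z + c * deriv g z"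
proof -
  have hol: "f holomorphic_on ball 0 1" "g holomorphic_on ball 0 1"
    using f g by (auto simp: B0_def)
  have d: "deriv (\<lambda>z. f z + c * g z) z = deriv f z + c * deriv g z" if "z \<in> ball 0 1" for z
  proof -
    have "f field_differentiable at z" "g field_differentiable at z"
      using hol that by (auto intro: holomorphic_on_imp_differentiable_at)
    then show ?thesis
      by (subst deriv_add) (auto intro!: derivative_intros simp: deriv_cmult)
  qed
  then show "z \<in> ball 0 1 \<Longrightarrow> deriv (\<lambda>z. f z + c * g z) z = deriv f z + c * deriv g z" .
  let ?F = "filtercomap cmod (at_left (1::real))"
  have ev: "\<forall>\<^sub>F z in ?F. z \<in> ball 0 1"
    unfolding eventually_filtercomap
    by (rule exI[of _ "\<lambda>y. y < 1"]) (auto simp: eventually_at_left_field intro: exI[of _ 0])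
  have "((\<lambda>z. complex_of_real (bloch_weight w z) * deriv f z
            + c * (complex_of_real (bloch_weight w z) * deriv g z)) \<longlongrightarrow> 0 + c * 0) ?F"
    using f g by (intro tendsto_intros) (auto simp: B0_def)
  then have "((\<lambda>z. complex_of_real (bloch_weight w z) * deriv (\<lambda>z. f z + c * g z) z) \<longlongrightarrow> 0) ?F"
    by (rule tendsto_cong[THEN iffD1, rotated, THEN tendsto_eq_rhs])
       (use ev in \<open>auto elim!: eventually_mono simp: d algebra_simps\<close>)
  then show "(\<lambda>z. f z + c * g z) \<in> carr (B0 w)"
    using f g by (auto simp: B0_def intro!: holomorphic_intros)
qed

lemma Metric_space_B0:
  assumes w: "majorant w"
  shows "Metric_space (carr (B0 w)) (norm_dist (B0 w))"
proof -
  define N where "N = nrm (B0 w)"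
  have N: "N f = cmod (f 0) + (SUP z\<in>ball 0 1. bloch_weight w z * cmod (deriv f z))" for f
    by (simp add: N_def B0_def)
  have up: "bloch_weight w z * cmod (deriv f z) \<le> N f - cmod (f 0)"
    if "f \<in> carr (B0 w)" "z \<in> ball 0 1" for f z
    using cSUP_upper[OF that(2) B0_bdd[OF w that(1)]] by (simp add: N)
  have bw: "bloch_weight w z \<ge> 0" if "z \<in> ball 0 1" for z
    using bloch_weight_pos[OF w that] by simp
  have N_ge: "cmod (f 0) \<le> N f" if "f \<in> carr (B0 w)" for f
    using up[OF that, of 0] bw[of 0]
    by (smt (verit) centre_in_ball mult_nonneg_nonneg norm_ge_zero)
  have diff: "(\<lambda>z. f z - g z) \<in> carr (B0 w)" if "f \<in> carr (B0 w)" "g \<in> carr (B0 w)" for f g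
    using B0_comb(1)[OF that, of "-1"] by simp
  have deriv_diff: "deriv (\<lambda>z. f z - g z) z = deriv f z - deriv g z"
    if "f \<in> carr (B0 w)" "g \<in> carr (B0 w)" "z \<in> ball 0 1" for f g z
    using B0_comb(2)[OF that, of "-1"] by simp
  have nd: "norm_dist (B0 w) f g = (if f \<in> carr (B0 w) \<and> g \<in> carr (B0 w) then N (\<lambda>z. f z - g z) else 0)"
    for f g
    by (simp add: norm_dist_def N_def) (simp add: B0_def)
  show ?thesis
  proof
    fix f g :: "complex \<Rightarrow> complex"
    show "0 \<le> norm_dist (B0 w) f g"
      using N_ge[OF diff, of f g] by (auto simp: nd intro: order_trans[OF norm_ge_zero])
    show "norm_dist (B0 w) f g = norm_dist (B0 w) g f"
    proof (cases "f \<in> carr (B0 w) \<and> g \<in> carr (B0 w)")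
      case True
      then have "(SUP z\<in>ball 0 1. bloch_weight w z * cmod (deriv (\<lambda>z. f z - g z) z))
          = (SUP z\<in>ball 0 1. bloch_weight w z * cmod (deriv (\<lambda>z. g z - f z) z))"
        by (intro SUP_cong refl) (simp add: deriv_diff norm_minus_commute)
      with True show ?thesis by (simp add: nd N norm_minus_commute)
    qed (auto simp: nd)
  next
    fix f g assume fg: "f \<in> carr (B0 w)" "g \<in> carr (B0 w)"
    show "(norm_dist (B0 w) f g = 0) = (f = g)"
    proof
      assume "norm_dist (B0 w) f g = 0"
      then have 0: "N (\<lambda>z. f z - g z) = 0" using fg by (simp add: nd)
      have at0: "f 0 - g 0 = 0" using N_ge[OF diff[OF fg]] 0 by simp
      have d0: "deriv (\<lambda>z. f z - g z) z = 0" if "z \<in> ball 0 1" for z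
        using up[OF diff[OF fg] that] 0 at0 bloch_weight_pos[OF w that]
        by (simp add: mult_le_0_iff)
      have hol: "(\<lambda>z. f z - g z) holomorphic_on ball 0 1"
        using diff[OF fg] by (simp add: B0_def)
      have "(\<lambda>z. f z - g z) constant_on ball 0 1"
      proof (rule has_field_derivative_0_imp_constant_on)
        fix z :: complex assume "z \<in> ball 0 1"
        then show "((\<lambda>z. f z - g z) has_field_derivative 0) (at z)"
          using holomorphic_derivI[OF hol open_ball] d0 by metis
      qed auto
      then obtain k where k: "\<And>z. z \<in> ball 0 1 \<Longrightarrow> f z - g z = k"
        by (auto simp: constant_on_def)
      have "f z = g z" if "z \<in> ball 0 1" for z
        using k[OF that] k[of 0] at0 by simp
      moreover have "f z = g z" if "z \<notin> ball 0 1" for z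
        using fg that by (simp add: B0_def)
      ultimately show "f = g" by blast
    next
      assume "f = g"
      then show "norm_dist (B0 w) f g = 0" by (simp add: nd N)
    qed
  next
    fix f g h assume fgh: "f \<in> carr (B0 w)" "g \<in> carr (B0 w)" "h \<in> carr (B0 w)"
    have "bloch_weight w z * cmod (deriv (\<lambda>z. f z - h z) z)
        \<le> (N (\<lambda>z. f z - g z) - cmod (f 0 - g 0)) + (N (\<lambda>z. g z - h z) - cmod (g 0 - h 0))"
      if z: "z \<in> ball 0 1" for z
    proof -
      have "bloch_weight w z * cmod (deriv (\<lambda>z. f z - h z) z)
          \<le> bloch_weight w z * (cmod (deriv f z - deriv g z) + cmod (deriv g z - deriv h z))"
        using norm_triangle_ineq[of "deriv f z - deriv g z" "deriv g z - deriv h z"]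
        by (intro mult_left_mono bw[OF z]) (simp add: deriv_diff[OF fgh(1,3) z])
      also have "\<dots> = bloch_weight w z * cmod (deriv (\<lambda>z. f z - g z) z)
          + bloch_weight w z * cmod (deriv (\<lambda>z. g z - h z) z)"
        by (simp add: deriv_diff[OF fgh(1,2) z] deriv_diff[OF fgh(2,3) z] distrib_left)
      also have "\<dots> \<le> (N (\<lambda>z. f z - g z) - cmod (f 0 - g 0)) + (N (\<lambda>z. g z - h z) - cmod (g 0 - h 0))"
        by (intro add_mono up diff fgh z)
      finally show ?thesis .
    qed
    then have "(SUP z\<in>ball 0 1. bloch_weight w z * cmod (deriv (\<lambda>z. f z - h z) z))
        \<le> (N (\<lambda>z. f z - g z) - cmod (f 0 - g 0)) + (N (\<lambda>z. g z - h z) - cmod (g 0 - h 0))"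
      by (intro cSUP_least) auto
    moreover have "cmod (f 0 - h 0) \<le> cmod (f 0 - g 0) + cmod (g 0 - h 0)"
      using norm_triangle_ineq[of "f 0 - g 0" "g 0 - h 0"] by simp
    ultimately show "norm_dist (B0 w) f h \<le> norm_dist (B0 w) f g + norm_dist (B0 w) g h"
      using fgh by (simp add: nd N[of "\<lambda>z. f z - h z"])
  qed
qed

lemma prob_space_circle: "prob_space circle"
proof -
  interpret U: prob_space "uniform_measure lborel {0..1::real}"
    by (rule prob_space_uniform_measure) auto
  have "(\<lambda>t. cis (2 * pi * t)) \<in> borel_measurable borel"
    by (intro borel_measurable_continuous_onI continuous_intros)
  then have "(\<lambda>t. cis (2 * pi * t)) \<in>
      uniform_measure lborel {0..1} \<rightarrow>\<^sub>M restrict_space borel (sphere 0 1)"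
    by (intro measurable_restrict_space2) auto
  then interpret D: prob_space "distr (uniform_measure lborel {0..1})
      (restrict_space borel (sphere 0 1)) (\<lambda>t. cis (2 * pi * t))"
    by (rule U.prob_space_distr)
  show ?thesis
    using D.prob_space_completion by (simp add: circle_def)
qed

subsection \<open>Simultaneous approximation\<close>

definition poly_pair :: "complex set \<Rightarrow> complex poly \<Rightarrow> (complex \<Rightarrow> complex) \<times> (complex \<Rightarrow> complex) set" where
  "poly_pair E Q = (\<lambda>z. if z \<in> ball 0 1 then poly Q z else 0, ae_eq E `` {poly Q})"

definition P_space :: "complex set \<Rightarrow> (real \<Rightarrow> real)
    \<Rightarrow> ((complex \<Rightarrow> complex) \<times> (complex \<Rightarrow> complex) set) normed_space" where
  "P_space E w = (B0 w \<oplus>\<^sub>N Linf E)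
     \<lparr> carr := prod_topology (norm_topology (B0 w)) (weakstar_topology E) closure_of range (poly_pair E) \<rparr>"

definition SA_property :: "complex set \<Rightarrow> (real \<Rightarrow> real) \<Rightarrow> bool" where
  "SA_property E w \<longleftrightarrow> E \<in> sets circle \<and> carr (P_space E w) = carr (B0 w \<oplus>\<^sub>N Linf E)"

definition rigidity_set :: "complex set \<Rightarrow> (real \<Rightarrow> real) \<Rightarrow> bool" where
  "rigidity_set E w \<longleftrightarrow> E \<in> sets circle \<and> inj_on fst (carr (P_space E w))"

definition measurable_partition :: "complex set \<Rightarrow> complex set \<Rightarrow> complex set \<Rightarrow> bool" where
  "measurable_partition E A S \<longleftrightarrow>
     A \<in> sets circle \<and> S \<in> sets circle \<and> A \<union> S = E \<and> A \<inter> S = {}"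

definition same_mod_null :: "complex set \<Rightarrow> complex set \<Rightarrow> bool" where
  "same_mod_null A B \<longleftrightarrow> (A - B) \<union> (B - A) \<in> null_sets circle"

text \<open>An automorphism of the disc is taken together with its continuous extension to the
  closed disc, so that it acts on subsets of the circle.\<close>

definition disc_automorphism :: "(complex \<Rightarrow> complex) \<Rightarrow> bool" where
  "disc_automorphism \<phi> \<longleftrightarrow>
     \<phi> holomorphic_on ball 0 1 \<and> bij_betw \<phi> (ball 0 1) (ball 0 1) \<and> continuous_on (cball 0 1) \<phi>"

end

theory Submission
  imports Defs
begin

text \<open>Everything is read off the kernel \<open>N\<^sub>E\<close>, the weak-star closed space of all \<open>g\<close> with
  \<open>(0, g)\<close> in \<open>P_space E w\<close>. Multiplication by \<open>z\<close> and the backward shift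
  \<open>f \<mapsto> (f - f(0))/z\<close> are bounded in the norm of \<open>B0 w\<close>, and when polynomials tend to \<open>0\<close> in
  that norm their constant terms vanish in the limit; hence \<open>N\<^sub>E\<close> is invariant under
  multiplication by \<open>z\<close> and by its conjugate. By the Weierstrass theorem and a monotone class
  argument it is an \<open>L\<^sup>\<infinity>\<close>-module, so it is \<open>L\<^sup>\<infinity>(S)\<close> for the largest \<open>S\<close> whose indicator
  it contains. A set is rigid iff its kernel is \<open>0\<close>, and, polynomials being dense in \<open>B0 w\<close>, it has the
  SA-property iff its kernel is everything. Since \<open>L\<^sup>\<infinity>(S)\<close> splits off, \<open>A = E - S\<close> has kernel \<open>0\<close>.
  Composition with a Moebius transformation is bounded on \<open>B0 w\<close> and weak-star
  continuous, hence transports kernels.\<close>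

subsection \<open>Weights and the Bloch-type norm\<close>

text \<open>For general \<open>w\<close> a function in \<open>B0 w\<close> need not have boundary
  values, so its partner \<open>g\<close> cannot be found as a limit on the circle; this is why the
  argument looks at the kernel of the projection and not at traces of \<open>f\<close>. The closure
  mixes a norm topology with a weak-star topology, so sequences are avoided: \<open>approx\<close>
  asks, for each tolerance and each finite family of integrable test functions, for a single
  polynomial that serves both components. The weak-star topology is what makes the module argument
  possible: a bounded factor can be moved onto the test function, and bounded pointwise limits are
  weak-star limits by dominated convergence. The majorant enters the estimates through three facts:
  t / w(t) is non-decreasing and tends to 0 with t, both because the exponent \<alpha> is below 1,
  and w itself is non-decreasing. The first makes the weight decrease towards the circle, the second
  puts polynomials into the space, the third makes the weights at a point and at its Moebius image
  comparable.\<close>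

definition pol :: "complex poly \<Rightarrow> complex \<Rightarrow> complex" where
  "pol Q = (\<lambda>z. if z \<in> ball 0 1 then poly Q z else 0)"

lemma majorant_pos: "majorant w \<Longrightarrow> 0 < t \<Longrightarrow> t \<le> 1 \<Longrightarrow> 0 < w t"
  unfolding majorant_def by simp

lemma majorant_mono: "majorant w \<Longrightarrow> 0 \<le> s \<Longrightarrow> s \<le> t \<Longrightarrow> t \<le> 1 \<Longrightarrow> w s \<le> w t"
  unfolding majorant_def mono_on_def by simp

lemma majorant_exponent:
  assumes "majorant w"
  obtains \<alpha> where "0 < \<alpha>" "\<alpha> < 1"
    "\<And>s t. 0 < s \<Longrightarrow> s \<le> t \<Longrightarrow> t \<le> 1 \<Longrightarrow> w t / t powr \<alpha> \<le> w s / s powr \<alpha>"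
proof -
  obtain \<alpha> where \<alpha>: "0 < \<alpha>" "\<alpha> < 1" "monotone_on {0<..1} (\<le>) (\<ge>) (\<lambda>t. w t / t powr \<alpha>)"
    using assms unfolding majorant_def by blast
  show ?thesis
    by (rule that[OF \<alpha>(1,2)]) (rule monotone_onD[OF \<alpha>(3)], simp_all)
qed

text \<open>Write t / w(t) as t^(1-\<alpha>) divided by w(t) / t^\<alpha>: the numerator increases
  because \<alpha> < 1, and the denominator decreases by the choice of \<alpha>.\<close>

lemma weight_quotient_mono:
  assumes w: "majorant w" and "0 < s" "s \<le> t" "t \<le> 1"
  shows "s / w s \<le> t / w t"
proof -
  obtain \<alpha> where \<alpha>: "0 < \<alpha>" "\<alpha> < 1"
    "\<And>s t. 0 < s \<Longrightarrow> s \<le> t \<Longrightarrow> t \<le> 1 \<Longrightarrow> w t / t powr \<alpha> \<le> w s / s powr \<alpha>"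
    using majorant_exponent[OF w] by blast
  have pos: "w s > 0" "w t > 0" using assms by (auto intro!: majorant_pos[OF w])
  have le: "w t / t powr \<alpha> \<le> w s / s powr \<alpha>"
    using assms by (intro \<alpha>)
  have "s powr (1 - \<alpha>) / (w s / s powr \<alpha>) \<le> t powr (1 - \<alpha>) / (w t / t powr \<alpha>)"
    using assms \<alpha>(1,2) pos by (intro frac_le[OF _ _ _ le] powr_mono2) auto
  moreover have "x powr (1 - \<alpha>) * x powr \<alpha> = x" if "x > 0" for x :: real
    using that by (simp add: powr_diff)
  ultimately show ?thesis using assms by simp
qed

text \<open>For s \<le> t this is monotonicity of the quotient together with 1 \<le> c. For s > t
  the numerator is at most c t and the denominator is at least w(t), as w is non-decreasing. Needed
  to compare the weights at a point and at its Moebius image.\<close>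

lemma weight_quotient_comparison:
  assumes w: "majorant w" and "0 < s" "s \<le> 1" "0 < t" "t \<le> 1" "s \<le> c * t" "1 \<le> c"
  shows "s / w s \<le> c * (t / w t)"
proof (cases "s \<le> t")
  case True
  have "w t > 0" using assms by (auto intro: majorant_pos[OF w])
  then have "t / w t \<le> c * (t / w t)" using assms by (simp add: field_simps)
  then show ?thesis using weight_quotient_mono[OF w _ True] assms by simp
next
  case False
  then have "w t \<le> w s" "w t > 0"
    using assms by (auto intro: majorant_pos[OF w] majorant_mono[OF w])
  then have "s / w s \<le> c * t / w t" using assms by (intro frac_le) linarith+
  then show ?thesis by simp
qed

lemma bloch_weight_antimono:
  assumes "majorant w" "cmod z \<le> cmod z'" "cmod z' < 1"
  shows "bloch_weight w z' \<le> bloch_weight w z"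
  unfolding bloch_weight_def using assms by (intro weight_quotient_mono) auto

lemma bloch_weight_nonneg: "majorant w \<Longrightarrow> cmod z < 1 \<Longrightarrow> 0 \<le> bloch_weight w z"
  using bloch_weight_pos[of w z] by auto

text \<open>Comparing w(t) / t^\<alpha> with its value at t = 1 bounds t / w(t) by t^(1-\<alpha>) /
  w(1). Functions with bounded derivative, polynomials among them, therefore satisfy the little-o
  condition.\<close>

lemma bloch_weight_tendsto_0:
  assumes w: "majorant w"
  shows "(bloch_weight w \<longlongrightarrow> 0) (filtercomap cmod (at_left 1))"
proof -
  obtain \<alpha> where \<alpha>: "0 < \<alpha>" "\<alpha> < 1"
    "\<And>s t. 0 < s \<Longrightarrow> s \<le> t \<Longrightarrow> t \<le> 1 \<Longrightarrow> w t / t powr \<alpha> \<le> w s / s powr \<alpha>"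
    using majorant_exponent[OF w] by blast
  have w1: "w 1 > 0" by (rule majorant_pos[OF w]) auto
  have bnd: "(1 - r) / w (1 - r) \<le> (1 - r) powr (1 - \<alpha>) / w 1" if "0 < r" "r < 1" for r
  proof -
    let ?t = "1 - r"
    have "w 1 \<le> w ?t / ?t powr \<alpha>"
      using \<alpha>(3)[of ?t 1] that by simp
    then have "?t powr (1 - \<alpha>) / (w ?t / ?t powr \<alpha>) \<le> ?t powr (1 - \<alpha>) / w 1"
      using w1 by (intro frac_le) auto
    moreover have "?t powr (1 - \<alpha>) * ?t powr \<alpha> = ?t"
      using that by (simp add: powr_diff)
    ultimately show ?thesis by simp
  qed
  have pos: "0 \<le> (1 - r) / w (1 - r)" if "0 < r" "r < 1" for r
    using that by (intro divide_nonneg_pos majorant_pos[OF w]) auto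
  have ev: "\<forall>\<^sub>F r in at_left (1::real). 0 < r \<and> r < 1"
    by (auto simp: eventually_at_left_field intro: exI[of _ 0])
  have "((\<lambda>r::real. 1 - r) \<longlongrightarrow> 1 - 1) (at_left 1)"
    by (intro tendsto_intros)
  then have "((\<lambda>r::real. (1 - r) powr (1 - \<alpha>)) \<longlongrightarrow> (1 - 1) powr (1 - \<alpha>)) (at_left 1)"
    by (rule tendsto_powr'[OF _ tendsto_const])
       (use \<alpha> ev in \<open>auto elim!: eventually_mono\<close>)
  then have "((\<lambda>r. (1 - r) powr (1 - \<alpha>) / w 1) \<longlongrightarrow> (1 - 1) powr (1 - \<alpha>) / w 1) (at_left 1)"
    using w1 by (intro tendsto_divide tendsto_const) auto
  then have lim: "((\<lambda>r. (1 - r) powr (1 - \<alpha>) / w 1) \<longlongrightarrow> 0) (at_left 1)"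
    using \<alpha>(2) by simp
  have "((\<lambda>r. (1 - r) / w (1 - r)) \<longlongrightarrow> 0) (at_left 1)"
    by (rule tendsto_sandwich[OF _ _ tendsto_const lim])
       (use ev in \<open>eventually_elim, simp add: pos bnd\<close>)+
  then have "((\<lambda>z. (1 - cmod z) / w (1 - cmod z)) \<longlongrightarrow> 0) (filtercomap cmod (at_left 1))"
    by (rule filterlim_compose[OF _ filterlim_filtercomap])
  then show ?thesis by (simp add: bloch_weight_def[abs_def])
qed

lemma eventually_in_disc: "\<forall>\<^sub>F z in filtercomap cmod (at_left 1). z \<in> ball 0 1"
  unfolding eventually_filtercomap
  by (rule exI[of _ "\<lambda>y. y < 1"]) (auto simp: eventually_at_left_field intro: exI[of _ 0])

lemma B0_cong_deriv:
  fixes f g :: "complex \<Rightarrow> complex"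
  assumes "\<And>z. z \<in> ball 0 1 \<Longrightarrow> f z = g z" "z \<in> ball 0 1"
  shows "deriv f z = deriv g z"
proof (rule deriv_cong_ev)
  have "\<forall>\<^sub>F x in nhds z. x \<in> ball 0 1"
    by (rule eventually_nhds_in_open) (use assms in auto)
  then show "\<forall>\<^sub>F x in nhds z. f x = g x"
    by eventually_elim (rule assms(1))
qed simp

lemma bounded_deriv_in_B0:
  assumes w: "majorant w" and hol: "F holomorphic_on ball 0 1"
    and bnd: "\<And>z. z \<in> ball 0 1 \<Longrightarrow> cmod (deriv F z) \<le> B"
  shows "(\<lambda>z. if z \<in> ball 0 1 then F z else 0) \<in> carr (B0 w)"
proof -
  let ?f = "\<lambda>z. if z \<in> ball 0 1 then F z else 0"
  have d: "deriv ?f z = deriv F z" if "z \<in> ball 0 1" for z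
    by (rule B0_cong_deriv) (use that in auto)
  have "((\<lambda>z. complex_of_real (bloch_weight w z) * deriv ?f z) \<longlongrightarrow> 0) (filtercomap cmod (at_left 1))"
  proof (rule Lim_null_comparison)
    show "\<forall>\<^sub>F z in filtercomap cmod (at_left 1).
        norm (complex_of_real (bloch_weight w z) * deriv ?f z) \<le> bloch_weight w z * B"
      using eventually_in_disc
    proof eventually_elim
      case (elim z)
      then have "bloch_weight w z * cmod (deriv F z) \<le> bloch_weight w z * B"
        using bnd[OF elim] bloch_weight_nonneg[OF w, of z] by (intro mult_left_mono) auto
      then show ?case
        using elim d bloch_weight_nonneg[OF w, of z] by (simp add: norm_mult)
    qed
    show "((\<lambda>z. bloch_weight w z * B) \<longlongrightarrow> 0) (filtercomap cmod (at_left 1))"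
      by (rule tendsto_mult_left_zero[OF bloch_weight_tendsto_0[OF w]])
  qed
  moreover have "?f holomorphic_on ball 0 1"
    using hol by (rule holomorphic_transform) auto
  ultimately show ?thesis by (simp add: B0_def)
qed

lemma deriv_poly: "deriv (poly Q) z = poly (pderiv Q) z" for Q :: "complex poly"
  by (rule DERIV_imp_deriv) (rule poly_DERIV)

lemma compact_continuous_norm_bound:
  fixes f :: "'a::topological_space \<Rightarrow> 'b::real_normed_vector"
  assumes "compact K" "continuous_on K f"
  shows "\<exists>B. \<forall>x\<in>K. norm (f x) \<le> B"
  using compact_imp_bounded[OF compact_continuous_image[OF assms(2,1)]]
  by (simp add: bounded_iff)

lemma pol_in_B0: assumes "majorant w" shows "pol Q \<in> carr (B0 w)"
proof -
  obtain B where "\<forall>z\<in>cball 0 1. cmod (poly (pderiv Q) z) \<le> B"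
    using compact_continuous_norm_bound[OF compact_cball continuous_on_poly[OF continuous_on_id]] by blast
  then show ?thesis unfolding pol_def
    by (intro bounded_deriv_in_B0[OF assms, of _ B]) (auto simp: deriv_poly intro!: holomorphic_intros)
qed

lemma deriv_pol: "z \<in> ball 0 1 \<Longrightarrow> deriv (pol Q) z = poly (pderiv Q) z"
  by (subst B0_cong_deriv[of "pol Q" "poly Q"]) (auto simp: pol_def deriv_poly)

lemma norm_dist_B0:
  assumes "f \<in> carr (B0 w)" "g \<in> carr (B0 w)"
  shows "norm_dist (B0 w) f g =
     cmod (f 0 - g 0) + (SUP z\<in>ball 0 1. bloch_weight w z * cmod (deriv f z - deriv g z))"
proof -
  have "(SUP z\<in>ball 0 1. bloch_weight w z * cmod (deriv (\<lambda>z. f z + (-1) * g z) z)) =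
      (SUP z\<in>ball 0 1. bloch_weight w z * cmod (deriv f z - deriv g z))"
    by (intro SUP_cong refl) (simp only: B0_comb(2)[OF assms], simp)
  then show ?thesis using assms by (simp add: norm_dist_def) (simp add: B0_def)
qed

lemma norm_dist_B0_le:
  assumes "f \<in> carr (B0 w)" "g \<in> carr (B0 w)" "cmod (f 0 - g 0) \<le> c"
    "\<And>z. z \<in> ball 0 1 \<Longrightarrow> bloch_weight w z * cmod (deriv f z - deriv g z) \<le> K"
  shows "norm_dist (B0 w) f g \<le> c + K"
  unfolding norm_dist_B0[OF assms(1,2)] using assms(3,4)
  by (intro add_mono cSUP_least) auto

text \<open>The value at 0 and the derivative term are bounded jointly, so that norm estimates for
  linear combinations add up without loss of a constant.\<close>

lemma norm_dist_B0_deriv: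
  assumes "majorant w" "f \<in> carr (B0 w)" "g \<in> carr (B0 w)" "z \<in> ball 0 1"
  shows "cmod (f 0 - g 0) + bloch_weight w z * cmod (deriv f z - deriv g z) \<le> norm_dist (B0 w) f g"
proof -
  have "bdd_above ((\<lambda>z. bloch_weight w z * cmod (deriv (\<lambda>z. f z + (-1) * g z) z)) ` ball 0 1)"
    by (rule B0_bdd[OF assms(1)]) (rule B0_comb[OF assms(2,3)])
  moreover have "(\<lambda>z. bloch_weight w z * cmod (deriv (\<lambda>z. f z + (-1) * g z) z)) ` ball 0 1 =
      (\<lambda>z. bloch_weight w z * cmod (deriv f z - deriv g z)) ` ball 0 1"
    by (intro image_cong refl) (simp only: B0_comb(2)[OF assms(2,3)], simp)
  ultimately have "bdd_above ((\<lambda>z. bloch_weight w z * cmod (deriv f z - deriv g z)) ` ball 0 1)"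
    by simp
  from cSUP_upper[OF assms(4) this] show ?thesis
    unfolding norm_dist_B0[OF assms(2,3)] by simp
qed

lemma norm_dist_B0_at_0:
  assumes "majorant w" "f \<in> carr (B0 w)" "g \<in> carr (B0 w)"
  shows "cmod (f 0 - g 0) \<le> norm_dist (B0 w) f g"
  using norm_dist_B0_deriv[OF assms, of 0] bloch_weight_nonneg[OF assms(1), of 0]
  by (smt (verit) centre_in_ball mult_nonneg_nonneg norm_ge_zero norm_zero)

subsection \<open>Representatives of classes in \<open>L\<^sup>\<infinity>(E)\<close>\<close>

text \<open>Representatives measurable on the whole circle and bounded at each of its points. One
  such algebra of functions serves all sets \<open>E\<close> at once, and pointwise bounds are
  easier to carry than almost everywhere bounds; \<open>Linf_cases\<close> shows that no class is
  lost.\<close>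

definition bdd_meas :: "(complex \<Rightarrow> complex) set" where
  "bdd_meas = {g \<in> borel_measurable circle. \<exists>C. \<forall>x\<in>sphere 0 1. cmod (g x) \<le> C}"

definition cls :: "complex set \<Rightarrow> (complex \<Rightarrow> complex) \<Rightarrow> (complex \<Rightarrow> complex) set" where
  "cls E g = ae_eq E `` {g}"

text \<open>The test function lives on the whole circle and only the domain of integration depends
  on \<open>E\<close>, so the same test functions can be used for \<open>E\<close> and its
  subsets.\<close>

definition pairing :: "complex set \<Rightarrow> (complex \<Rightarrow> complex) \<Rightarrow> (complex \<Rightarrow> complex) \<Rightarrow> complex" where
  "pairing E g h = (LINT x:E|circle. g x * h x)"

lemma space_circle: "space circle = sphere 0 1"
  by (simp add: circle_def space_restrict_space)

interpretation circle: prob_space circle by (rule prob_space_circle)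

lemma sets_circle_subset: "E \<in> sets circle \<Longrightarrow> E \<subseteq> sphere 0 1"
  using sets.sets_into_space[of E circle] by (simp add: space_circle)

lemma borel_measurable_circle: 
  assumes "f \<in> borel_measurable borel" shows "f \<in> borel_measurable circle"
  unfolding circle_def
  by (rule measurable_completion) (use assms in \<open>simp add: measurable_distr_eq1 measurable_restrict_space1\<close>)

lemma bdd_measI:
  assumes "g \<in> borel_measurable circle" "\<And>x. x \<in> sphere 0 1 \<Longrightarrow> cmod (g x) \<le> C"
  shows "g \<in> bdd_meas"
  using assms unfolding bdd_meas_def by blast

lemma bdd_measE:
  assumes "g \<in> bdd_meas"
  obtains C where "g \<in> borel_measurable circle" "0 \<le> C" "\<forall>x\<in>sphere 0 1. cmod (g x) \<le> C"
proof -
  from assms obtain C where *: "g \<in> borel_measurable circle" "\<And>x. x \<in> sphere 0 1 \<Longrightarrow> cmod (g x) \<le> C"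
    unfolding bdd_meas_def by blast
  show ?thesis by (rule that[of "max C 0"]) (use * in \<open>force simp: le_max_iff_disj\<close>)+
qed

lemma bdd_meas_measurable[measurable_dest]: "g \<in> bdd_meas \<Longrightarrow> g \<in> borel_measurable circle"
  by (simp add: bdd_meas_def)

lemma bdd_meas_continuous:
  assumes "continuous_on UNIV g" shows "g \<in> bdd_meas"
proof -
  obtain C where "\<forall>x\<in>sphere 0 1. cmod (g x) \<le> C"
    using compact_continuous_norm_bound[OF compact_sphere continuous_on_subset[OF assms subset_UNIV]] by blast
  then show ?thesis
    using assms by (auto intro!: bdd_measI borel_measurable_circle borel_measurable_continuous_onI)
qed

lemma bdd_meas_poly[simp]: "poly Q \<in> bdd_meas"
  by (intro bdd_meas_continuous continuous_intros)

lemma bdd_meas_const[simp]: "(\<lambda>x. c) \<in> bdd_meas"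
  by (intro bdd_meas_continuous continuous_intros)

lemma bdd_meas_add: assumes "f \<in> bdd_meas" "g \<in> bdd_meas" shows "(\<lambda>x. f x + g x) \<in> bdd_meas"
proof -
  obtain C where C: "f \<in> borel_measurable circle" "0 \<le> C" "\<forall>x\<in>sphere 0 1. cmod (f x) \<le> C"
    by (rule bdd_measE[OF assms(1)])
  obtain D where D: "g \<in> borel_measurable circle" "0 \<le> D" "\<forall>x\<in>sphere 0 1. cmod (g x) \<le> D"
    by (rule bdd_measE[OF assms(2)])
  show ?thesis
    by (rule bdd_measI[of _ "C + D"])
       (use assms C D in \<open>auto intro!: norm_triangle_le add_mono dest: bdd_meas_measurable\<close>)
qed

lemma bdd_meas_mult: assumes "f \<in> bdd_meas" "g \<in> bdd_meas" shows "(\<lambda>x. f x * g x) \<in> bdd_meas"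
proof -
  obtain C where C: "f \<in> borel_measurable circle" "0 \<le> C" "\<forall>x\<in>sphere 0 1. cmod (f x) \<le> C"
    by (rule bdd_measE[OF assms(1)])
  obtain D where D: "g \<in> borel_measurable circle" "0 \<le> D" "\<forall>x\<in>sphere 0 1. cmod (g x) \<le> D"
    by (rule bdd_measE[OF assms(2)])
  show ?thesis
    by (rule bdd_measI[of _ "C * D"])
       (use assms C D in \<open>auto intro!: mult_mono simp: norm_mult dest: bdd_meas_measurable\<close>)
qed

lemma bdd_meas_cmult: "g \<in> bdd_meas \<Longrightarrow> (\<lambda>x. c * g x) \<in> bdd_meas"
  by (rule bdd_meas_mult) auto

lemma bdd_meas_diff: "f \<in> bdd_meas \<Longrightarrow> g \<in> bdd_meas \<Longrightarrow> (\<lambda>x. f x - g x) \<in> bdd_meas"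
  using bdd_meas_add[of f "\<lambda>x. (-1) * g x"] bdd_meas_cmult[of g "-1"] by simp

lemma bdd_meas_indicator: "T \<in> sets circle \<Longrightarrow> (\<lambda>x. indicator T x) \<in> bdd_meas"
  by (rule bdd_measI[of _ 1]) (auto simp: indicator_def)

lemmas bdd_meas_intros = bdd_meas_add bdd_meas_mult bdd_meas_cmult bdd_meas_diff bdd_meas_indicator

lemma AE_circle_on:
  "E \<in> sets circle \<Longrightarrow> (AE x in circle_on E. P x) \<longleftrightarrow> (AE x in circle. x \<in> E \<longrightarrow> P x)"
  by (intro AE_restrict_space_iff) auto

lemma bdd_meas_ess_bdd_on:
  assumes "E \<in> sets circle" "g \<in> bdd_meas" shows "g \<in> ess_bdd_on E"
proof -
  obtain C where C: "g \<in> borel_measurable circle" "0 \<le> C" "\<forall>x\<in>sphere 0 1. cmod (g x) \<le> C"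
    by (rule bdd_measE[OF assms(2)])
  have "AE x in circle_on E. cmod (g x) \<le> C"
    unfolding AE_circle_on[OF assms(1)] by (rule AE_I2) (use C in \<open>simp add: space_circle\<close>)
  then show ?thesis using assms(2)
    by (auto simp: ess_bdd_on_def intro!: measurable_restrict_space1)
qed

lemma cls_mem:
  assumes "E \<in> sets circle" "g \<in> bdd_meas"
  shows "h \<in> cls E g \<longleftrightarrow> h \<in> ess_bdd_on E \<and> (AE x in circle. x \<in> E \<longrightarrow> g x = h x)"
  using assms bdd_meas_ess_bdd_on[OF assms] by (auto simp: cls_def ae_eq_def AE_circle_on)

lemma cls_self: "E \<in> sets circle \<Longrightarrow> g \<in> bdd_meas \<Longrightarrow> g \<in> cls E g"
  by (simp add: cls_mem bdd_meas_ess_bdd_on)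

lemma cls_eq_iff:
  assumes "E \<in> sets circle" "g \<in> bdd_meas" "h \<in> bdd_meas"
  shows "cls E g = cls E h \<longleftrightarrow> (AE x in circle. x \<in> E \<longrightarrow> g x = h x)"
  unfolding cls_def using assms bdd_meas_ess_bdd_on
  by (subst eq_equiv_class_iff[OF equiv_ae_eq]) (auto simp: ae_eq_def AE_circle_on)

lemma cls_in_Linf: "E \<in> sets circle \<Longrightarrow> g \<in> bdd_meas \<Longrightarrow> cls E g \<in> carr (Linf E)"
  by (auto simp: Linf_def cls_def intro!: quotientI bdd_meas_ess_bdd_on)

lemma Linf_cases:
  assumes E: "E \<in> sets circle" and "G \<in> carr (Linf E)"
  obtains g where "g \<in> bdd_meas" "G = cls E g"
proof -
  obtain g0 where g0: "g0 \<in> ess_bdd_on E" "G = ae_eq E `` {g0}"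
    using assms by (auto simp: Linf_def elim!: quotientE)
  obtain C where C: "AE x in circle_on E. cmod (g0 x) \<le> C" and m: "g0 \<in> borel_measurable (circle_on E)"
    using g0 by (auto simp: ess_bdd_on_def)
  define g1 where "g1 = (\<lambda>x. indicator E x *\<^sub>R g0 x)"
  have g1: "g1 \<in> borel_measurable circle"
    using m E unfolding g1_def by (subst (asm) borel_measurable_restrict_space_iff) auto
  \<comment> \<open>After extension by 0 off \<open>E\<close>, the values beyond the essential bound
    are replaced by 0; on \<open>E\<close> this changes a null set only.\<close>
  define g where "g = (\<lambda>x. if cmod (g1 x) \<le> C then g1 x else 0)"
  \<comment> \<open>If \<open>E\<close> is null, a negative \<open>C\<close> is also an essential
    bound; hence the absolute value.\<close>
  have "cmod (g x) \<le> \<bar>C\<bar>" for x by (auto simp: g_def)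
  moreover have "g \<in> borel_measurable circle" using g1 unfolding g_def by measurable
  ultimately have g: "g \<in> bdd_meas" by (auto intro: bdd_measI)
  have "AE x in circle_on E. g0 x = g x"
    using C unfolding AE_circle_on[OF E] by eventually_elim (auto simp: g_def g1_def)
  then have "(g0, g) \<in> ae_eq E"
    using g0 bdd_meas_ess_bdd_on[OF E g] by (auto simp: ae_eq_def)
  then have "G = cls E g"
    using g0(2) equiv_class_eq[OF equiv_ae_eq] by (simp add: cls_def)
  with g show ?thesis by (rule that)
qed

lemma restr_cls:
  assumes "E \<in> sets circle" "A \<in> sets circle" "A \<subseteq> E" "g \<in> bdd_meas"
  shows "restr A (cls E g) = cls A g"
proof
  show "restr A (cls E g) \<subseteq> cls A g"
  proof
    fix h assume "h \<in> restr A (cls E g)"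
    then obtain k where k: "k \<in> cls E g" "(k, h) \<in> ae_eq A" by (auto simp: restr_def)
    have "AE x in circle. x \<in> A \<longrightarrow> g x = k x"
      using k(1) assms by (auto simp: cls_mem elim!: eventually_mono)
    moreover have "AE x in circle. x \<in> A \<longrightarrow> k x = h x"
      using k(2) assms by (auto simp: ae_eq_def AE_circle_on)
    ultimately have "AE x in circle. x \<in> A \<longrightarrow> g x = h x" by eventually_elim auto
    then show "h \<in> cls A g" using k(2) assms by (auto simp: cls_mem ae_eq_def)
  qed
  show "cls A g \<subseteq> restr A (cls E g)"
    using cls_self[OF assms(1,4)] by (auto simp: restr_def cls_def)
qed

text \<open>The unions in the definition of \<open>Linf\<close> run over all representatives. They
  collapse because every choice of representatives yields the same class.\<close>

lemma Linf_add_cls: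
  assumes E: "E \<in> sets circle" and g: "g \<in> bdd_meas" and h: "h \<in> bdd_meas"
  shows "add (Linf E) (cls E g) (cls E h) = cls E (\<lambda>x. g x + h x)"
proof -
  have *: "ae_eq E `` {\<lambda>x. g' x + h' x} = cls E (\<lambda>x. g x + h x)"
    if gh: "g' \<in> cls E g" "h' \<in> cls E h" for g' h'
  proof -
    have "AE x in circle. x \<in> E \<longrightarrow> g x = g' x" "AE x in circle. x \<in> E \<longrightarrow> h x = h' x"
      using gh g h E by (auto simp: cls_mem)
    then have ae: "AE x in circle. x \<in> E \<longrightarrow> g x + h x = g' x + h' x" by eventually_elim auto
    have "g' \<in> borel_measurable (circle_on E)" "h' \<in> borel_measurable (circle_on E)"
      using gh g h E by (auto simp: cls_mem ess_bdd_on_def)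
    moreover obtain C D where CD: "AE x in circle_on E. cmod (g' x) \<le> C" "AE x in circle_on E. cmod (h' x) \<le> D"
      using gh g h E by (auto simp: cls_mem ess_bdd_on_def)
    have "AE x in circle_on E. cmod (g' x + h' x) \<le> C + D"
      using CD by eventually_elim (auto intro: norm_triangle_le)
    ultimately have "(\<lambda>x. g' x + h' x) \<in> ess_bdd_on E" by (auto simp: ess_bdd_on_def)
    then have "((\<lambda>x. g x + h x), (\<lambda>x. g' x + h' x)) \<in> ae_eq E"
      using ae bdd_meas_ess_bdd_on[OF E bdd_meas_add[OF g h]] E by (auto simp: ae_eq_def AE_circle_on)
    then show ?thesis using equiv_class_eq[OF equiv_ae_eq] by (simp add: cls_def)
  qed
  have "(\<Union>g'\<in>cls E g. \<Union>h'\<in>cls E h. ae_eq E `` {\<lambda>x. g' x + h' x}) = cls E (\<lambda>x. g x + h x)"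
    using * cls_self[OF E g] cls_self[OF E h] by blast
  then show ?thesis by (simp add: Linf_def)
qed

lemma Linf_smul_cls:
  assumes E: "E \<in> sets circle" and g: "g \<in> bdd_meas"
  shows "smul (Linf E) c (cls E g) = cls E (\<lambda>x. c * g x)"
proof -
  have *: "ae_eq E `` {\<lambda>x. c * g' x} = cls E (\<lambda>x. c * g x)"
    if gh: "g' \<in> cls E g" for g'
  proof -
    have "AE x in circle. x \<in> E \<longrightarrow> g x = g' x"
      using gh g E by (auto simp: cls_mem)
    then have ae: "AE x in circle. x \<in> E \<longrightarrow> c * g x = c * g' x" by eventually_elim auto
    have "g' \<in> borel_measurable (circle_on E)"
      using gh g E by (auto simp: cls_mem ess_bdd_on_def)
    moreover obtain C where C: "AE x in circle_on E. cmod (g' x) \<le> C"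
      using gh g E by (auto simp: cls_mem ess_bdd_on_def)
    have "AE x in circle_on E. cmod (c * g' x) \<le> cmod c * C"
      using C by eventually_elim (auto simp: norm_mult intro: mult_left_mono)
    ultimately have "(\<lambda>x. c * g' x) \<in> ess_bdd_on E" by (auto simp: ess_bdd_on_def)
    then have "((\<lambda>x. c * g x), (\<lambda>x. c * g' x)) \<in> ae_eq E"
      using ae bdd_meas_ess_bdd_on[OF E bdd_meas_cmult[OF g]] E by (auto simp: ae_eq_def AE_circle_on)
    then show ?thesis using equiv_class_eq[OF equiv_ae_eq] by (simp add: cls_def)
  qed
  have "(\<Union>g'\<in>cls E g. ae_eq E `` {\<lambda>x. c * g' x}) = cls E (\<lambda>x. c * g x)"
    using * cls_self[OF E g] by blast
  then show ?thesis by (simp add: Linf_def)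
qed

lemma Linf_nrm_cls:
  assumes E: "E \<in> sets circle" and g: "g \<in> bdd_meas"
  shows "nrm (Linf E) (cls E g) = Inf {C. 0 \<le> C \<and> (AE x in circle. x \<in> E \<longrightarrow> cmod (g x) \<le> C)}"
proof -
  have "(\<exists>h\<in>cls E g. AE x in circle_on E. cmod (h x) \<le> C) \<longleftrightarrow> (AE x in circle. x \<in> E \<longrightarrow> cmod (g x) \<le> C)" for C
  proof
    assume "\<exists>h\<in>cls E g. AE x in circle_on E. cmod (h x) \<le> C"
    then obtain h where "AE x in circle. x \<in> E \<longrightarrow> g x = h x" "AE x in circle. x \<in> E \<longrightarrow> cmod (h x) \<le> C"
      using g E by (auto simp: cls_mem AE_circle_on)
    then show "AE x in circle. x \<in> E \<longrightarrow> cmod (g x) \<le> C" by eventually_elim auto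
  next
    assume "AE x in circle. x \<in> E \<longrightarrow> cmod (g x) \<le> C"
    then show "\<exists>h\<in>cls E g. AE x in circle_on E. cmod (h x) \<le> C"
      using cls_self[OF E g] E by (auto simp: AE_circle_on)
  qed
  then show ?thesis by (simp add: Linf_def)
qed

subsection \<open>The pairing between \<open>L\<^sup>\<infinity>(E)\<close> and \<open>L\<^sup>1\<close>\<close>

lemma integrable_bdd_mult:
  assumes "g \<in> bdd_meas" "integrable circle h"
  shows "integrable circle (\<lambda>x. g x * h x)"
proof -
  obtain C where C: "g \<in> borel_measurable circle" "0 \<le> C" "\<forall>x\<in>sphere 0 1. cmod (g x) \<le> C"
    by (rule bdd_measE[OF assms(1)])
  show ?thesis
  proof (rule Bochner_Integration.integrable_bound)
    show "integrable circle (\<lambda>x. C * h x)" using assms(2) by simp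
    show "(\<lambda>x. g x * h x) \<in> borel_measurable circle" using C(1) assms(2) by measurable
    show "AE x in circle. norm (g x * h x) \<le> norm (of_real C * h x)"
      by (rule AE_I2) (use C in \<open>auto simp: space_circle norm_mult intro!: mult_right_mono\<close>)
  qed
qed

lemma set_integrable_bdd_mult:
  assumes "E \<in> sets circle" "g \<in> bdd_meas" "integrable circle h"
  shows "set_integrable circle E (\<lambda>x. g x * h x)"
  unfolding set_integrable_def
  by (rule integrable_mult_indicator[OF assms(1) integrable_bdd_mult[OF assms(2,3)]])

lemma pairing_add:
  assumes "E \<in> sets circle" "f \<in> bdd_meas" "g \<in> bdd_meas" "integrable circle h"
  shows "pairing E (\<lambda>x. f x + g x) h = pairing E f h + pairing E g h"
  using set_integral_add(2)[OF set_integrable_bdd_mult[OF assms(1,2,4)] set_integrable_bdd_mult[OF assms(1,3,4)]]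
  by (simp add: pairing_def distrib_right)

lemma pairing_diff:
  assumes "E \<in> sets circle" "f \<in> bdd_meas" "g \<in> bdd_meas" "integrable circle h"
  shows "pairing E (\<lambda>x. f x - g x) h = pairing E f h - pairing E g h"
  using set_integral_diff(2)[OF set_integrable_bdd_mult[OF assms(1,2,4)] set_integrable_bdd_mult[OF assms(1,3,4)]]
  by (simp add: pairing_def left_diff_distrib)

lemma pairing_cmult: "pairing E (\<lambda>x. c * g x) h = c * pairing E g h"
  by (simp add: pairing_def mult.assoc)

text \<open>This identity is the weak-star continuity of multiplication by a bounded function: the
  factor passes to the test function.\<close>

lemma pairing_mult_shift: "pairing E (\<lambda>x. f x * g x) h = pairing E g (\<lambda>x. f x * h x)"
  by (simp add: pairing_def ac_simps)

lemma pairing_indicator: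
  assumes "A \<subseteq> E" shows "pairing A g h = pairing E g (\<lambda>x. indicator A x * h x)"
  unfolding pairing_def set_lebesgue_integral_def
  by (rule Bochner_Integration.integral_cong) (use assms in \<open>auto simp: indicator_def\<close>)

lemma pairing_cong:
  assumes E: "E \<in> sets circle" and fg: "f \<in> bdd_meas" "g \<in> bdd_meas" and h: "integrable circle h"
    and ae: "AE x in circle. x \<in> E \<longrightarrow> f x = g x"
  shows "pairing E f h = pairing E g h"
  unfolding pairing_def set_lebesgue_integral_def
proof (rule integral_cong_AE)
  show "(\<lambda>x. indicator E x *\<^sub>R (f x * h x)) \<in> borel_measurable circle"
    "(\<lambda>x. indicator E x *\<^sub>R (g x * h x)) \<in> borel_measurable circle"
    using set_integrable_bdd_mult[OF E fg(1) h] set_integrable_bdd_mult[OF E fg(2) h]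
    by (auto simp: set_integrable_def)
  show "AE x in circle. indicator E x *\<^sub>R (f x * h x) = indicator E x *\<^sub>R (g x * h x)"
    using ae by eventually_elim (auto simp: indicator_def)
qed

lemma pairing_bound:
  assumes E: "E \<in> sets circle" and g: "g \<in> bdd_meas" and h: "integrable circle h"
    and c: "\<And>x. x \<in> sphere 0 1 \<Longrightarrow> cmod (g x) \<le> c"
  shows "cmod (pairing E g h) \<le> c * (LINT x|circle. cmod (h x))"
proof -
  have "0 \<le> c" using c[of 1] norm_ge_zero[of "g 1"] by (simp del: norm_ge_zero)
  have "cmod (pairing E g h) \<le> (LINT x|circle. c * cmod (h x))"
    unfolding pairing_def set_lebesgue_integral_def
  proof (rule Bochner_Integration.integral_norm_bound_integral)
    show "integrable circle (\<lambda>x. indicator E x *\<^sub>R (g x * h x))"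
      using set_integrable_bdd_mult[OF E g h] by (simp add: set_integrable_def)
    show "integrable circle (\<lambda>x. c * cmod (h x))" using h by simp
    show "norm (indicator E x *\<^sub>R (g x * h x)) \<le> c * cmod (h x)" if "x \<in> space circle" for x
      using that c[of x] \<open>0 \<le> c\<close>
      by (auto simp: space_circle indicator_def norm_mult intro!: mult_right_mono)
  qed
  then show ?thesis by simp
qed

lemma integral_circle_on:
  "E \<in> sets circle \<Longrightarrow> (LINT x|circle_on E. g x * h x) = pairing E g h"
  by (subst integral_restrict_space) (auto simp: pairing_def set_lebesgue_integral_def)

lemma pairing_indicator_self: "pairing E g (\<lambda>x. indicator E x *\<^sub>R h x) = pairing E g h"
  unfolding pairing_def set_lebesgue_integral_def
  by (rule Bochner_Integration.integral_cong) (auto simp: indicator_def)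

lemma integral_cls:
  assumes E: "E \<in> sets circle" and g: "g \<in> bdd_meas" and h: "integrable (circle_on E) h"
    and k: "k \<in> cls E g"
  shows "(LINT x|circle_on E. k x * h x) = pairing E g h"
proof -
  have "(LINT x|circle_on E. k x * h x) = (LINT x|circle_on E. g x * h x)"
  proof (rule integral_cong_AE)
    have "g \<in> borel_measurable (circle_on E)" "k \<in> borel_measurable (circle_on E)"
      using k g E bdd_meas_ess_bdd_on[OF E g] by (auto simp: cls_mem ess_bdd_on_def)
    moreover have "h \<in> borel_measurable (circle_on E)" using h by auto
    ultimately show "(\<lambda>x. k x * h x) \<in> borel_measurable (circle_on E)"
      "(\<lambda>x. g x * h x) \<in> borel_measurable (circle_on E)" by measurable
    show "AE x in circle_on E. k x * h x = g x * h x"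
      using k g E by (auto simp: cls_mem AE_circle_on elim!: eventually_mono)
  qed
  then show ?thesis using E by (simp add: integral_circle_on)
qed

section \<open>Weak-star neighbourhoods described by finitely many test functions\<close>

lemma weakstar_subbasic:
  assumes "integrable (circle_on E) h" "open U"
  shows "openin (weakstar_topology E)
    {G \<in> carr (Linf E). \<forall>g\<in>G. (LINT x|circle_on E. g x * h x) \<in> U}"
  unfolding weakstar_topology_def
  by (rule topology_generated_by_Basis) (use assms in blast)

lemma topspace_weakstar: "topspace (weakstar_topology E) = carr (Linf E)"
proof
  show "topspace (weakstar_topology E) \<subseteq> carr (Linf E)"
    by (auto simp: weakstar_topology_def)
  have "openin (weakstar_topology E)
      {G \<in> carr (Linf E). \<forall>g\<in>G. (LINT x|circle_on E. g x * 0) \<in> UNIV}"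
    by (rule weakstar_subbasic) auto
  then show "carr (Linf E) \<subseteq> topspace (weakstar_topology E)"
    using openin_subset by fastforce
qed

text \<open>Induction over the generation of the open set: an intersection takes the smaller
  tolerance and the union of the two families of test functions, a union inherits the data of one
  member.\<close>

lemma weakstar_nbhd:
  assumes E: "E \<in> sets circle" and g: "g \<in> bdd_meas"
    and U: "openin (weakstar_topology E) U" "cls E g \<in> U"
  shows "\<exists>e>0. \<exists>H. finite H \<and> (\<forall>h\<in>H. integrable circle h) \<and>
     (\<forall>k\<in>bdd_meas. (\<forall>h\<in>H. cmod (pairing E (\<lambda>x. g x - k x) h) < e) \<longrightarrow> cls E k \<in> U)"
    (is "?P U")
proof -
  have "generate_topology_on
     {{G \<in> carr (Linf E). \<forall>g\<in>G. (LINT x|circle_on E. g x * h x) \<in> U} | h U.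
        integrable (circle_on E) h \<and> open U} U"
    using U(1) unfolding weakstar_topology_def by (rule openin_topology_generated_by)
  then have "cls E g \<in> U \<longrightarrow> ?P U"
  proof (induction rule: generate_topology_on.induct)
    case Empty
    then show ?case by simp
  next
    case (Int a b)
    show ?case
    proof
      assume "cls E g \<in> a \<inter> b"
      then have "cls E g \<in> a" "cls E g \<in> b" by auto
      note ab = Int.IH(1)[THEN mp, OF this(1)] Int.IH(2)[THEN mp, OF this(2)]
      from ab(1) obtain e H where eH: "e > 0" "finite H" "\<forall>h\<in>H. integrable circle h"
          "\<forall>k\<in>bdd_meas. (\<forall>h\<in>H. cmod (pairing E (\<lambda>x. g x - k x) h) < e) \<longrightarrow> cls E k \<in> a"
        by (elim exE conjE) (rule that)
      from ab(2) obtain e' H' where eH': "e' > 0" "finite H'" "\<forall>h\<in>H'. integrable circle h"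
          "\<forall>k\<in>bdd_meas. (\<forall>h\<in>H'. cmod (pairing E (\<lambda>x. g x - k x) h) < e') \<longrightarrow> cls E k \<in> b"
        by (elim exE conjE) (rule that)
      show "?P (a \<inter> b)"
        by (rule exI[of _ "min e e'"], intro conjI, use eH(1) eH'(1) in simp, rule exI[of _ "H \<union> H'"])
           (use eH eH' in auto)
    qed
  next
    case (UN K)
    show ?case
    proof
      assume "cls E g \<in> \<Union>K"
      then obtain k where "k \<in> K" "cls E g \<in> k" by blast
      from UN.IH[OF this(1), THEN mp, OF this(2)] obtain e H where eH: "e > 0" "finite H" "\<forall>h\<in>H. integrable circle h"
          "\<forall>l\<in>bdd_meas. (\<forall>h\<in>H. cmod (pairing E (\<lambda>x. g x - l x) h) < e) \<longrightarrow> cls E l \<in> k"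
        by (elim exE conjE) (rule that)
      then show "?P (\<Union>K)" using \<open>k \<in> K\<close> by blast
    qed
  next
    case (Basis s)
    then obtain h V where s: "s = {G \<in> carr (Linf E). \<forall>g\<in>G. (LINT x|circle_on E. g x * h x) \<in> V}"
      and h: "integrable (circle_on E) h" and V: "open V" by blast
    \<comment> \<open>A subbasic set comes with a function integrable over \<open>E\<close> only;
      extended by 0 it is a test function on the whole circle with the same pairings over
      \<open>E\<close>.\<close>
    define h' where "h' = (\<lambda>x. indicator E x *\<^sub>R h x)"
    have h': "integrable circle h'"
      using h E unfolding h'_def by (subst (asm) integrable_restrict_space) auto
    show ?case
    proof
      assume "cls E g \<in> s"
      then have "pairing E g h \<in> V"
        using cls_self[OF E g] integral_cls[OF E g h] by (auto simp: s)
      then obtain e where e: "e > 0" "ball (pairing E g h) e \<subseteq> V"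
        using V openE by blast
      have "cls E k \<in> s" if k: "k \<in> bdd_meas" and d: "cmod (pairing E (\<lambda>x. g x - k x) h') < e" for k
      proof -
        have "pairing E (\<lambda>x. g x - k x) h' = pairing E g h - pairing E k h"
          using pairing_diff[OF E g k h'] by (simp add: h'_def pairing_indicator_self)
        then have "pairing E k h \<in> V" using d e(2) by (auto simp: dist_norm)
        then show ?thesis using k by (auto simp: s integral_cls[OF E k h] cls_in_Linf[OF E k])
      qed
      then show "?P s" using e(1) h' by (intro exI[of _ e] conjI exI[of _ "{h'}"]) auto
    qed
  qed
  with U(2) show ?thesis by blast
qed

lemma weakstar_open_nbhd:
  assumes E: "E \<in> sets circle" and g: "g \<in> bdd_meas" and e: "e > 0"
    and H: "finite H" "\<forall>h\<in>H. integrable circle h"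
  shows "\<exists>U. openin (weakstar_topology E) U \<and> cls E g \<in> U \<and>
     (\<forall>k\<in>bdd_meas. cls E k \<in> U \<longrightarrow> (\<forall>h\<in>H. cmod (pairing E (\<lambda>x. g x - k x) h) < e))"
proof -
  define B where "B h = {G \<in> carr (Linf E). \<forall>k\<in>G. (LINT x|circle_on E. k x * h x) \<in> ball (pairing E g h) e}" for h
  have int: "integrable (circle_on E) h" if "h \<in> H" for h
    using H(2) that E integrable_mult_indicator[OF E, of h] by (subst integrable_restrict_space) auto
  \<comment> \<open>The intersection with the whole space matters when \<open>H\<close> is
    empty.\<close>
  let ?U = "(\<Inter>h\<in>H. B h) \<inter> topspace (weakstar_topology E)"
  have "openin (weakstar_topology E) ?U"
    using H(1) by (rule openin_INT) (unfold B_def, intro weakstar_subbasic int, auto)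
  moreover have "cls E g \<in> ?U"
    using e by (auto simp: B_def topspace_weakstar cls_in_Linf[OF E g] integral_cls[OF E g int])
  moreover have "cmod (pairing E (\<lambda>x. g x - k x) h) < e"
    if k: "k \<in> bdd_meas" and "cls E k \<in> ?U" and h: "h \<in> H" for k h
  proof -
    have "pairing E k h \<in> ball (pairing E g h) e"
    proof -
      have "cls E k \<in> B h" using that(2) h by blast
      then have "(LINT x|circle_on E. k x * h x) \<in> ball (pairing E g h) e"
        using cls_self[OF E k] unfolding B_def by blast
      then show ?thesis by (simp only: integral_cls[OF E k int[OF h] cls_self[OF E k]])
    qed
    then show ?thesis using pairing_diff[OF E g k] H(2) h by (simp add: dist_norm)
  qed
  ultimately show ?thesis by blast
qed

subsection \<open>Approximation by polynomials\<close>

text \<open>Membership of \<open>(f, cls E g)\<close> in \<open>P_space E w\<close>, written with representatives. It is meaningful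
  only for \<open>f\<close> in \<open>B0 w\<close>, as \<open>norm_dist\<close> is \<open>0\<close> off the carrier.\<close>

definition approx ::
  "complex set \<Rightarrow> (real \<Rightarrow> real) \<Rightarrow> (complex \<Rightarrow> complex) \<Rightarrow> (complex \<Rightarrow> complex) \<Rightarrow> bool" where
  "approx E w f g \<longleftrightarrow> (\<forall>e>0. \<forall>H. finite H \<longrightarrow> (\<forall>h\<in>H. integrable circle h) \<longrightarrow>
     (\<exists>Q. norm_dist (B0 w) f (pol Q) < e \<and>
          (\<forall>h\<in>H. cmod (pairing E (\<lambda>x. g x - poly Q x) h) < e)))"

lemma approxD:
  assumes "approx E w f g" "e > 0" "finite H" "\<forall>h\<in>H. integrable circle h"
  obtains Q where "norm_dist (B0 w) f (pol Q) < e"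
    "\<forall>h\<in>H. cmod (pairing E (\<lambda>x. g x - poly Q x) h) < e"
  using assms unfolding approx_def by blast

lemma poly_pair_eq: "poly_pair E Q = (pol Q, cls E (poly Q))"
  by (simp add: poly_pair_def pol_def cls_def)

text \<open>Products of a norm ball and a weak-star neighbourhood form a neighbourhood base. The
  smaller of the radius and the tolerance can be used for both factors, which is why
  \<open>approx\<close> has a single \<open>e\<close>.\<close>

lemma P_space_iff_approx:
  assumes w: "majorant w" and E: "E \<in> sets circle" and f: "f \<in> carr (B0 w)" and g: "g \<in> bdd_meas"
  shows "(f, cls E g) \<in> carr (P_space E w) \<longleftrightarrow> approx E w f g"
proof -
  interpret M: Metric_space "carr (B0 w)" "norm_dist (B0 w)" by (rule Metric_space_B0[OF w])
  let ?T = "prod_topology (norm_topology (B0 w)) (weakstar_topology E)"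
  have top: "(f, cls E g) \<in> topspace ?T"
    by (simp add: norm_topology_def topspace_weakstar f cls_in_Linf[OF E g])
  have carr: "carr (P_space E w) = ?T closure_of range (poly_pair E)"
    by (simp add: P_space_def)
  show ?thesis
  proof
    assume L: "(f, cls E g) \<in> carr (P_space E w)"
    show "approx E w f g" unfolding approx_def
    proof (intro allI impI)
      fix e :: real and H :: "(complex \<Rightarrow> complex) set"
      assume e: "e > 0" and H: "finite H" "\<forall>h\<in>H. integrable circle h"
      from weakstar_open_nbhd[OF E g e H] obtain U where U: "openin (weakstar_topology E) U" "cls E g \<in> U"
        "\<forall>k\<in>bdd_meas. cls E k \<in> U \<longrightarrow> (\<forall>h\<in>H. cmod (pairing E (\<lambda>x. g x - k x) h) < e)"
        by (elim exE conjE) (rule that)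
      have "openin ?T (M.mball f e \<times> U)"
        using U(1) by (simp add: openin_prod_Times_iff norm_topology_def)
      moreover have "(f, cls E g) \<in> M.mball f e \<times> U" using U(2) f e by simp
      moreover have "\<forall>T. (f, cls E g) \<in> T \<and> openin ?T T \<longrightarrow> (\<exists>y. y \<in> range (poly_pair E) \<and> y \<in> T)"
        using L unfolding carr in_closure_of by (rule conjunct2)
      ultimately have "\<exists>y. y \<in> range (poly_pair E) \<and> y \<in> M.mball f e \<times> U"
        by (metis (no_types))
      then obtain y where y: "y \<in> range (poly_pair E)" "y \<in> M.mball f e \<times> U"
        by (elim exE conjE) (rule that)
      obtain Q where "y = poly_pair E Q" using y(1) by (rule rangeE)
      with y(2) have "poly_pair E Q \<in> M.mball f e \<times> U" by simp
      then show "\<exists>Q. norm_dist (B0 w) f (pol Q) < e \<and>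
          (\<forall>h\<in>H. cmod (pairing E (\<lambda>x. g x - poly Q x) h) < e)"
        using U(3) by (auto simp: poly_pair_eq)
    qed
  next
    assume R: "approx E w f g"
    show "(f, cls E g) \<in> carr (P_space E w)"
      unfolding carr in_closure_of
    proof (intro conjI allI impI top)
      fix T assume "(f, cls E g) \<in> T \<and> openin ?T T"
      then obtain U V where UV: "openin (norm_topology (B0 w)) U" "openin (weakstar_topology E) V"
        "f \<in> U" "cls E g \<in> V" "U \<times> V \<subseteq> T"
        unfolding openin_prod_topology_alt by blast
      obtain r where r: "r > 0" "M.mball f r \<subseteq> U"
        using UV(1,3) unfolding norm_topology_def M.openin_mtopology by blast
      from weakstar_nbhd[OF E g UV(2,4)]
      obtain e H where eH: "e > 0" "finite H" "\<forall>h\<in>H. integrable circle h"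
        "\<forall>k\<in>bdd_meas. (\<forall>h\<in>H. cmod (pairing E (\<lambda>x. g x - k x) h) < e) \<longrightarrow> cls E k \<in> V"
        by (elim exE conjE) (rule that)
      obtain Q where Q: "norm_dist (B0 w) f (pol Q) < min r e"
        "\<forall>h\<in>H. cmod (pairing E (\<lambda>x. g x - poly Q x) h) < min r e"
        using approxD[OF R, of "min r e" H] r(1) eH by auto
      have "pol Q \<in> M.mball f r" using Q(1) f pol_in_B0[OF w] by simp
      moreover have "cls E (poly Q) \<in> V" using Q(2) eH(4) by auto
      ultimately have "poly_pair E Q \<in> T" using UV(5) r(2) by (auto simp: poly_pair_eq)
      then show "\<exists>y. y \<in> range (poly_pair E) \<and> y \<in> T" by blast
    qed
  qed
qed

lemma P_space_carr:
  assumes w: "majorant w" and E: "E \<in> sets circle"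
  shows "carr (P_space E w) = {(f, cls E g) | f g. f \<in> carr (B0 w) \<and> g \<in> bdd_meas \<and> approx E w f g}"
proof -
  interpret M: Metric_space "carr (B0 w)" "norm_dist (B0 w)" by (rule Metric_space_B0[OF w])
  have "p \<in> {(f, cls E g) | f g. f \<in> carr (B0 w) \<and> g \<in> bdd_meas \<and> approx E w f g}"
    if p: "p \<in> carr (P_space E w)" for p
  proof -
    obtain f G where fG: "p = (f, G)" by (cases p)
    have "p \<in> topspace (prod_topology (norm_topology (B0 w)) (weakstar_topology E))"
      using p closure_of_subset_topspace by (fastforce simp: P_space_def)
    then have f: "f \<in> carr (B0 w)" and "G \<in> carr (Linf E)"
      by (auto simp: fG norm_topology_def topspace_weakstar)
    then obtain g where g: "g \<in> bdd_meas" "G = cls E g" using Linf_cases[OF E] by blast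
    then show ?thesis using P_space_iff_approx[OF w E f g(1)] p f fG by auto
  qed
  then show ?thesis using P_space_iff_approx[OF w E] by auto
qed

text \<open>A closure is closed: pairs that are approximable by approximable pairs are themselves
  approximable, with half of the tolerance spent on each of the two steps.\<close>

lemma approx_closure:
  assumes w: "majorant w" and E: "E \<in> sets circle" and f: "f \<in> carr (B0 w)" and g: "g \<in> bdd_meas"
    and *: "\<And>e H. e > 0 \<Longrightarrow> finite H \<Longrightarrow> \<forall>h\<in>H. integrable circle h \<Longrightarrow>
      \<exists>f'\<in>carr (B0 w). \<exists>g'\<in>bdd_meas. approx E w f' g' \<and> norm_dist (B0 w) f f' < e \<and>
        (\<forall>h\<in>H. cmod (pairing E (\<lambda>x. g x - g' x) h) < e)"
  shows "approx E w f g"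
  unfolding approx_def
proof (intro allI impI)
  interpret M: Metric_space "carr (B0 w)" "norm_dist (B0 w)" by (rule Metric_space_B0[OF w])
  fix e :: real and H :: "(complex \<Rightarrow> complex) set"
  assume e: "e > 0" and H: "finite H" "\<forall>h\<in>H. integrable circle h"
  obtain f' g' where f': "f' \<in> carr (B0 w)" "g' \<in> bdd_meas" "approx E w f' g'"
    "norm_dist (B0 w) f f' < e/2" "\<forall>h\<in>H. cmod (pairing E (\<lambda>x. g x - g' x) h) < e/2"
    using *[of "e/2" H] e H by auto
  obtain Q where Q: "norm_dist (B0 w) f' (pol Q) < e/2"
    "\<forall>h\<in>H. cmod (pairing E (\<lambda>x. g' x - poly Q x) h) < e/2"
    using approxD[OF f'(3), of "e/2" H] e H by auto
  have "norm_dist (B0 w) f (pol Q) < e"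
    using M.triangle[OF f f'(1) pol_in_B0[OF w, of Q]] f'(4) Q(1) by simp
  moreover have "cmod (pairing E (\<lambda>x. g x - poly Q x) h) < e" if h: "h \<in> H" for h
  proof -
    have "pairing E (\<lambda>x. g x - poly Q x) h =
        pairing E (\<lambda>x. g x - g' x) h + pairing E (\<lambda>x. g' x - poly Q x) h"
      using h H(2) E g f'(2) by (simp add: pairing_diff)
    also have "cmod \<dots> < e/2 + e/2"
      using f'(5) Q(2) h by (intro norm_triangle_lt add_strict_mono) auto
    finally show ?thesis by simp
  qed
  ultimately show "\<exists>Q. norm_dist (B0 w) f (pol Q) < e \<and>
      (\<forall>h\<in>H. cmod (pairing E (\<lambda>x. g x - poly Q x) h) < e)" by blast
qed

lemma norm_dist_lincomb_le:
  assumes w: "majorant w" and f: "f \<in> carr (B0 w)" "f' \<in> carr (B0 w)"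
    and k: "k \<in> carr (B0 w)" "k' \<in> carr (B0 w)"
  shows "norm_dist (B0 w) (\<lambda>z. f z + c * f' z) (\<lambda>z. k z + c * k' z)
     \<le> norm_dist (B0 w) f k + cmod c * norm_dist (B0 w) f' k'"
proof -
  let ?d = "norm_dist (B0 w)"
  have "?d (\<lambda>z. f z + c * f' z) (\<lambda>z. k z + c * k' z) \<le>
     (cmod (f 0 - k 0) + cmod c * cmod (f' 0 - k' 0)) +
     ((?d f k - cmod (f 0 - k 0)) + cmod c * (?d f' k' - cmod (f' 0 - k' 0)))"
  proof (rule norm_dist_B0_le)
    have split: "(a + c * a') - (b + c * b') = (a - b) + c * (a' - b')" for a a' b b' :: complex
      by (simp add: algebra_simps)
    show "cmod ((f 0 + c * f' 0) - (k 0 + c * k' 0)) \<le> cmod (f 0 - k 0) + cmod c * cmod (f' 0 - k' 0)"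
      unfolding split by (rule norm_triangle_le) (simp add: norm_mult)
    fix z :: complex assume z: "z \<in> ball 0 1"
    let ?b = "bloch_weight w z"
    have b: "0 \<le> ?b" using bloch_weight_pos[OF w z] by simp
    have "cmod (deriv (\<lambda>z. f z + c * f' z) z - deriv (\<lambda>z. k z + c * k' z) z)
        \<le> cmod (deriv f z - deriv k z) + cmod c * cmod (deriv f' z - deriv k' z)"
      unfolding B0_comb(2)[OF f z] B0_comb(2)[OF k z] split
      by (rule norm_triangle_le) (simp add: norm_mult)
    then have "?b * cmod (deriv (\<lambda>z. f z + c * f' z) z - deriv (\<lambda>z. k z + c * k' z) z)
        \<le> ?b * (cmod (deriv f z - deriv k z) + cmod c * cmod (deriv f' z - deriv k' z))"
      by (rule mult_left_mono[OF _ b])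
    also have "\<dots> = ?b * cmod (deriv f z - deriv k z) + cmod c * (?b * cmod (deriv f' z - deriv k' z))"
      by (simp add: algebra_simps)
    also have "\<dots> \<le> (?d f k - cmod (f 0 - k 0)) + cmod c * (?d f' k' - cmod (f' 0 - k' 0))"
      using norm_dist_B0_deriv[OF w f(1) k(1) z] norm_dist_B0_deriv[OF w f(2) k(2) z]
      by (intro add_mono mult_left_mono) auto
    finally show "?b * cmod (deriv (\<lambda>z. f z + c * f' z) z - deriv (\<lambda>z. k z + c * k' z) z)
      \<le> (?d f k - cmod (f 0 - k 0)) + cmod c * (?d f' k' - cmod (f' 0 - k' 0))" .
  qed (use B0_comb(1) f k in auto)
  then show ?thesis by (simp add: algebra_simps)
qed

lemma approx_lincomb:
  assumes w: "majorant w" and E: "E \<in> sets circle"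
    and f: "f \<in> carr (B0 w)" "f' \<in> carr (B0 w)" and g: "g \<in> bdd_meas" "g' \<in> bdd_meas"
    and a: "approx E w f g" "approx E w f' g'"
  shows "approx E w (\<lambda>z. f z + c * f' z) (\<lambda>z. g z + c * g' z)"
  unfolding approx_def
proof (intro allI impI)
  fix e :: real and H :: "(complex \<Rightarrow> complex) set"
  assume e: "e > 0" and H: "finite H" "\<forall>h\<in>H. integrable circle h"
  define d where "d = e / (1 + cmod c)"
  have c: "1 + cmod c > 0" by (simp add: add_pos_nonneg)
  have "(1 + cmod c) * d = e" using c by (simp add: d_def)
  then have "d + cmod c * d = e" by (simp add: distrib_right)
  moreover have "d > 0" using e c by (simp add: d_def)
  ultimately have d: "d > 0" "d + cmod c * d = e" by auto
  obtain Q where Q: "norm_dist (B0 w) f (pol Q) < d" "\<forall>h\<in>H. cmod (pairing E (\<lambda>x. g x - poly Q x) h) < d"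
    using approxD[OF a(1) d(1) H] .
  obtain R where R: "norm_dist (B0 w) f' (pol R) < d" "\<forall>h\<in>H. cmod (pairing E (\<lambda>x. g' x - poly R x) h) < d"
    using approxD[OF a(2) d(1) H] .
  have comb: "a + cmod c * b < e" if "a < d" "b < d" for a b
    using that d(2) mult_left_mono[of b d "cmod c"] by simp
  have "pol (Q + smult c R) = (\<lambda>z. pol Q z + c * pol R z)"
    by (auto simp: pol_def fun_eq_iff)
  then have "norm_dist (B0 w) (\<lambda>z. f z + c * f' z) (pol (Q + smult c R)) < e"
    using norm_dist_lincomb_le[OF w f pol_in_B0[OF w, of Q] pol_in_B0[OF w, of R], of c] comb[OF Q(1) R(1)]
    by simp
  moreover have "cmod (pairing E (\<lambda>x. (g x + c * g' x) - poly (Q + smult c R) x) h) < e" if h: "h \<in> H" for h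
  proof -
    have "pairing E (\<lambda>x. (g x + c * g' x) - poly (Q + smult c R) x) h =
        pairing E (\<lambda>x. g x - poly Q x) h + c * pairing E (\<lambda>x. g' x - poly R x) h"
    proof -
      have "(\<lambda>x. (g x + c * g' x) - poly (Q + smult c R) x) =
          (\<lambda>x. (g x - poly Q x) + c * (g' x - poly R x))" by (auto simp: algebra_simps)
      then show ?thesis
        using h H(2) E g by (simp add: pairing_add bdd_meas_intros pairing_cmult)
    qed
    also have "cmod \<dots> \<le> cmod (pairing E (\<lambda>x. g x - poly Q x) h) + cmod c * cmod (pairing E (\<lambda>x. g' x - poly R x) h)"
      by (rule norm_triangle_le) (simp add: norm_mult)
    also have "\<dots> < e" using Q(2) R(2) h by (intro comb) auto
    finally show ?thesis .
  qed
  ultimately show "\<exists>Q. norm_dist (B0 w) (\<lambda>z. f z + c * f' z) (pol Q) < e \<and>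
      (\<forall>h\<in>H. cmod (pairing E (\<lambda>x. (g x + c * g' x) - poly Q x) h) < e)" by blast
qed

lemma approx_poly: "majorant w \<Longrightarrow> approx E w (pol Q) (poly Q)"
  using Metric_space.mdist_zero[OF Metric_space_B0 pol_in_B0, of w Q]
  by (auto simp: approx_def pairing_def intro!: exI[of _ Q])

lemma pol_0: "pol 0 = (\<lambda>z. 0)" by (auto simp: pol_def)

lemma zero_in_B0: "majorant w \<Longrightarrow> (\<lambda>z. 0) \<in> carr (B0 w)"
  using pol_in_B0[of w 0] by (simp add: pol_0)

text \<open>Multiplied by the indicator of \<open>A\<close>, a test function pairs over
  \<open>E\<close> as it did over \<open>A\<close>; hence the polynomials found for \<open>E\<close>
  also work for \<open>A\<close>.\<close>

lemma approx_subset: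
  assumes "approx E w f g" "A \<in> sets circle" "A \<subseteq> E"
  shows "approx A w f g"
  unfolding approx_def
proof (intro allI impI)
  fix e :: real and H :: "(complex \<Rightarrow> complex) set"
  assume e: "e > 0" and H: "finite H" "\<forall>h\<in>H. integrable circle h"
  let ?i = "\<lambda>h x. indicator A x * h x :: complex"
  have "finite (?i ` H)" "\<forall>h\<in>?i ` H. integrable circle h"
    using H by (auto intro!: integrable_bdd_mult bdd_meas_indicator assms)
  from approxD[OF assms(1) e this] obtain Q where Q: "norm_dist (B0 w) f (pol Q) < e"
    "\<forall>h\<in>?i ` H. cmod (pairing E (\<lambda>x. g x - poly Q x) h) < e" .
  from Q(2) have "\<forall>h\<in>H. cmod (pairing A (\<lambda>x. g x - poly Q x) h) < e"
    by (simp add: pairing_indicator[OF assms(3)])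
  with Q(1) show "\<exists>Q. norm_dist (B0 w) f (pol Q) < e \<and>
      (\<forall>h\<in>H. cmod (pairing A (\<lambda>x. g x - poly Q x) h) < e)" by (intro exI conjI)
qed

lemma approx_cong:
  assumes "approx E w f g" "E \<in> sets circle" "g \<in> bdd_meas" "g' \<in> bdd_meas"
    "AE x in circle. x \<in> E \<longrightarrow> g x = g' x"
  shows "approx E w f g'"
proof -
  have "pairing E (\<lambda>x. g' x - poly Q x) h = pairing E (\<lambda>x. g x - poly Q x) h"
    if "integrable circle h" for Q h
    by (rule pairing_cong) (use assms that in \<open>auto intro!: bdd_meas_diff elim!: eventually_mono\<close>)
  then show ?thesis using assms(1) unfolding approx_def by metis
qed

subsection \<open>The shifts on polynomials\<close>

lemma zero_dist_deriv:
  assumes w: "majorant w" and z: "z \<in> ball 0 1"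
  shows "cmod (poly Q 0) + bloch_weight w z * cmod (poly (pderiv Q) z) \<le> norm_dist (B0 w) (\<lambda>z. 0) (pol Q)"
  using norm_dist_B0_deriv[OF w zero_in_B0[OF w] pol_in_B0[OF w, of Q] z] z
  by (simp add: deriv_pol) (simp add: pol_def)

lemma zero_dist_le:
  assumes w: "majorant w" and "cmod (poly Q 0) \<le> c"
    and "\<And>z. z \<in> ball 0 1 \<Longrightarrow> bloch_weight w z * cmod (poly (pderiv Q) z) \<le> K"
  shows "norm_dist (B0 w) (\<lambda>z. 0) (pol Q) \<le> c + K"
proof (rule norm_dist_B0_le[OF zero_in_B0[OF w] pol_in_B0[OF w]])
  show "cmod (0 - pol Q 0) \<le> c" using assms(2) by (simp add: pol_def)
  show "bloch_weight w z * cmod (deriv (\<lambda>z. 0) z - deriv (pol Q) z) \<le> K" if "z \<in> ball 0 1" for z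
    using assms(3)[OF that] that by (simp add: deriv_pol)
qed

text \<open>The weight decreases towards the boundary, so along the radius the bound for the derivative
  at \<open>z\<close> is also one at every earlier point: no integral of \<open>w(t)/t\<close> appears.\<close>

lemma weighted_increment_le:
  assumes w: "majorant w" and z: "z \<in> ball 0 1"
  shows "bloch_weight w z * cmod (poly Q z - poly Q 0) \<le> norm_dist (B0 w) (\<lambda>z. 0) (pol Q)"
proof -
  let ?N = "norm_dist (B0 w) (\<lambda>z. 0) (pol Q)"
  have b: "bloch_weight w z > 0" by (rule bloch_weight_pos[OF w z])
  have N: "0 \<le> ?N" by (rule Metric_space.nonneg[OF Metric_space_B0[OF w]])
  have bd: "cmod (poly (pderiv Q) \<zeta>) \<le> ?N / bloch_weight w z" if "\<zeta> \<in> cball 0 (cmod z)" for \<zeta>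
  proof -
    have \<zeta>: "\<zeta> \<in> ball 0 1" using that z by simp
    have "bloch_weight w z * cmod (poly (pderiv Q) \<zeta>) \<le> bloch_weight w \<zeta> * cmod (poly (pderiv Q) \<zeta>)"
      using bloch_weight_antimono[OF w, of \<zeta> z] that z by (intro mult_right_mono) auto
    also have "\<dots> \<le> ?N"
      using zero_dist_deriv[OF w \<zeta>, of Q] norm_ge_zero[of "poly Q 0"] by linarith
    finally show ?thesis using b by (simp add: field_simps)
  qed
  have "cmod (poly Q z - poly Q 0) \<le> ?N / bloch_weight w z * cmod (z - 0)"
    by (rule field_differentiable_bound[OF convex_cball[of 0 "cmod z"] _ bd])
       (auto intro: DERIV_subset[OF poly_DERIV])
  also have "\<dots> \<le> ?N / bloch_weight w z * 1"
    using z b N by (intro mult_left_mono divide_nonneg_pos) auto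
  finally show ?thesis using b by (simp add: field_simps)
qed

text \<open>The derivative of z Q is (Q - Q(0)) + Q(0) + z Q'. After weighting, the first and the
  last term cost one norm each and the middle one costs the weight at 0, which gives the
  constant.\<close>

lemma forward_shift_bound:
  assumes w: "majorant w"
  shows "norm_dist (B0 w) (\<lambda>z. 0) (pol (pCons 0 Q)) \<le>
    (2 + bloch_weight w 0) * norm_dist (B0 w) (\<lambda>z. 0) (pol Q)"
proof -
  let ?N = "norm_dist (B0 w) (\<lambda>z. 0) (pol Q)"
  have "norm_dist (B0 w) (\<lambda>z. 0) (pol (pCons 0 Q)) \<le> 0 + (2 + bloch_weight w 0) * ?N"
  proof (rule zero_dist_le[OF w])
    fix z :: complex assume z: "z \<in> ball 0 1"
    let ?b = "bloch_weight w z"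
    have b: "0 \<le> ?b" "?b \<le> bloch_weight w 0"
      using bloch_weight_pos[OF w z] bloch_weight_antimono[OF w, of 0 z] z by auto
    have "cmod (poly (pderiv (pCons 0 Q)) z) = cmod ((poly Q z - poly Q 0) + (poly Q 0 + z * poly (pderiv Q) z))"
      by (simp add: pderiv_pCons)
    also have "\<dots> \<le> cmod (poly Q z - poly Q 0) + (cmod (poly Q 0) + cmod z * cmod (poly (pderiv Q) z))"
      by (intro norm_triangle_le add_mono order_refl norm_triangle_le) (simp add: norm_mult)
    also have "\<dots> \<le> cmod (poly Q z - poly Q 0) + (cmod (poly Q 0) + 1 * cmod (poly (pderiv Q) z))"
      using z by (intro add_mono mult_right_mono) auto
    finally have "?b * cmod (poly (pderiv (pCons 0 Q)) z) \<le>
        ?b * cmod (poly Q z - poly Q 0) + ?b * cmod (poly Q 0) + ?b * cmod (poly (pderiv Q) z)"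
      using mult_left_mono[OF _ b(1)] by (fastforce simp: distrib_left)
    also have "\<dots> \<le> ?N + bloch_weight w 0 * ?N + ?N"
    proof (intro add_mono mult_mono)
      show "?b * cmod (poly Q z - poly Q 0) \<le> ?N" by (rule weighted_increment_le[OF w z])
      have *: "cmod (poly Q 0) + ?b * cmod (poly (pderiv Q) z) \<le> ?N" by (rule zero_dist_deriv[OF w z])
      have "0 \<le> ?b * cmod (poly (pderiv Q) z)" using b by simp
      with * show "cmod (poly Q 0) \<le> ?N" by linarith
      from * show "?b * cmod (poly (pderiv Q) z) \<le> ?N" using norm_ge_zero[of "poly Q 0"] by linarith
    qed (use b in auto)
    finally show "?b * cmod (poly (pderiv (pCons 0 Q)) z) \<le> (2 + bloch_weight w 0) * ?N"
      by (simp add: algebra_simps)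
  qed simp
  then show ?thesis by simp
qed

text \<open>Put Q = a + z R and let N be its norm. Both Q - Q(0) = z R and Q' = R + z R' are at most
  N after weighting. Where |z| \<ge> 1/2, division by z costs a factor 2: the weighted R is at most
  2 N, the weighted z R' at most 3 N and the weighted R' at most 6 N. Inside, the maximum principle
  carries the bound over from the circle of radius 1/2, on which the weight is constant. The value
  R(0) is Q'(0).\<close>

lemma backward_shift_bound:
  assumes w: "majorant w"
  obtains C where "0 \<le> C" "\<forall>a R. norm_dist (B0 w) (\<lambda>z. 0) (pol R) \<le> C * norm_dist (B0 w) (\<lambda>z. 0) (pol (pCons a R))"
proof -
  define b0 bh where "b0 = bloch_weight w 0" and "bh = bloch_weight w (1/2)"
  have b0: "b0 > 0" and bh: "bh > 0"
    by (auto simp: b0_def bh_def intro!: bloch_weight_pos[OF w])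
  \<comment> \<open>The first entry is the bound for |z| \<ge> 1/2; the second is the bound for |z|
    \<le> 1/2, where the weight is at most \<open>b0\<close>.\<close>
  define K where "K = max 6 (b0 * (6 / bh))"
  have "norm_dist (B0 w) (\<lambda>z. 0) (pol R) \<le> (1/b0 + K) * norm_dist (B0 w) (\<lambda>z. 0) (pol (pCons a R))" for a R
  proof -
    let ?Q = "pCons a R"
    let ?N = "norm_dist (B0 w) (\<lambda>z. 0) (pol ?Q)"
    have N: "0 \<le> ?N" by (rule Metric_space.nonneg[OF Metric_space_B0[OF w]])
    have D: "bloch_weight w z * cmod (poly R z + z * poly (pderiv R) z) \<le> ?N" if "z \<in> ball 0 1" for z
    proof -
      have "cmod (poly ?Q 0) + bloch_weight w z * cmod (poly (pderiv ?Q) z) \<le> ?N"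
        by (rule zero_dist_deriv[OF w that])
      then have "cmod a + bloch_weight w z * cmod (poly R z + z * poly (pderiv R) z) \<le> ?N"
        by (simp add: pderiv_pCons)
      then show ?thesis using norm_ge_zero[of a] by linarith
    qed
    have outer: "bloch_weight w z * cmod (poly (pderiv R) z) \<le> 6 * ?N"
      if z: "z \<in> ball 0 1" "1/2 \<le> cmod z" for z
    proof -
      let ?b = "bloch_weight w z"
      have b: "0 \<le> ?b" using bloch_weight_pos[OF w z(1)] by simp
      have dbl: "?b * cmod u \<le> 2 * (?b * cmod (z * u))" for u
      proof -
        have "1/2 * (?b * cmod u) \<le> cmod z * (?b * cmod u)"
          using z(2) b by (intro mult_right_mono) auto
        then show ?thesis by (simp add: norm_mult algebra_simps)
      qed
      have 1: "?b * cmod (z * poly R z) \<le> ?N"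
        using weighted_increment_le[OF w z(1), of ?Q] by simp
      have "cmod (z * poly (pderiv R) z) \<le> cmod (poly R z + z * poly (pderiv R) z) + cmod (poly R z)"
        using norm_triangle_ineq4[of "poly R z + z * poly (pderiv R) z" "poly R z"] by simp
      then have "?b * cmod (z * poly (pderiv R) z) \<le>
          ?b * cmod (poly R z + z * poly (pderiv R) z) + ?b * cmod (poly R z)"
        using mult_left_mono[OF _ b] by (fastforce simp: distrib_left)
      then show ?thesis
        using 1 dbl[of "poly R z"] dbl[of "poly (pderiv R) z"] D[OF z(1)] by linarith
    qed
    have inner: "bloch_weight w z * cmod (poly (pderiv R) z) \<le> b0 * (6 / bh) * ?N"
      if z: "cmod z \<le> 1/2" for z
    proof -
      have "cmod (poly (pderiv R) z) \<le> 6 * ?N / bh"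
      proof (rule maximum_modulus_frontier[where S = "cball 0 (1/2)" and f = "poly (pderiv R)" and \<xi> = z])
        fix \<zeta> :: complex assume "\<zeta> \<in> frontier (cball 0 (1/2))"
        then have \<zeta>: "cmod \<zeta> = 1/2" by simp
        have "bloch_weight w \<zeta> = bh" unfolding bloch_weight_def bh_def \<zeta> by (simp add: norm_divide)
        with outer[of \<zeta>] \<zeta> have "bh * cmod (poly (pderiv R) \<zeta>) \<le> 6 * ?N" by simp
        then show "cmod (poly (pderiv R) \<zeta>) \<le> 6 * ?N / bh" using bh by (simp add: field_simps)
      qed (use z in \<open>auto intro!: holomorphic_intros continuous_intros\<close>)
      moreover have "bloch_weight w z \<le> b0" "0 \<le> bloch_weight w z"
        using bloch_weight_antimono[OF w, of 0 z] bloch_weight_pos[OF w, of z] z by (auto simp: b0_def)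
      ultimately have "bloch_weight w z * cmod (poly (pderiv R) z) \<le> b0 * (6 * ?N / bh)"
        using b0 by (intro mult_mono) auto
      then show ?thesis by simp
    qed
    have "norm_dist (B0 w) (\<lambda>z. 0) (pol R) \<le> ?N / b0 + K * ?N"
    proof (rule zero_dist_le[OF w])
      have "b0 * cmod (poly R 0) \<le> ?N" using D[of 0] by (simp add: b0_def)
      then show "cmod (poly R 0) \<le> ?N / b0" using b0 by (simp add: field_simps)
      fix z :: complex assume z: "z \<in> ball 0 1"
      show "bloch_weight w z * cmod (poly (pderiv R) z) \<le> K * ?N"
      proof (cases "1/2 \<le> cmod z")
        case True
        have "6 * ?N \<le> K * ?N" using N by (intro mult_right_mono) (auto simp: K_def)
        with outer[OF z True] show ?thesis by linarith
      next
        case False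
        have "b0 * (6 / bh) * ?N \<le> K * ?N" using N by (intro mult_right_mono) (auto simp: K_def)
        with inner[of z] False show ?thesis by linarith
      qed
    qed
    then show ?thesis by (simp add: algebra_simps)
  qed
  moreover have "0 \<le> 1/b0 + K" using b0 by (simp add: K_def le_max_iff_disj)
  ultimately show ?thesis using that by blast
qed

subsection \<open>The kernel of the projection is invariant under both shifts\<close>

text \<open>If Q is close to the pair (0, g), then z Q is close to (0, z g): the norm grows by the
  constant of the forward shift, and in the pairings the factor x goes to the test
  functions.\<close>

lemma kernel_forward:
  assumes w: "majorant w" and E: "E \<in> sets circle" and g: "g \<in> bdd_meas"
    and a: "approx E w (\<lambda>z. 0) g"
  shows "approx E w (\<lambda>z. 0) (\<lambda>x. x * g x)"
  unfolding approx_def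
proof (intro allI impI)
  fix e :: real and H :: "(complex \<Rightarrow> complex) set"
  assume e: "e > 0" and H: "finite H" "\<forall>h\<in>H. integrable circle h"
  let ?C = "2 + bloch_weight w 0"
  have C: "1 \<le> ?C" using bloch_weight_nonneg[OF w, of 0] by simp
  have id: "(\<lambda>x. x) \<in> bdd_meas" by (intro bdd_meas_continuous continuous_intros)
  have "e / ?C > 0" "finite ((\<lambda>h x. x * h x) ` H)"
    "\<forall>h\<in>(\<lambda>h x. x * h x) ` H. integrable circle h"
    using C e H by (auto intro!: integrable_bdd_mult[OF id])
  from approxD[OF a this] obtain Q where Q: "norm_dist (B0 w) (\<lambda>z. 0) (pol Q) < e / ?C"
    "\<forall>h\<in>(\<lambda>h x. x * h x) ` H. cmod (pairing E (\<lambda>x. g x - poly Q x) h) < e / ?C" .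
  have "e / ?C \<le> e / 1" using C e by (intro divide_left_mono) auto
  then have "e / ?C \<le> e" by simp
  moreover have "norm_dist (B0 w) (\<lambda>z. 0) (pol (pCons 0 Q)) < e"
  proof -
    have "?C * norm_dist (B0 w) (\<lambda>z. 0) (pol Q) < ?C * (e / ?C)"
      using C Q(1) by (intro mult_strict_left_mono) auto
    also have "\<dots> = e" using C by simp
    finally show ?thesis using forward_shift_bound[OF w, of Q] by linarith
  qed
  moreover have "pairing E (\<lambda>x. x * g x - poly (pCons 0 Q) x) h = pairing E (\<lambda>x. g x - poly Q x) (\<lambda>x. x * h x)" for h
    using pairing_mult_shift[of E "\<lambda>x. x" "\<lambda>x. g x - poly Q x" h] by (simp add: right_diff_distrib)
  ultimately show "\<exists>Q. norm_dist (B0 w) (\<lambda>z. 0) (pol Q) < e \<and>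
      (\<forall>h\<in>H. cmod (pairing E (\<lambda>x. x * g x - poly Q x) h) < e)"
    using Q(2) by (intro exI[of _ "pCons 0 Q"]) auto
qed

text \<open>For Q = c + z R the points x of the circle satisfy (cnj x) g - R = (cnj x) ((g - Q) +
  c), because x has modulus 1. So R approximates (cnj x) g up to the constant c = Q(0), and this is
  controlled by the norm of Q, which is small because the first component of the pair is 0.\<close>

lemma kernel_backward:
  assumes w: "majorant w" and E: "E \<in> sets circle" and g: "g \<in> bdd_meas"
    and a: "approx E w (\<lambda>z. 0) g"
  shows "approx E w (\<lambda>z. 0) (\<lambda>x. cnj x * g x)"
  unfolding approx_def
proof (intro allI impI)
  fix e :: real and H :: "(complex \<Rightarrow> complex) set"
  assume e: "e > 0" and H: "finite H" "\<forall>h\<in>H. integrable circle h"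
  obtain C where C: "0 \<le> C"
    "\<forall>a R. norm_dist (B0 w) (\<lambda>z. 0) (pol R) \<le> C * norm_dist (B0 w) (\<lambda>z. 0) (pol (pCons a R))"
    by (rule backward_shift_bound[OF w])
  define J where "J = (\<Sum>h\<in>H. LINT x|circle. cmod (cnj x * h x))"
  \<comment> \<open>The tolerance has to cover the pairing error d, the norm C d after the backward
    shift, and the contribution J d of the constant term; \<open>J\<close> dominates the L1 norm of
    every test function.\<close>
  define d where "d = e / (1 + C + J)"
  have J: "0 \<le> J" "h \<in> H \<Longrightarrow> (LINT x|circle. cmod (cnj x * h x)) \<le> J" for h
    unfolding J_def using H(1) by (auto intro!: sum_nonneg member_le_sum)
  have pos: "1 + C + J > 0" using C(1) J(1) by simp
  have d: "d > 0" using e pos by (simp add: d_def)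
  have "(1 + C + J) * d = e" using pos by (simp add: d_def)
  then have de: "d + C * d + J * d = e" by (simp add: algebra_simps)
  have nn: "0 \<le> C * d" "0 \<le> J * d" using C(1) J(1) d by auto
  have cj: "cnj \<in> bdd_meas" by (intro bdd_meas_continuous continuous_intros)
  have int: "integrable circle (\<lambda>x. cnj x * h x)" if "h \<in> H" for h
    using H(2) that by (intro integrable_bdd_mult[OF cj]) auto
  have "finite ((\<lambda>h x. cnj x * h x) ` H)" "\<forall>h\<in>(\<lambda>h x. cnj x * h x) ` H. integrable circle h"
    using H int by auto
  from approxD[OF a d this] obtain Q where Q: "norm_dist (B0 w) (\<lambda>z. 0) (pol Q) < d"
    "\<forall>h\<in>(\<lambda>h x. cnj x * h x) ` H. cmod (pairing E (\<lambda>x. g x - poly Q x) h) < d" .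
  obtain c R where QR: "Q = pCons c R" by (rule pCons_cases)
  have c: "cmod c < d"
  proof -
    have "cmod (poly Q 0) \<le> norm_dist (B0 w) (\<lambda>z. 0) (pol Q)"
      using norm_dist_B0_at_0[OF w zero_in_B0[OF w] pol_in_B0[OF w, of Q]] by (simp add: pol_def)
    then show ?thesis using Q(1) by (simp add: QR)
  qed
  have "C * norm_dist (B0 w) (\<lambda>z. 0) (pol Q) \<le> C * d" using C(1) Q(1) by (intro mult_left_mono) auto
  then have 1: "norm_dist (B0 w) (\<lambda>z. 0) (pol R) < e"
    using spec[OF spec[OF C(2), of c], of R] QR de nn d by simp
  have 2: "cmod (pairing E (\<lambda>x. cnj x * g x - poly R x) h) < e" if h: "h \<in> H" for h
  proof -
    let ?h = "\<lambda>x. cnj x * h x"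
    have "cnj x * g x - poly R x = cnj x * ((g x - poly Q x) + c)" if "x \<in> sphere 0 1" for x
    proof -
      have "cnj x * x = 1" using that complex_norm_square[of x] by (simp add: mult.commute)
      then have "cnj x * (x * poly R x) = poly R x" by (simp add: mult.assoc[symmetric])
      then show ?thesis by (simp add: QR algebra_simps)
    qed
    then have "pairing E (\<lambda>x. cnj x * g x - poly R x) h = pairing E (\<lambda>x. cnj x * ((g x - poly Q x) + c)) h"
      using h H(2) by (intro pairing_cong E bdd_meas_intros g cj bdd_meas_poly bdd_meas_const)
         (auto simp: space_circle intro: AE_I2)
    also have "\<dots> = pairing E (\<lambda>x. (g x - poly Q x) + c) ?h" by (rule pairing_mult_shift)
    also have "\<dots> = pairing E (\<lambda>x. g x - poly Q x) ?h + pairing E (\<lambda>x. c) ?h"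
      using int[OF h] by (intro pairing_add E bdd_meas_intros g bdd_meas_poly bdd_meas_const)
    finally have "cmod (pairing E (\<lambda>x. cnj x * g x - poly R x) h)
        \<le> cmod (pairing E (\<lambda>x. g x - poly Q x) ?h) + cmod (pairing E (\<lambda>x. c) ?h)"
      by (simp add: norm_triangle_ineq)
    also have "cmod (pairing E (\<lambda>x. g x - poly Q x) ?h) < d" using Q(2) h by simp
    also have "cmod (pairing E (\<lambda>x. c) ?h) \<le> cmod c * (LINT x|circle. cmod (?h x))"
      by (rule pairing_bound[OF E bdd_meas_const int[OF h]]) simp
    also have "\<dots> \<le> d * J" using c J h d by (intro mult_mono) auto
    finally show ?thesis using de nn by (simp add: mult.commute)
  qed
  show "\<exists>Q. norm_dist (B0 w) (\<lambda>z. 0) (pol Q) < e \<and>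
      (\<forall>h\<in>H. cmod (pairing E (\<lambda>x. cnj x * g x - poly Q x) h) < e)"
    using 1 2 by blast
qed

subsection \<open>Polynomials are dense\<close>

text \<open>Taylor polynomials at 0 converge uniformly on a disc of radius s > 1; the Cauchy
  estimate on discs of radius s - 1 around points of the closed unit disc transfers this to the
  derivatives. Applied below to dilations and to polynomials composed with Moebius maps.\<close>

lemma poly_approx_holomorphic:
  assumes hol: "F holomorphic_on ball 0 r" and r: "1 < r" and e: "0 < e"
  shows "\<exists>Q. \<forall>z\<in>cball 0 1. cmod (F z - poly Q z) < e \<and> cmod (deriv F z - poly (pderiv Q) z) < e"
proof -
  obtain s where s: "1 < s" "s < r" using dense[OF r] by blast
  obtain t where t: "s < t" "t < r" using dense[OF s(2)] by blast
  define a where "a n = (deriv ^^ n) F 0 / fact n" for n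
  have sums: "(\<lambda>n. a n * z ^ n) sums F z" if "z \<in> ball 0 r" for z
    using holomorphic_power_series[OF hol that] by (simp add: a_def)
  have "summable (\<lambda>n. a n * of_real t ^ n)"
    using sums[of "of_real t"] s t by (auto intro: sums_summable)
  from conv_radius_geI[OF this] have "ereal t \<le> conv_radius a" using s t by simp
  with t(1) have "ereal s < conv_radius a" using less_le_trans by (metis less_ereal.simps(1))
  then have "uniform_limit (cball 0 s) (\<lambda>n x. \<Sum>i<n. a i * (x - 0) ^ i) (\<lambda>x. \<Sum>i. a i * (x - 0) ^ i) sequentially"
    by (rule powser_uniform_limit)
  \<comment> \<open>The first entry serves the values; the second serves the derivatives, since the
    Cauchy estimate divides by s - 1.\<close>
  moreover define d where "d = min e (e * (s - 1)) / 2"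
  have d: "d > 0" "d < e" "d < e * (s - 1)" using e s by (auto simp: d_def min_def)
  ultimately obtain n where n: "\<forall>x\<in>cball 0 s. dist (\<Sum>i<n. a i * (x - 0) ^ i) (\<Sum>i. a i * (x - 0) ^ i) < d"
    unfolding uniform_limit_iff eventually_sequentially by blast
  define Q where "Q = (\<Sum>i<n. monom (a i) i)"
  have Q: "cmod (F z - poly Q z) < d" if "z \<in> cball 0 s" for z
  proof -
    have "(\<Sum>i. a i * z ^ i) = F z" using sums[of z] s that by (auto intro: sums_unique[symmetric])
    then show ?thesis using bspec[OF n that]
      by (simp add: Q_def poly_sum poly_monom dist_norm norm_minus_commute)
  qed
  have "cmod (deriv F z - poly (pderiv Q) z) < e" if z: "z \<in> cball 0 1" for z
  proof -
    have sub: "cball z (s - 1) \<subseteq> cball 0 s"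
      using z by (auto simp: dist_norm) (smt (verit) norm_triangle_ineq4 norm_minus_commute norm_triangle_sub)
    have sub': "cball z (s - 1) \<subseteq> ball 0 r" using sub s by auto
    have hF: "F holomorphic_on ball z (s - 1)"
      using hol sub' by (rule holomorphic_on_subset[OF _ order_trans[OF ball_subset_cball]])
    have "F field_differentiable at z"
      using hol s z by (intro holomorphic_on_imp_differentiable_at[OF hol]) auto
    then have "deriv (\<lambda>z. F z - poly Q z) z = deriv F z - poly (pderiv Q) z"
      by (subst deriv_diff) (auto simp: deriv_poly intro: poly_DERIV field_differentiable_derivI
            simp: field_differentiable_def)
    moreover have "norm ((deriv ^^ 1) (\<lambda>z. F z - poly Q z) z) \<le> (fact 1) * d / (s - 1) ^ 1"
    proof (rule Cauchy_inequality)
      show "(\<lambda>z. F z - poly Q z) holomorphic_on ball z (s - 1)"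
        by (intro holomorphic_intros hF)
      show "continuous_on (cball z (s - 1)) (\<lambda>z. F z - poly Q z)"
        by (intro continuous_intros holomorphic_on_imp_continuous_on holomorphic_on_subset[OF hol sub'])
      show "0 < s - 1" using s by simp
      show "norm (F x - poly Q x) \<le> d" if "norm (z - x) = s - 1" for x
      proof -
        have "x \<in> cball z (s - 1)" using that by (simp add: dist_norm)
        with sub show ?thesis using Q[of x] by (auto intro: less_imp_le)
      qed
    qed
    moreover have "d / (s - 1) < e" using d s by (simp add: field_simps)
    ultimately show ?thesis by simp
  qed
  moreover have "cmod (F z - poly Q z) < e" if "z \<in> cball 0 1" for z
    using Q[of z] that s d by auto
  ultimately show ?thesis by blast
qed

text \<open>First \<open>f\<close> is replaced by a dilation f(r z), which is holomorphic beyond the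
  closed disc, then the dilation by a polynomial. Away from the circle the derivatives are close by
  uniform continuity. Near it both are small after weighting: that of \<open>f\<close> by the
  little-o condition, that of the dilation because the weight at z is at most the weight at r
  z.\<close>

lemma pol_dense:
  assumes w: "majorant w" and f: "f \<in> carr (B0 w)" and e: "0 < e"
  shows "\<exists>Q. norm_dist (B0 w) f (pol Q) < e"
proof -
  have hol: "f holomorphic_on ball 0 1" using f by (simp add: B0_def)
  have hold: "deriv f holomorphic_on ball 0 1" using hol by (rule holomorphic_deriv) simp
  define b0 where "b0 = bloch_weight w 0"
  have b0: "b0 > 0" unfolding b0_def by (rule bloch_weight_pos[OF w]) simp
  have b0_ge: "0 \<le> bloch_weight w z" "bloch_weight w z \<le> b0" if "z \<in> ball 0 1" for z
    using bloch_weight_pos[OF w that] bloch_weight_antimono[OF w, of 0 z] that by (auto simp: b0_def)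
  have "((\<lambda>z. complex_of_real (bloch_weight w z) * deriv f z) \<longlongrightarrow> 0) (filtercomap cmod (at_left 1))"
    using f by (simp add: B0_def)
  then have "\<forall>\<^sub>F z in filtercomap cmod (at_left 1).
      cmod (complex_of_real (bloch_weight w z) * deriv f z) < e / 4"
    using e by (auto dest: tendstoD[of _ 0 _ "e / 4"] simp: dist_norm)
  then obtain P where P: "eventually P (at_left 1)"
      "\<And>z. P (cmod z) \<Longrightarrow> cmod (complex_of_real (bloch_weight w z) * deriv f z) < e / 4"
    by (auto simp: eventually_filtercomap)
  from P(1) obtain b where b: "b < 1" "\<And>y. b < y \<Longrightarrow> y < 1 \<Longrightarrow> P y"
    by (auto simp: eventually_at_left_field)
  define \<rho> where "\<rho> = max b 0"
  define \<rho>' where "\<rho>' = (1 + \<rho>) / 2"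
  have \<rho>: "0 \<le> \<rho>" "\<rho> < \<rho>'" "\<rho>' < 1" "0 < \<rho>'" using b(1) by (auto simp: \<rho>_def \<rho>'_def)
  have small: "bloch_weight w z * cmod (deriv f z) < e / 4" if "\<rho> < cmod z" "cmod z < 1" for z
    using P(2)[of z] b(2)[of "cmod z"] that b0_ge[of z] by (auto simp: norm_mult \<rho>_def)
  \<comment> \<open>The derivative of the dilation as a function of factor and point jointly;
    uniform continuity on a compact product makes \<open>\<delta>\<close> independent of z.\<close>
  let ?G = "\<lambda>(r, z). complex_of_real r * deriv f (complex_of_real r * z)"
  let ?K = "{0..1::real} \<times> cball (0::complex) \<rho>'"
  have inK: "complex_of_real r * z \<in> ball 0 1" if "0 \<le> r" "r \<le> 1" "cmod z < 1" for r z
    using that mult_le_one[of r "cmod z"] mult_left_le_one_le[of "cmod z" r] by (auto simp: norm_mult)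
  have "continuous_on ?K ?G"
    unfolding split_def
    by (intro continuous_intros continuous_on_compose2[OF holomorphic_on_imp_continuous_on[OF hold]])
       (use inK \<rho> in force)
  moreover have "compact ?K" by (intro compact_Times) auto
  ultimately have "uniformly_continuous_on ?K ?G" by (rule compact_uniformly_continuous)
  moreover have "e / (4 * b0) > 0" using e b0 by simp
  ultimately obtain \<delta> where \<delta>: "\<delta> > 0"
    "\<forall>x\<in>?K. \<forall>x'\<in>?K. dist x' x < \<delta> \<longrightarrow> dist (?G x') (?G x) < e / (4 * b0)"
    unfolding uniformly_continuous_on_def by blast
  \<comment> \<open>A factor above \<open>\<rho> / \<rho>'\<close> sends |z| >
    \<open>\<rho>'\<close> to |r z| > \<open>\<rho>\<close>, where the weighted derivative of
    \<open>f\<close> is small; a factor above \<open>1 - \<delta>\<close> is close enough to 1 for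
    the uniform continuity.\<close>
  have "max (\<rho> / \<rho>') (1 - \<delta>) < 1" using \<rho> \<delta>(1) by simp
  then obtain r where r: "max (\<rho> / \<rho>') (1 - \<delta>) < r" "r < 1" using dense by blast
  have "0 \<le> \<rho> / \<rho>'" using \<rho> by simp
  with r have r0: "0 < r" "1 - \<delta> < r" by auto
  have r\<rho>: "\<rho> < r * t" if "\<rho>' < t" for t
  proof -
    have "\<rho> < r * \<rho>'" using r(1) \<rho> by (simp add: field_simps)
    also have "\<dots> \<le> r * t" using that r0 by (intro mult_left_mono) auto
    finally show ?thesis .
  qed
  define F where "F = (\<lambda>z. f (complex_of_real r * z))"
  have "F holomorphic_on ball 0 (1 / r)"
  proof -
    have "(f \<circ> (\<lambda>z. complex_of_real r * z)) holomorphic_on ball 0 (1 / r)"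
      by (rule holomorphic_on_compose_gen[OF _ hol])
         (use r0 in \<open>auto intro!: holomorphic_intros simp: norm_mult field_simps\<close>)
    then show ?thesis by (simp add: F_def o_def)
  qed
  moreover have "1 < 1 / r" using r0 r(2) by simp
  moreover have "0 < min (e / 8) (e / (8 * b0))" using e b0 by simp
  ultimately obtain Q where Q: "\<forall>z\<in>cball 0 1. cmod (F z - poly Q z) < min (e / 8) (e / (8 * b0)) \<and>
      cmod (deriv F z - poly (pderiv Q) z) < min (e / 8) (e / (8 * b0))"
    using poly_approx_holomorphic by meson
  have derF: "deriv F z = complex_of_real r * deriv f (complex_of_real r * z)" if "z \<in> ball 0 1" for z
  proof -
    have "(f has_field_derivative deriv f (complex_of_real r * z)) (at (complex_of_real r * z))"
      using holomorphic_derivI[OF hol open_ball] inK[of r z] that r0 r(2) by simp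
    then have "(F has_field_derivative deriv f (complex_of_real r * z) * complex_of_real r) (at z)"
      unfolding F_def
      by (rule DERIV_chain2[where g = "\<lambda>z. complex_of_real r * z"]) (auto intro!: derivative_eq_intros)
    then show ?thesis by (simp add: DERIV_imp_deriv mult.commute)
  qed
  have "norm_dist (B0 w) f (pol Q) \<le> e / 8 + (e / 2 + e / 8)"
  proof (rule norm_dist_B0_le[OF f pol_in_B0[OF w]])
    show "cmod (f 0 - pol Q 0) \<le> e / 8"
      using bspec[OF Q, of 0] by (simp add: F_def pol_def)
    fix z :: complex assume z: "z \<in> ball 0 1"
    let ?b = "bloch_weight w z"
    have "cmod (deriv f z - deriv (pol Q) z) \<le>
        cmod (deriv f z - deriv F z) + cmod (deriv F z - poly (pderiv Q) z)"
      using norm_triangle_ineq[of "deriv f z - deriv F z" "deriv F z - poly (pderiv Q) z"] z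
      by (simp add: deriv_pol)
    from mult_left_mono[OF this b0_ge(1)[OF z]]
    have "?b * cmod (deriv f z - deriv (pol Q) z) \<le>
        ?b * cmod (deriv f z - deriv F z) + ?b * cmod (deriv F z - poly (pderiv Q) z)"
      by (simp add: distrib_left)
    moreover have "?b * cmod (deriv F z - poly (pderiv Q) z) \<le> b0 * (e / (8 * b0))"
      using bspec[OF Q, of z] z b0_ge[OF z] by (intro mult_mono) auto
    moreover have "b0 * (e / (8 * b0)) = e / 8" "b0 * (e / (4 * b0)) = e / 4" using b0 by simp_all
    moreover have "?b * cmod (deriv f z - deriv F z) \<le> e / 2"
    proof (cases "cmod z \<le> \<rho>'")
      case True
      have "dist (?G (r, z)) (?G (1, z)) < e / (4 * b0)"
        using True r r0 by (intro \<delta>(2)[rule_format]) (auto simp: dist_prod_def dist_real_def)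
      then have "cmod (deriv f z - deriv F z) < e / (4 * b0)"
        using derF[OF z] by (simp add: dist_norm norm_minus_commute)
      then have "?b * cmod (deriv f z - deriv F z) \<le> b0 * (e / (4 * b0))"
        using b0_ge[OF z] by (intro mult_mono) auto
      also have "\<dots> \<le> e / 2" using b0 e by simp
      finally show ?thesis .
    next
      case False
      let ?z = "complex_of_real r * z"
      have z': "?z \<in> ball 0 1" using inK[of r z] z r r0 by simp
      have cz: "cmod ?z = r * cmod z" using r0 by (simp add: norm_mult)
      have le: "r * cmod z \<le> cmod z" using r r0 by (intro mult_left_le_one_le) auto
      have "?b * cmod (deriv F z) \<le> ?b * cmod (deriv f ?z)"
        using r r0 b0_ge[OF z] derF[OF z] by (auto simp: norm_mult intro!: mult_left_mono mult_left_le_one_le)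
      also have "\<dots> \<le> bloch_weight w ?z * cmod (deriv f ?z)"
        using bloch_weight_antimono[OF w, of ?z z] z le cz by (intro mult_right_mono) auto
      also have "\<dots> < e / 4" using z' r\<rho>[of "cmod z"] False cz by (intro small) auto
      finally have 1: "?b * cmod (deriv F z) < e / 4" .
      have "cmod (deriv f z - deriv F z) \<le> cmod (deriv f z) + cmod (deriv F z)"
        by (rule norm_triangle_ineq4)
      from mult_left_mono[OF this b0_ge(1)[OF z]] show ?thesis
        using 1 small[of z] False \<rho> z by (simp add: distrib_left)
    qed
    ultimately show "?b * cmod (deriv f z - deriv (pol Q) z) \<le> e / 2 + e / 8" by linarith
  qed
  also have "\<dots> < e" using e by simp
  finally show ?thesis by blast
qed

subsection \<open>The kernel of the projection is an \<open>L\<^sup>\<infinity>\<close>-module\<close>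

lemma kernel_lincomb:
  assumes w: "majorant w" and E: "E \<in> sets circle" and g: "g \<in> bdd_meas" "g' \<in> bdd_meas"
    and a: "approx E w (\<lambda>z. 0) g" "approx E w (\<lambda>z. 0) g'"
  shows "approx E w (\<lambda>z. 0) (\<lambda>x. g x + c * g' x)"
  using approx_lincomb[OF w E zero_in_B0[OF w] zero_in_B0[OF w] g a] by simp

lemma kernel_zero: "majorant w \<Longrightarrow> approx E w (\<lambda>z. 0) (\<lambda>x. 0)"
proof -
  have "poly 0 = (\<lambda>x::complex. 0)" by (rule ext) simp
  then show "majorant w \<Longrightarrow> approx E w (\<lambda>z. 0) (\<lambda>x. 0)"
    using approx_poly[of w E 0] by (simp only: pol_0)
qed

text \<open>Dominated convergence turns bounded pointwise convergence into convergence of every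
  pairing. Only finitely many pairings are tested at a time, so a single member of the sequence is
  close enough for all of them.\<close>

lemma kernel_bounded_limit:
  assumes w: "majorant w" and E: "E \<in> sets circle" and g: "g \<in> borel_measurable circle"
    and gn: "\<And>n. g_seq n \<in> bdd_meas" and bnd: "\<And>n x. x \<in> sphere 0 1 \<Longrightarrow> cmod (g_seq n x) \<le> C"
    and lim: "\<And>x. x \<in> sphere 0 1 \<Longrightarrow> (\<lambda>n. g_seq n x) \<longlonglongrightarrow> g x"
    and a: "\<And>n. approx E w (\<lambda>z. 0) (g_seq n)"
  shows "g \<in> bdd_meas" "approx E w (\<lambda>z. 0) g"
proof -
  have gC: "cmod (g x) \<le> C" if "x \<in> sphere 0 1" for x
    by (rule Lim_norm_ubound[OF _ lim[OF that]]) (use bnd[OF that] in auto)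
  then show gb: "g \<in> bdd_meas" by (rule bdd_measI[OF g])
  have conv: "(\<lambda>n. pairing E (g_seq n) h) \<longlonglongrightarrow> pairing E g h" if h: "integrable circle h" for h
    unfolding pairing_def set_lebesgue_integral_def
  proof (rule integral_dominated_convergence[where w = "\<lambda>x. C * cmod (h x)"])
    show "(\<lambda>x. indicator E x *\<^sub>R (g x * h x)) \<in> borel_measurable circle"
      using set_integrable_bdd_mult[OF E gb h] by (simp add: set_integrable_def)
    show "(\<lambda>x. indicator E x *\<^sub>R (g_seq n x * h x)) \<in> borel_measurable circle" for n
      using set_integrable_bdd_mult[OF E gn h] by (simp add: set_integrable_def)
    show "integrable circle (\<lambda>x. C * cmod (h x))" using h by simp
    show "AE x in circle. (\<lambda>n. indicator E x *\<^sub>R (g_seq n x * h x)) \<longlonglongrightarrow> indicator E x *\<^sub>R (g x * h x)"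
      by (rule AE_I2, intro tendsto_intros lim) (simp add: space_circle)
    show "AE x in circle. norm (indicator E x *\<^sub>R (g_seq n x * h x)) \<le> C * cmod (h x)" for n
    proof (rule AE_I2)
      fix x assume "x \<in> space circle"
      then have x: "cmod (g_seq n x) \<le> C" by (intro bnd) (simp add: space_circle)
      then have "cmod (g_seq n x) * cmod (h x) \<le> C * cmod (h x)" "0 \<le> C * cmod (h x)"
        using order_trans[OF norm_ge_zero x] by (auto intro!: mult_right_mono)
      then show "norm (indicator E x *\<^sub>R (g_seq n x * h x)) \<le> C * cmod (h x)"
        by (simp add: indicator_def norm_mult)
    qed
  qed
  show "approx E w (\<lambda>z. 0) g"
  proof (rule approx_closure[OF w E zero_in_B0[OF w] gb])
    fix e :: real and H :: "(complex \<Rightarrow> complex) set"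
    assume e: "e > 0" and H: "finite H" "\<forall>h\<in>H. integrable circle h"
    have "\<forall>h\<in>H. \<forall>\<^sub>F n in sequentially. cmod (pairing E (\<lambda>x. g x - g_seq n x) h) < e"
    proof
      fix h assume "h \<in> H"
      then have h: "integrable circle h" using H by auto
      from tendstoD[OF conv[OF h] e] show "\<forall>\<^sub>F n in sequentially. cmod (pairing E (\<lambda>x. g x - g_seq n x) h) < e"
        by eventually_elim (simp add: pairing_diff[OF E gb gn h] dist_norm norm_minus_commute)
    qed
    then have "\<forall>\<^sub>F n in sequentially. \<forall>h\<in>H. cmod (pairing E (\<lambda>x. g x - g_seq n x) h) < e"
      using H(1) by (simp add: eventually_ball_finite_distrib)
    then obtain n where "\<forall>h\<in>H. cmod (pairing E (\<lambda>x. g x - g_seq n x) h) < e"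
      unfolding eventually_sequentially by blast
    moreover have "norm_dist (B0 w) (\<lambda>z. 0) (\<lambda>z. 0) = 0"
      using Metric_space.mdist_zero[OF Metric_space_B0[OF w] zero_in_B0[OF w]] .
    ultimately show "\<exists>f'\<in>carr (B0 w). \<exists>g'\<in>bdd_meas. approx E w f' g' \<and> norm_dist (B0 w) (\<lambda>z. 0) f' < e \<and>
        (\<forall>h\<in>H. cmod (pairing E (\<lambda>x. g x - g' x) h) < e)"
      using e by (intro bexI[of _ "\<lambda>z. 0"] bexI[of _ "g_seq n"] conjI a gn zero_in_B0[OF w]) auto
  qed
qed

text \<open>The functions that map the kernel into itself form an algebra closed under bounded
  pointwise limits. The kernel contains no constants to start from, unless it is everything, whereas
  constants are always multipliers.\<close>

definition multiplier :: "complex set \<Rightarrow> (real \<Rightarrow> real) \<Rightarrow> (complex \<Rightarrow> complex) \<Rightarrow> bool" where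
  "multiplier E w \<phi> \<longleftrightarrow> \<phi> \<in> bdd_meas \<and>
     (\<forall>g\<in>bdd_meas. approx E w (\<lambda>z. 0) g \<longrightarrow> approx E w (\<lambda>z. 0) (\<lambda>x. \<phi> x * g x))"

section \<open>From the two shifts to all bounded measurable multipliers\<close>

context
  fixes w :: "real \<Rightarrow> real" and E :: "complex set"
  assumes w: "majorant w" and E: "E \<in> sets circle"
begin

lemma multiplier_const: "multiplier E w (\<lambda>x. c)"
  unfolding multiplier_def
proof (intro conjI ballI impI)
  have z: "(\<lambda>x. 0) \<in> bdd_meas" by simp
  have "approx E w (\<lambda>z. 0) (\<lambda>x. 0)" by (rule kernel_zero[OF w])
  then show "approx E w (\<lambda>z. 0) (\<lambda>x. c * g x)" if "g \<in> bdd_meas" "approx E w (\<lambda>z. 0) g" for g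
    using kernel_lincomb[OF w E z that(1) _ that(2), of c] by simp
qed simp

lemma multiplier_mult:
  assumes "multiplier E w \<phi>" "multiplier E w \<psi>" shows "multiplier E w (\<lambda>x. \<phi> x * \<psi> x)"
  using assms unfolding multiplier_def by (auto simp: mult.assoc intro!: bdd_meas_mult)

lemma multiplier_add:
  assumes "multiplier E w \<phi>" "multiplier E w \<psi>" shows "multiplier E w (\<lambda>x. \<phi> x + \<psi> x)"
  unfolding multiplier_def
proof (intro conjI ballI impI)
  show "(\<lambda>x. \<phi> x + \<psi> x) \<in> bdd_meas" using assms by (auto simp: multiplier_def intro: bdd_meas_add)
  fix g assume g: "g \<in> bdd_meas" "approx E w (\<lambda>z. 0) g"
  have "approx E w (\<lambda>z. 0) (\<lambda>x. \<phi> x * g x + 1 * (\<psi> x * g x))"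
    by (rule kernel_lincomb[OF w E]) (use assms g in \<open>auto simp: multiplier_def intro: bdd_meas_mult\<close>)
  then show "approx E w (\<lambda>z. 0) (\<lambda>x. (\<phi> x + \<psi> x) * g x)" by (simp add: distrib_right)
qed

lemma multiplier_cmult: "multiplier E w \<phi> \<Longrightarrow> multiplier E w (\<lambda>x. c * \<phi> x)"
  by (rule multiplier_mult[OF multiplier_const])

lemma multiplier_sum:
  assumes "\<And>i. i \<in> I \<Longrightarrow> multiplier E w (\<phi> i)" shows "multiplier E w (\<lambda>x. \<Sum>i\<in>I. \<phi> i x)"
  using assms
proof (induction I rule: infinite_finite_induct)
  case (insert i I)
  then have "multiplier E w (\<lambda>x. \<phi> i x + (\<Sum>i\<in>I. \<phi> i x))" by (intro multiplier_add) auto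
  then show ?case using insert by simp
qed (auto intro: multiplier_const)

lemma multiplier_bounded_limit:
  assumes \<phi>: "\<phi> \<in> borel_measurable circle" and m: "\<And>n. multiplier E w (\<phi>_seq n)"
    and bnd: "\<And>n x. x \<in> sphere 0 1 \<Longrightarrow> cmod (\<phi>_seq n x) \<le> C"
    and lim: "\<And>x. x \<in> sphere 0 1 \<Longrightarrow> (\<lambda>n. \<phi>_seq n x) \<longlonglongrightarrow> \<phi> x"
  shows "multiplier E w \<phi>"
  unfolding multiplier_def
proof (intro conjI ballI impI)
  have "cmod (\<phi> x) \<le> C" if "x \<in> sphere 0 1" for x
    by (rule Lim_norm_ubound[OF _ lim[OF that]]) (use bnd[OF that] in auto)
  then show "\<phi> \<in> bdd_meas" by (rule bdd_measI[OF \<phi>])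
  fix g assume g: "g \<in> bdd_meas" "approx E w (\<lambda>z. 0) g"
  obtain D where D: "g \<in> borel_measurable circle" "0 \<le> D" "\<forall>x\<in>sphere 0 1. cmod (g x) \<le> D"
    by (rule bdd_measE[OF g(1)])
  show "approx E w (\<lambda>z. 0) (\<lambda>x. \<phi> x * g x)"
  proof (rule kernel_bounded_limit(2)[OF w E, where g_seq = "\<lambda>n x. \<phi>_seq n x * g x" and C = "C * D"])
    show "(\<lambda>x. \<phi> x * g x) \<in> borel_measurable circle" using \<phi> D(1) by measurable
    show "(\<lambda>x. \<phi>_seq n x * g x) \<in> bdd_meas" for n
      using m[of n] g(1) by (auto simp: multiplier_def intro: bdd_meas_mult)
    show "approx E w (\<lambda>z. 0) (\<lambda>x. \<phi>_seq n x * g x)" for n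
      using m[of n] g by (auto simp: multiplier_def)
    fix x :: complex assume x: "x \<in> sphere 0 1"
    show "(\<lambda>n. \<phi>_seq n x * g x) \<longlonglongrightarrow> \<phi> x * g x" by (intro tendsto_intros lim x)
    show "cmod (\<phi>_seq n x * g x) \<le> C * D" for n
      using bnd[OF x, of n] D(3) x order_trans[OF norm_ge_zero bnd[OF x, of n]]
      by (auto simp: norm_mult intro!: mult_mono)
  qed
qed

lemma multiplier_id: "multiplier E w (\<lambda>x. x)"
  unfolding multiplier_def using kernel_forward[OF w E]
  by (auto intro!: bdd_meas_continuous continuous_intros)

lemma multiplier_cnj: "multiplier E w cnj"
  unfolding multiplier_def using kernel_backward[OF w E]
  by (auto intro!: bdd_meas_continuous continuous_intros)

lemma multiplier_real_polynomial:
  assumes "real_polynomial_function p"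
  shows "multiplier E w (\<lambda>x. complex_of_real (p x))"
  using assms
proof (induction rule: real_polynomial_function.induct)
  case (linear f)
  interpret bounded_linear f by fact
  \<comment> \<open>Real linearity gives f(x) = Re x f(1) + Im x f(\<i>); the coefficients result
    from Re x = (x + cnj x) / 2 and Im x = (x - cnj x) / (2 \<i>).\<close>
  have "(\<lambda>x. complex_of_real (f x)) = (\<lambda>x. (f 1 / 2 + f \<i> / (2 * \<i>)) * x + (f 1 / 2 - f \<i> / (2 * \<i>)) * cnj x)"
  proof (rule ext)
    fix x
    have "f x = f (Re x *\<^sub>R 1 + Im x *\<^sub>R \<i>)" by (rule arg_cong[of _ _ f]) (simp add: complex_eq_iff)
    then have "f x = Re x * f 1 + Im x * f \<i>" by (simp add: add scaleR)
    then show "complex_of_real (f x) = (f 1 / 2 + f \<i> / (2 * \<i>)) * x + (f 1 / 2 - f \<i> / (2 * \<i>)) * cnj x"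
      by (simp add: complex_eq_iff)
  qed
  then show ?case
    by (rule ssubst) (intro multiplier_add multiplier_cmult multiplier_id multiplier_cnj)
next
  case (const c) show ?case by (rule multiplier_const)
next
  case (add f g) then show ?case by (simp add: multiplier_add)
next
  case (mult f g) then show ?case by (simp add: multiplier_mult)
qed

lemma multiplier_continuous:
  fixes p :: "complex \<Rightarrow> real"
  assumes c: "continuous_on UNIV p"
  shows "multiplier E w (\<lambda>x. complex_of_real (p x))"
proof -
  have cs: "continuous_on (sphere 0 1) p" by (rule continuous_on_subset[OF c]) simp
  have "\<exists>q. real_polynomial_function q \<and> (\<forall>x\<in>sphere 0 1. \<bar>p x - q x\<bar> < 1 / Suc n)" for n
    using Stone_Weierstrass_real_polynomial_function[OF compact_sphere cs, of "1 / Suc n"]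
    by (metis of_nat_0_less_iff zero_less_Suc zero_less_divide_1_iff)
  then obtain q where q: "\<And>n. real_polynomial_function (q n)"
    "\<And>n x. x \<in> sphere 0 1 \<Longrightarrow> \<bar>p x - q n x\<bar> < 1 / Suc n" by metis
  obtain B where B: "\<forall>x\<in>sphere 0 1. norm (p x) \<le> B"
    using compact_continuous_norm_bound[OF compact_sphere cs] by blast
  show ?thesis
  \<comment> \<open>All approximation errors are below 1, so \<open>B + 1\<close> bounds every
    \<open>q n\<close> on the circle.\<close>
  proof (rule multiplier_bounded_limit[where \<phi>_seq = "\<lambda>n x. complex_of_real (q n x)" and C = "B + 1"])
    show "(\<lambda>x. complex_of_real (p x)) \<in> borel_measurable circle"
      by (intro borel_measurable_circle borel_measurable_continuous_onI continuous_intros c)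
    show "multiplier E w (\<lambda>x. complex_of_real (q n x))" for n
      by (rule multiplier_real_polynomial[OF q(1)])
    fix x :: complex assume x: "x \<in> sphere 0 1"
    show "cmod (complex_of_real (q n x)) \<le> B + 1" for n
    proof -
      have "1 / real (Suc n) \<le> 1" "\<bar>p x\<bar> \<le> B" using B x by simp_all
      then show ?thesis using q(2)[OF x, of n] unfolding norm_of_real by linarith
    qed
    have "(\<lambda>n. q n x) \<longlonglongrightarrow> p x"
    proof (rule LIMSEQ_I)
      fix r :: real assume "r > 0"
      then obtain N where N: "1 / Suc N < r" using nat_approx_posE by blast
      have "norm (q n x - p x) < r" if "n \<ge> N" for n
      proof -
        have "1 / real (Suc n) \<le> 1 / Suc N" using that by (intro divide_left_mono) auto
        then show ?thesis using q(2)[OF x, of n] N by (simp add: abs_minus_commute)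
      qed
      then show "\<exists>no. \<forall>n\<ge>no. norm (q n x - p x) < r" by blast
    qed
    then show "(\<lambda>n. complex_of_real (q n x)) \<longlonglongrightarrow> complex_of_real (p x)" by (rule tendsto_of_real)
  qed
qed

text \<open>The continuous functions max(0, 1 - n dist(x, T)) stay between 0 and 1 and converge to
  the indicator at every point, as the distance vanishes on the closed set \<open>T\<close> and
  nowhere else.\<close>

lemma multiplier_indicator_closed:
  assumes T: "closed T"
  shows "multiplier E w (indicator T)"
proof (cases "T = {}")
  \<comment> \<open>The empty set is treated apart because \<open>infdist\<close> to it is 0 by
    convention, so that the approximants would all equal 1.\<close>
  case True
  then show ?thesis using multiplier_const[of 0] by (simp add: indicator_def[abs_def])
next
  case False
  show ?thesis
  proof (rule multiplier_bounded_limit[where C = 1 and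
        \<phi>_seq = "\<lambda>n x. complex_of_real (max 0 (1 - real n * infdist x T))"])
    show "(indicator T :: complex \<Rightarrow> complex) \<in> borel_measurable circle"
      using T by (intro borel_measurable_circle borel_measurable_indicator) simp
    show "multiplier E w (\<lambda>x. complex_of_real (max 0 (1 - real n * infdist x T)))" for n
      by (intro multiplier_continuous continuous_intros)
    fix x :: complex assume x: "x \<in> sphere 0 1"
    show "cmod (complex_of_real (max 0 (1 - real n * infdist x T))) \<le> 1" for n
      using infdist_nonneg[of x T] by (auto simp: norm_of_real)
    show "(\<lambda>n. complex_of_real (max 0 (1 - real n * infdist x T))) \<longlonglongrightarrow> indicator T x"
    proof (cases "x \<in> T")
      case True
      then show ?thesis by simp
    next
      case xT: False
      have pos: "infdist x T > 0"
        using in_closed_iff_infdist_zero[OF T False, of x] infdist_nonneg[of x T] xT by linarith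
      obtain N where N: "1 / infdist x T < real N" using reals_Archimedean2 by blast
      have "max 0 (1 - real n * infdist x T) = 0" if "n \<ge> N" for n
      proof -
        have "1 < real N * infdist x T" using N pos by (simp add: field_simps)
        also have "\<dots> \<le> real n * infdist x T" using that pos by (intro mult_right_mono) auto
        finally show ?thesis by simp
      qed
      then have "\<forall>\<^sub>F n in sequentially. complex_of_real (max 0 (1 - real n * infdist x T)) = indicator T x"
        using xT by (auto simp: eventually_sequentially)
      then show ?thesis by (rule tendsto_eventually)
    qed
  qed
qed

text \<open>Dynkin's argument: closed sets are stable under intersection and generate the Borel
  sets, and the sets whose indicators are multipliers are closed under complements and countable
  disjoint unions.\<close>

lemma multiplier_indicator_borel:
  assumes "T \<in> sets (borel :: complex measure)"
  shows "multiplier E w (indicator T)"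
proof -
  have "Int_stable (Collect (closed :: complex set \<Rightarrow> bool))" "Collect closed \<subseteq> Pow UNIV"
    by (auto simp: Int_stable_def)
  moreover have "T \<in> sigma_sets UNIV (Collect closed)"
    using assms by (simp add: borel_eq_closed)
  ultimately show ?thesis
  proof (induction rule: sigma_sets_induct_disjoint)
    case (basic A)
    then show ?case by (simp add: multiplier_indicator_closed)
  next
    case empty
    show ?case by (rule multiplier_indicator_closed) simp
  next
    case (compl A)
    have "multiplier E w (\<lambda>x. 1 + (-1) * indicator A x)"
      by (intro multiplier_add multiplier_cmult multiplier_const compl.IH)
    moreover have "(indicator (UNIV - A) :: complex \<Rightarrow> complex) = (\<lambda>x. 1 + (-1) * indicator A x)"
      by (auto simp: indicator_def)
    ultimately show ?case by simp
  next
    case (union A)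
    \<comment> \<open>Disjointness makes each partial sum an indicator, hence bounded by 1
      independently of n.\<close>
    have eq: "(\<Sum>i<n. indicator (A i) x) = (indicator (\<Union>i<n. A i) x :: complex)" for n x
      using union.hyps(1) by (subst indicator_UN_disjoint) (auto intro: disjoint_family_on_mono)
    show ?case
    proof (rule multiplier_bounded_limit[where C = 1 and \<phi>_seq = "\<lambda>n x. \<Sum>i<n. indicator (A i) x"])
      have "range A \<subseteq> sets borel"
        using union.hyps(2) by (simp add: borel_eq_closed)
      then have "(\<Union>i. A i) \<in> sets borel" by (rule sets.countable_UN)
      then show "(indicator (\<Union>i. A i) :: complex \<Rightarrow> complex) \<in> borel_measurable circle"
        by (intro borel_measurable_circle borel_measurable_indicator)
      show "multiplier E w (\<lambda>x. \<Sum>i<n. indicator (A i) x)" for n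
        by (intro multiplier_sum union.IH)
      show "cmod (\<Sum>i<n. indicator (A i) x) \<le> 1" for n x
        unfolding eq by (simp add: indicator_def)
      show "(\<lambda>n. \<Sum>i<n. indicator (A i) x) \<longlonglongrightarrow> (indicator (\<Union>i. A i) x :: complex)" for x
        unfolding eq by (rule LIMSEQ_indicator_UN)
    qed
  qed
qed

lemma multiplier_cong:
  assumes "multiplier E w \<phi>" "\<psi> \<in> bdd_meas" "AE x in circle. \<phi> x = \<psi> x"
  shows "multiplier E w \<psi>"
  unfolding multiplier_def
proof (intro conjI ballI impI)
  fix g assume g: "g \<in> bdd_meas" "approx E w (\<lambda>z. 0) g"
  show "approx E w (\<lambda>z. 0) (\<lambda>x. \<psi> x * g x)"
    by (rule approx_cong[of E w _ "\<lambda>x. \<phi> x * g x"])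
       (use assms g E in \<open>auto simp: multiplier_def intro: bdd_meas_mult elim!: eventually_mono\<close>)
qed fact

text \<open>\<open>circle\<close> is a completion, so a measurable set differs from a Borel set by a
  subset of a null set, and null sets do not affect \<open>approx\<close>.\<close>

lemma multiplier_indicator:
  assumes "T \<in> sets circle"
  shows "multiplier E w (indicator T)"
proof -
  obtain S N N' where S: "T = S \<union> N" "N \<subseteq> N'"
      and N': "N' \<in> null_sets (distr (uniform_measure lborel {0..1})
        (restrict_space borel (sphere 0 1)) (\<lambda>t. cis (2 * pi * t)))"
      and SM: "S \<in> sets (distr (uniform_measure lborel {0..1})
        (restrict_space borel (sphere 0 1)) (\<lambda>t. cis (2 * pi * t)))"
    using assms unfolding circle_def by (rule sets_completionE)
  have "S \<in> sets borel" using SM by (simp add: sets_restrict_space_iff)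
  moreover have "AE x in circle. x \<notin> N'"
    unfolding circle_def by (rule AE_completion[OF AE_not_in[OF N']])
  then have "AE x in circle. indicator S x = (indicator T x :: complex)"
    by eventually_elim (use S in \<open>auto simp: indicator_def\<close>)
  ultimately show ?thesis
    using multiplier_cong[OF multiplier_indicator_borel bdd_meas_indicator[OF assms]] by blast
qed

lemma multiplier_bdd_meas:
  assumes g: "g \<in> bdd_meas"
  shows "multiplier E w g"
proof -
  obtain C where C: "g \<in> borel_measurable circle" "0 \<le> C" "\<forall>x\<in>sphere 0 1. cmod (g x) \<le> C"
    by (rule bdd_measE[OF g])
  obtain F where F: "\<And>i. simple_function circle (F i)" "\<And>x. x \<in> space circle \<Longrightarrow> (\<lambda>i. F i x) \<longlonglongrightarrow> g x"
    "\<And>i x. x \<in> space circle \<Longrightarrow> dist (F i x) 0 \<le> 2 * dist (g x) 0"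
    using borel_measurable_implies_sequence_metric[OF C(1), of 0] by metis
  \<comment> \<open>The simple function written as an explicit finite combination of indicators, the
    form to which closure under sums applies.\<close>
  define F' where "F' i = (\<lambda>x. \<Sum>y\<in>F i ` space circle. y * indicator (F i -` {y} \<inter> space circle) x)" for i
  have F': "F' i x = F i x" if x: "x \<in> sphere 0 1" for i x
  proof -
    have "F' i x = (\<Sum>y\<in>F i ` space circle. if y = F i x then y else 0)"
      unfolding F'_def using x by (intro sum.cong) (auto simp: indicator_def space_circle)
    then show ?thesis
      using x simple_functionD(1)[OF F(1)] by (simp add: space_circle)
  qed
  show ?thesis
  proof (rule multiplier_bounded_limit[where \<phi>_seq = F' and C = "2 * C"])
    show "multiplier E w (F' i)" for i
      unfolding F'_def
      by (intro multiplier_sum multiplier_cmult multiplier_indicator simple_functionD(2)[OF F(1)])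
    fix x :: complex assume x: "x \<in> sphere 0 1"
    show "(\<lambda>i. F' i x) \<longlonglongrightarrow> g x" using F(2)[of x] x by (simp add: F' space_circle)
    show "cmod (F' i x) \<le> 2 * C" for i using F(3)[of x i] C(3) x by (force simp: F' space_circle)
  qed (use C in auto)
qed

lemma kernel_mult:
  "\<phi> \<in> bdd_meas \<Longrightarrow> g \<in> bdd_meas \<Longrightarrow> approx E w (\<lambda>z. 0) g \<Longrightarrow> approx E w (\<lambda>z. 0) (\<lambda>x. \<phi> x * g x)"
  using multiplier_bdd_meas by (simp add: multiplier_def)

subsection \<open>The support of the kernel\<close>

lemma kernel_indicator_Un:
  assumes "S \<in> sets circle" "T \<in> sets circle"
    and "approx E w (\<lambda>z. 0) (indicator S)" "approx E w (\<lambda>z. 0) (indicator T)"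
  shows "approx E w (\<lambda>z. 0) (indicator (S \<union> T))"
proof -
  have bm: "indicator S \<in> bdd_meas" "indicator T \<in> bdd_meas" using assms by (auto intro: bdd_meas_indicator)
  \<comment> \<open>The indicator of the union is that of \<open>S\<close> plus (1 - indicator of
    \<open>S\<close>) times that of \<open>T\<close>.\<close>
  have "(\<lambda>x. 1 - indicator S x) \<in> bdd_meas" by (intro bdd_meas_diff bm) simp
  from kernel_lincomb[OF w E bm(1) bdd_meas_mult[OF this bm(2)] assms(3) kernel_mult[OF this bm(2) assms(4)], of 1]
  show ?thesis
    by (rule back_subst[of "approx E w (\<lambda>z. 0)"]) (auto simp: indicator_def)
qed

lemma kernel_indicator_UN:
  assumes T: "\<And>n::nat. T n \<in> sets circle" "\<And>n. approx E w (\<lambda>z. 0) (indicator (T n))"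
  shows "approx E w (\<lambda>z. 0) (indicator (\<Union>n. T n))"
proof -
  have Un: "approx E w (\<lambda>z. 0) (indicator (\<Union>i<n. T i))" for n
  proof (induction n)
    case 0
    have "approx E w (\<lambda>z. 0) (\<lambda>x. 0)" by (rule kernel_zero[OF w])
    then show ?case by (simp add: indicator_def[abs_def])
  next
    case (Suc n)
    have "approx E w (\<lambda>z. 0) (indicator (T n \<union> (\<Union>i<n. T i)))"
      by (intro kernel_indicator_Un Suc T) (use T in auto)
    then show ?case by (simp add: lessThan_Suc)
  qed
  show ?thesis
  proof (rule kernel_bounded_limit(2)[OF w E, where C = 1 and g_seq = "\<lambda>n. indicator (\<Union>i<n. T i)"])
    show "(\<lambda>n. indicator (\<Union>i<n. T i) x) \<longlonglongrightarrow> (indicator (\<Union>n. T n) x :: complex)" for x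
      by (rule LIMSEQ_indicator_UN)
    show "cmod (indicator (\<Union>i<n. T i) x) \<le> 1" for n x by (simp add: indicator_def)
  qed (use T Un in \<open>auto intro!: bdd_meas_indicator\<close>)
qed

text \<open>Where |g| > 1/(n+1), division by g is a bounded operation, so the module property yields
  the indicator of this set; the union over n is the set where g does not vanish.\<close>

lemma kernel_indicator_nonzero:
  assumes g: "g \<in> bdd_meas" and a: "approx E w (\<lambda>z. 0) g"
  shows "{x \<in> E. g x \<noteq> 0} \<in> sets circle" "approx E w (\<lambda>z. 0) (indicator {x \<in> E. g x \<noteq> 0})"
proof -
  have E_space: "E \<subseteq> space circle" using sets_circle_subset[OF E] by (simp add: space_circle)
  have gm[measurable]: "g \<in> borel_measurable circle" and [measurable]: "E \<in> sets circle"
    using g E by auto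
  define T where "T n = {x \<in> space circle. x \<in> E \<and> 1 / real (Suc n) < cmod (g x)}" for n
  have T: "T n \<in> sets circle" for n unfolding T_def by measurable
  have UT: "{x \<in> E. g x \<noteq> 0} = (\<Union>n. T n)"
  proof (intro set_eqI iffI)
    fix x assume "x \<in> {x \<in> E. g x \<noteq> 0}"
    then have x: "x \<in> E" "0 < cmod (g x)" by auto
    from nat_approx_posE[OF x(2)] obtain n where "1 / real (Suc n) < cmod (g x)" .
    then show "x \<in> (\<Union>n. T n)" using x E_space unfolding T_def by blast
  qed (auto simp: T_def)
  show "{x \<in> E. g x \<noteq> 0} \<in> sets circle" unfolding UT using T by auto
  have "approx E w (\<lambda>z. 0) (indicator (T n))" for n
  proof -
    define \<phi> where "\<phi> = (\<lambda>x. indicator (T n) x / g x)"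
    have \<phi>: "\<phi> \<in> bdd_meas"
    proof (rule bdd_measI)
      show "\<phi> \<in> borel_measurable circle" unfolding \<phi>_def using T by measurable
      show "cmod (\<phi> x) \<le> real (Suc n)" for x
      proof (cases "x \<in> T n")
        case True
        then have "1 / real (Suc n) < cmod (g x)" by (simp add: T_def)
        moreover from this have "0 < cmod (g x)" by (meson less_trans of_nat_0_less_iff zero_less_Suc zero_less_divide_1_iff)
        ultimately have "1 / cmod (g x) < real (Suc n)" by (simp add: field_simps del: of_nat_Suc)
        then show ?thesis using True by (simp add: \<phi>_def norm_divide)
      qed (simp add: \<phi>_def)
    qed
    have "\<phi> x * g x = indicator (T n) x" for x
      by (auto simp: \<phi>_def indicator_def T_def)
    with kernel_mult[OF \<phi> g a] show ?thesis by (simp add: indicator_def[abs_def])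
  qed
  then show "approx E w (\<lambda>z. 0) (indicator {x \<in> E. g x \<noteq> 0})"
    unfolding UT by (intro kernel_indicator_UN T)
qed

text \<open>\<open>S\<close> is a subset of \<open>E\<close> of largest measure whose indicator lies in the kernel.\<close>

theorem kernel_support:
  shows "\<exists>S. S \<in> sets circle \<and> S \<subseteq> E \<and>
    (\<forall>g\<in>bdd_meas. approx E w (\<lambda>z. 0) g \<longleftrightarrow> (AE x in circle. x \<in> E - S \<longrightarrow> g x = 0))"
proof -
  define \<T> where "\<T> = {T \<in> sets circle. T \<subseteq> E \<and> approx E w (\<lambda>z. 0) (indicator T)}"
  have zero: "approx E w (\<lambda>z. 0) (\<lambda>x. 0)" by (rule kernel_zero[OF w])
  then have "{} \<in> \<T>" by (simp add: \<T>_def indicator_def[abs_def])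
  define s where "s = (SUP T\<in>\<T>. measure circle T)"
  have bdd: "bdd_above (measure circle ` \<T>)" by (rule bdd_aboveI2[of _ _ 1]) simp
  have "\<exists>T\<in>\<T>. s - 1 / real (Suc n) < measure circle T" for n
    using \<open>{} \<in> \<T>\<close> bdd unfolding s_def by (subst less_cSUP_iff[symmetric]) auto
  then obtain T where T: "\<And>n. T n \<in> \<T>" "\<And>n. s - 1 / real (Suc n) < measure circle (T n)" by metis
  define S where "S = (\<Union>n. T n)"
  have S: "S \<in> \<T>" unfolding S_def \<T>_def using T(1) kernel_indicator_UN[of T] by (auto simp: \<T>_def)
  have "s \<le> measure circle S"
  proof (rule field_le_epsilon)
    fix e :: real assume "e > 0"
    then obtain n where n: "1 / real (Suc n) < e" using nat_approx_posE by blast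
    have "measure circle (T n) \<le> measure circle S"
      using S T(1) by (intro circle.finite_measure_mono) (auto simp: S_def \<T>_def)
    then show "s \<le> measure circle S + e" using T(2)[of n] n by linarith
  qed
  have "AE x in circle. x \<in> E - S \<longrightarrow> g x = 0" if g: "g \<in> bdd_meas" "approx E w (\<lambda>z. 0) g" for g
  proof -
    let ?T = "{x \<in> E. g x \<noteq> 0}"
    note T' = kernel_indicator_nonzero[OF g]
    \<comment> \<open>\<open>S\<close> attains the supremum \<open>s\<close>, so enlarging it by the
      set where g does not vanish cannot add measure.\<close>
    have "S \<union> ?T \<in> \<T>" using S T' by (auto simp: \<T>_def intro!: kernel_indicator_Un)
    then have "measure circle (S \<union> ?T) \<le> s" unfolding s_def by (rule cSUP_upper[OF _ bdd])
    moreover have "measure circle (S \<union> (?T - S)) = measure circle S + measure circle (?T - S)"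
      using S T'(1) by (intro circle.finite_measure_Union) (auto simp: \<T>_def)
    ultimately have "measure circle (?T - S) = 0"
      using \<open>s \<le> measure circle S\<close> measure_nonneg[of circle "?T - S"] unfolding Un_Diff_cancel by linarith
    then have "?T - S \<in> null_sets circle"
      using S T'(1) by (intro null_setsI) (auto simp: \<T>_def circle.emeasure_eq_measure)
    from AE_not_in[OF this] show ?thesis by eventually_elim auto
  qed
  moreover have "approx E w (\<lambda>z. 0) g" if g: "g \<in> bdd_meas" and ae: "AE x in circle. x \<in> E - S \<longrightarrow> g x = 0" for g
  proof (rule approx_cong[OF kernel_mult[OF g, of "indicator S"] E])
    show "AE x in circle. x \<in> E \<longrightarrow> g x * indicator S x = g x"
      using ae by eventually_elim (auto simp: indicator_def)
  qed (use S g in \<open>auto simp: \<T>_def intro!: bdd_meas_indicator bdd_meas_mult\<close>)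
  ultimately show ?thesis using S unfolding \<T>_def by blast
qed

end

subsection \<open>Moebius transformations of the disc\<close>

definition mob :: "complex \<Rightarrow> complex \<Rightarrow> complex \<Rightarrow> complex" where
  "mob u a z = u * (z - a) / (1 - cnj a * z)"

locale disc_moebius =
  fixes u a :: complex
  assumes u: "cmod u = 1" and a: "cmod a < 1"
begin

lemma u_cnj: "cnj u * u = 1" "u * cnj u = 1"
  using u complex_norm_square[of u] by (simp_all add: mult.commute)

lemma a_cnj: "1 - cnj a * a \<noteq> 0"
proof -
  have "(cmod a)\<^sup>2 < 1" using a by (simp add: power_less_one_iff)
  then have "complex_of_real ((cmod a)\<^sup>2) \<noteq> 1" by (metis of_real_eq_1_iff less_irrefl)
  then show ?thesis using complex_norm_square[of a] by (simp add: mult.commute)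
qed

text \<open>A number strictly between 1 and the modulus 1/|a| of the pole, in a form that also makes
  sense for a = 0.\<close>

definition radius :: real where "radius = 2 / (1 + cmod a)"

lemma radius: "1 < radius" "cmod a * radius < 1"
  using a by (auto simp: radius_def field_simps add_pos_nonneg)

lemma denom_nz: assumes "cmod z < radius" shows "1 - cnj a * z \<noteq> 0"
proof
  assume "1 - cnj a * z = 0"
  then have "cmod (cnj a * z) = 1" by simp
  moreover have "cmod a * cmod z \<le> cmod a * radius" using assms by (intro mult_left_mono) auto
  ultimately show False using radius(2) by (simp add: norm_mult)
qed

lemma denom_nz': "cmod z \<le> 1 \<Longrightarrow> 1 - cnj a * z \<noteq> 0"
  using denom_nz[of z] radius(1) by simp

lemma mob_holomorphic: "mob u a holomorphic_on ball 0 radius"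
  unfolding mob_def by (intro holomorphic_intros) (use denom_nz in auto)

lemma mob_norm:
  assumes "cmod z \<le> 1"
  shows "1 - (cmod (mob u a z))\<^sup>2 = (1 - (cmod z)\<^sup>2) * (1 - (cmod a)\<^sup>2) / (cmod (1 - cnj a * z))\<^sup>2"
proof -
  have nz: "(cmod (1 - cnj a * z))\<^sup>2 \<noteq> 0" using denom_nz'[OF assms] by simp
  have "(cmod (1 - cnj a * z))\<^sup>2 - (cmod (z - a))\<^sup>2 = (1 - (cmod z)\<^sup>2) * (1 - (cmod a)\<^sup>2)"
    unfolding cmod_power2 by (simp add: power2_eq_square algebra_simps)
  moreover have "(cmod (mob u a z))\<^sup>2 = (cmod (z - a))\<^sup>2 / (cmod (1 - cnj a * z))\<^sup>2"
    using u by (simp add: mob_def norm_mult norm_divide power_divide)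
  ultimately show ?thesis using nz by (simp add: field_simps)
qed

lemma a_sq: "0 < 1 - (cmod a)\<^sup>2" "1 - (cmod a)\<^sup>2 \<le> 1"
  using a by (simp_all add: power_less_one_iff)

lemma mob_sphere: assumes "cmod z = 1" shows "cmod (mob u a z) = 1"
proof -
  have "(cmod (mob u a z))\<^sup>2 = 1\<^sup>2" using mob_norm[of z] assms by simp
  then show ?thesis by (simp only: power2_eq_iff_nonneg[OF norm_ge_zero zero_le_one])
qed

text \<open>The constant 8 has two sources in the formula for 1 - |mob u a z|^2: the squared
  denominator is at most 4, and 1 + |mob u a z| is at most 2.\<close>

lemma one_minus_mob:
  assumes "cmod z < 1"
  shows "cmod (mob u a z) < 1" "1 - cmod z \<le> 8 / (1 - (cmod a)\<^sup>2) * (1 - cmod (mob u a z))"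
proof -
  let ?m = "cmod (mob u a z)" and ?D = "cmod (1 - cnj a * z)" and ?\<alpha> = "1 - (cmod a)\<^sup>2"
  have D: "0 < ?D" "?D \<le> 2"
  proof -
    show "0 < ?D" using denom_nz'[of z] assms by simp
    have "cmod a * cmod z \<le> 1" using a assms by (intro mult_le_one) auto
    then show "?D \<le> 2" using norm_triangle_ineq4[of 1 "cnj a * z"] by (simp add: norm_mult)
  qed
  have z2: "1 - cmod z \<le> 1 - (cmod z)\<^sup>2" "0 < 1 - (cmod z)\<^sup>2"
    using assms by (simp_all add: power_less_one_iff) (simp add: power2_eq_square mult_left_le_one_le)
  have "0 < (1 - (cmod z)\<^sup>2) * ?\<alpha> / ?D\<^sup>2" using z2 a_sq D by simp
  then have m2: "?m\<^sup>2 < 1\<^sup>2" using mob_norm[of z] assms by simp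
  then show m1: "?m < 1" by (rule power_less_imp_less_base) simp
  have "?D\<^sup>2 \<le> 2\<^sup>2" using D by (intro power_mono) auto
  then have "(1 - cmod z) * ?\<alpha> / 4 \<le> (1 - (cmod z)\<^sup>2) * ?\<alpha> / ?D\<^sup>2"
    using z2 a_sq D by (intro frac_le mult_mono) auto
  also have "\<dots> = (1 - ?m) * (1 + ?m)" using mob_norm[of z] assms by (simp add: power2_eq_square algebra_simps)
  also have "\<dots> \<le> (1 - ?m) * 2" using m1 by (intro mult_left_mono) auto
  finally show "1 - cmod z \<le> 8 / ?\<alpha> * (1 - ?m)" using a_sq(1) by (simp add: field_simps)
qed

text \<open>The inverse has to vanish at the image of 0, which is - u a; this explains its second
  parameter.\<close>

lemma mob_inverse:
  assumes z: "cmod z \<le> 1"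
  shows "mob (cnj u) (- u * a) (mob u a z) = z"
proof -
  let ?D = "1 - cnj a * z" and ?\<alpha> = "1 - cnj a * a"
  have D: "?D \<noteq> 0" by (rule denom_nz'[OF z])
  have 1: "mob u a z + u * a = u * z * ?\<alpha> / ?D"
    using D by (simp add: mob_def field_simps)
  have 2: "1 - cnj (- u * a) * mob u a z = ?\<alpha> / ?D"
  proof -
    have "cnj (- u * a) * mob u a z = - ((cnj u * u) * (cnj a * (z - a)) / ?D)"
      by (simp add: mob_def)
    then show ?thesis using D u_cnj by (simp add: field_simps)
  qed
  have "mob (cnj u) (- u * a) (mob u a z) = cnj u * (u * z * ?\<alpha> / ?D) / (?\<alpha> / ?D)"
    unfolding mob_def[of "cnj u"] 2 by (simp add: 1[symmetric])
  also have "\<dots> = (cnj u * u) * z" using D a_cnj by simp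
  finally show ?thesis using u_cnj by simp
qed

lemma inverse_moebius: "disc_moebius (cnj u) (- u * a)"
  by unfold_locales (use u a in \<open>auto simp: norm_mult\<close>)

lemma mob_inverse':
  assumes "cmod z \<le> 1"
  shows "mob u a (mob (cnj u) (- u * a) z) = z"
proof -
  have "- cnj u * (- u * a) = a" using u_cnj by (simp add: mult.assoc[symmetric])
  with disc_moebius.mob_inverse[OF inverse_moebius assms] show ?thesis
    by (simp only: complex_cnj_cnj)
qed

text \<open>On the circle \<open>1 - a (cnj z)\<close> is the conjugate of the denominator \<open>v = 1 - (cnj a) z\<close>, so the
  argument of \<open>mob u a z\<close> is that of \<open>u z\<close> minus twice that of \<open>v\<close>, and \<open>v\<close> has positive real part.\<close>

lemma mob_lift:
  "\<exists>\<psi>::real \<Rightarrow> real. \<psi> differentiable_on UNIV \<and> (\<forall>t. mob u a (cis (2 * pi * t)) = cis (2 * pi * \<psi> t))"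
proof -
  obtain \<theta> where \<theta>: "u = cis \<theta>" using u by (metis rcis_cmod_Arg rcis_def of_real_1 mult_1)
  define v where "v t = 1 - cnj a * cis (2 * pi * t)" for t
  define L where "L t = Im (Ln (v t))" for t
  define \<psi> where "\<psi> t = (\<theta> + 2 * pi * t - 2 * L t) / (2 * pi)" for t
  have v_pos: "Re (v t) > 0" for t
  proof -
    have "Re (cnj a * cis (2 * pi * t)) \<le> cmod (cnj a * cis (2 * pi * t))" by (rule complex_Re_le_cmod)
    also have "\<dots> < 1" using a by (simp add: norm_mult)
    finally show ?thesis by (simp add: v_def)
  qed
  have v_nz: "v t \<noteq> 0" for t using v_pos[of t] by auto
  have v_slit: "v t \<notin> \<real>\<^sub>\<le>\<^sub>0" for t using v_pos[of t] by (auto simp: complex_nonpos_Reals_iff)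
  have "\<psi> differentiable at t" for t
  proof -
    have "((\<lambda>t. cis (2 * pi * t)) has_derivative (\<lambda>s. (2 * pi * s) *\<^sub>R (\<i> * cis (2 * pi * t)))) (at t)"
      by (auto intro!: derivative_eq_intros)
    then have "((\<lambda>t. cnj a * cis (2 * pi * t)) has_derivative (\<lambda>s. cnj a * ((2 * pi * s) *\<^sub>R (\<i> * cis (2 * pi * t))))) (at t)"
      by (rule has_derivative_mult_right)
    then have "(v has_derivative (\<lambda>s. 0 - cnj a * ((2 * pi * s) *\<^sub>R (\<i> * cis (2 * pi * t))))) (at t)"
      unfolding v_def by (rule has_derivative_diff[OF has_derivative_const])
    then have "v differentiable at t" by (auto simp: differentiable_def)
    then have "(Ln \<circ> v) differentiable at t"
      by (rule differentiable_chain_at)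
         (rule field_differentiable_imp_differentiable[OF field_differentiable_at_Ln[OF v_slit]])
    then obtain D where "((Ln \<circ> v) has_derivative D) (at t)" by (auto simp: differentiable_def)
    from has_derivative_Im[OF this] have "(L has_derivative (\<lambda>s. Im (D s))) (at t)"
      by (simp add: o_def L_def[abs_def])
    then have "(\<psi> has_derivative (\<lambda>s. (0 + 2 * pi * s - 2 * Im (D s)) / (2 * pi))) (at t)"
      unfolding \<psi>_def by (auto intro!: derivative_eq_intros simp: fun_eq_iff field_simps)
    then show ?thesis by (auto simp: differentiable_def)
  qed
  moreover have "mob u a (cis (2 * pi * t)) = cis (2 * pi * \<psi> t)" for t
  proof -
    let ?z = "cis (2 * pi * t)"
    have cnjz: "?z * cnj ?z = 1" using complex_norm_square[of ?z] by simp
    have e: "exp (Ln (v t)) = v t" using v_nz by simp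
    have "cnj (v t) / v t = exp (cnj (Ln (v t)) - Ln (v t))"
      unfolding exp_diff exp_cnj[symmetric] e ..
    also have "cnj (Ln (v t)) - Ln (v t) = \<i> * complex_of_real (- 2 * Im (Ln (v t)))"
      by (simp add: complex_eq_iff)
    finally have q: "cnj (v t) / v t = cis (- 2 * Im (Ln (v t)))" by (simp only: cis_conv_exp)
    have "?z - a = ?z * cnj (v t)"
    proof -
      have "?z * cnj (v t) = ?z - a * (?z * cnj ?z)" by (simp add: v_def algebra_simps)
      then show ?thesis by (simp only: cnjz mult_1_right)
    qed
    then have "mob u a ?z = u * ?z * (cnj (v t) / v t)"
      by (simp add: mob_def v_def[symmetric])
    also have "\<dots> = cis (\<theta> + 2 * pi * t + (- 2 * Im (Ln (v t))))"
      unfolding q \<theta> cis_mult by simp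
    also have "\<theta> + 2 * pi * t + (- 2 * Im (Ln (v t))) = 2 * pi * \<psi> t"
      by (simp add: \<psi>_def L_def)
    finally show ?thesis .
  qed
  ultimately show ?thesis
    by (intro exI[of _ \<psi>]) (auto simp: differentiable_on_def intro: differentiable_at_withinI)
qed

end

text \<open>Let a be the zero of \<open>\<phi>\<close>. Composed with the map that sends 0 to a,
  \<open>\<phi>\<close> fixes 0, and the Schwarz lemma for the composition and for its inverse
  forces equality of moduli at the sample point 1/2; so the composition is a rotation.\<close>

lemma disc_automorphism_mob:
  assumes \<phi>: "disc_automorphism \<phi>"
  obtains u a where "disc_moebius u a" "\<forall>z\<in>cball 0 1. \<phi> z = mob u a z"
proof -
  have hol: "\<phi> holomorphic_on ball 0 1" and bij: "bij_betw \<phi> (ball 0 1) (ball 0 1)"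
    and cont: "continuous_on (cball 0 1) \<phi>"
    using \<phi> by (auto simp: disc_automorphism_def)
  have "0 \<in> \<phi> ` ball 0 1" using bij by (simp add: bij_betw_def)
  then obtain a where a: "a \<in> ball 0 1" "\<phi> a = 0" by force
  interpret M: disc_moebius 1 a by unfold_locales (use a in auto)
  interpret N: disc_moebius 1 "- a" by unfold_locales (use a in auto)
  have NM: "mob 1 (- a) (mob 1 a z) = z" if "cmod z \<le> 1" for z
    using M.mob_inverse[OF that] by simp
  have MN: "mob 1 a (mob 1 (- a) z) = z" if "cmod z \<le> 1" for z
    using N.mob_inverse[OF that] by simp
  define \<psi> where "\<psi> = \<phi> \<circ> mob 1 (- a)"
  have N_ball: "mob 1 (- a) z \<in> ball 0 1" if "z \<in> ball 0 1" for z
    using N.one_minus_mob(1)[of z] that by simp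
  have M_ball: "mob 1 a z \<in> ball 0 1" if "z \<in> ball 0 1" for z
    using M.one_minus_mob(1)[of z] that by simp
  have "mob 1 (- a) holomorphic_on ball 0 1"
    by (rule holomorphic_on_subset[OF N.mob_holomorphic]) (use N.radius in auto)
  then have \<psi>_hol: "\<psi> holomorphic_on ball 0 1"
    unfolding \<psi>_def by (rule holomorphic_on_compose_gen[OF _ hol]) (use N_ball in auto)
  have "bij_betw (mob 1 (- a)) (ball 0 1) (ball 0 1)"
    by (rule bij_betw_byWitness[where f' = "mob 1 a"]) (use NM MN N_ball M_ball in auto)
  then have \<psi>_bij: "bij_betw \<psi> (ball 0 1) (ball 0 1)"
    unfolding \<psi>_def using bij by (rule bij_betw_trans)
  have \<psi>0: "\<psi> 0 = 0" using a by (simp add: \<psi>_def mob_def)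
  have inj: "inj_on \<psi> (ball 0 1)" and img: "\<psi> ` ball 0 1 = ball 0 1"
    using \<psi>_bij by (auto simp: bij_betw_def)
  obtain g where g: "g holomorphic_on \<psi> ` ball 0 1" "\<And>z. z \<in> ball 0 1 \<Longrightarrow> g (\<psi> z) = z"
    using holomorphic_has_inverse[OF \<psi>_hol open_ball inj] by metis
  have ball: "cmod (\<psi> z) < 1" if "cmod z < 1" for z
    using img that by force
  have g_ball: "cmod (g y) < 1" if y: "cmod y < 1" for y
  proof -
    have "y \<in> \<psi> ` ball 0 1" using y img by simp
    then obtain z where "z \<in> ball 0 1" "y = \<psi> z" by blast
    then show ?thesis using g(2) by simp
  qed
  have "cmod (\<psi> (1/2)) \<le> cmod (1/2)"
    by (rule Schwarz_Lemma(1)[OF \<psi>_hol \<psi>0 ball]) auto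
  moreover have "cmod (g (\<psi> (1/2))) \<le> cmod (\<psi> (1/2))"
  proof (rule Schwarz_Lemma(1))
    show "g holomorphic_on ball 0 1" using g(1) img by simp
    show "g 0 = 0" using g(2)[of 0] \<psi>0 by simp
    show "cmod (\<psi> (1/2)) < 1" by (rule ball) simp
  qed (rule g_ball)
  ultimately have "cmod (\<psi> (1/2)) = cmod (1/2)" using g(2)[of "1/2"] by simp
  then have "\<exists>z. cmod z < 1 \<and> z \<noteq> 0 \<and> cmod (\<psi> z) = cmod z" by (intro exI[of _ "1/2"]) simp
  then obtain u where u: "\<And>z. cmod z < 1 \<Longrightarrow> \<psi> z = u * z" "cmod u = 1"
    using Schwarz_Lemma(3)[OF \<psi>_hol \<psi>0 ball, of 0] by auto
  interpret U: disc_moebius u a by unfold_locales (use a u in auto)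
  have eq: "\<phi> z - mob u a z = 0" if z: "z \<in> ball 0 1" for z
  proof -
    have "\<phi> z = \<psi> (mob 1 a z)" using NM[of z] z by (simp add: \<psi>_def)
    also have "\<dots> = u * mob 1 a z" using M_ball[OF z] u(1) by simp
    finally show ?thesis by (simp add: mob_def)
  qed
  have "mob u a holomorphic_on cball 0 1"
    by (rule holomorphic_on_subset[OF U.mob_holomorphic]) (use U.radius in auto)
  then have "continuous_on (cball 0 1) (\<lambda>z. \<phi> z - mob u a z)"
    by (intro continuous_on_diff cont holomorphic_on_imp_continuous_on)
  then have "continuous_on (closure (ball 0 1)) (\<lambda>z. \<phi> z - mob u a z)" by simp
  \<comment> \<open>Continuity carries the identity from the open disc to the circle, where it will
    be applied to sets.\<close>
  from continuous_constant_on_closure[OF this eq] have "\<forall>z\<in>cball 0 1. \<phi> z = mob u a z" by simp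
  then show ?thesis using U.disc_moebius_axioms by (rule that[rotated])
qed

subsection \<open>Moebius transformations preserve null sets of the circle\<close>

lemma cis_turn_eq_iff: "cis (2 * pi * s) = cis (2 * pi * t) \<longleftrightarrow> (\<exists>k::int. s = t + real_of_int k)"
proof -
  have "cis (2 * pi * s) = cis (2 * pi * t) \<longleftrightarrow> (\<exists>k::int. 2 * pi * s = 2 * pi * t + 2 * pi * k)"
    using sin_cos_eq_iff[of "2 * pi * s" "2 * pi * t"] by (auto simp: complex_eq_iff)
  also have "\<dots> \<longleftrightarrow> (\<exists>k::int. 2 * pi * s = 2 * pi * (t + k))" by (simp add: distrib_left)
  finally show ?thesis by simp
qed

lemma circle_eq_cis_turn:
  assumes "x \<in> sphere 0 1" obtains t where "0 \<le> t" "t \<le> 1" "x = cis (2 * pi * t)"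
proof -
  obtain s where s: "0 \<le> s" "s < 2 * pi" "x = Complex (cos s) (sin s)"
    using assms complex_unimodular_polar[of x] by auto
  show ?thesis
    by (rule that[of "s / (2 * pi)"]) (use s in \<open>auto simp: field_simps complex_eq_iff\<close>)
qed

abbreviation borel_circle :: "complex measure" where
  "borel_circle \<equiv> distr (uniform_measure lborel {0..1}) (restrict_space borel (sphere 0 1))
     (\<lambda>t. cis (2 * pi * t))"

text \<open>The full periodic preimage in the line is used instead of its part in [0,1], which would
  not be respected by lifts of circle maps. Both are negligible together, as countably many integer
  translates of the part cover the whole.\<close>

lemma null_borel_circle:
  assumes N: "N \<in> sets borel" "N \<subseteq> sphere 0 1"
  shows "N \<in> null_sets borel_circle \<longleftrightarrow> negligible {t. cis (2 * pi * t) \<in> N}"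
proof -
  have meas: "(\<lambda>t. cis (2 * pi * t)) \<in> borel_measurable borel"
    by (intro borel_measurable_continuous_onI continuous_intros)
  then have meas': "(\<lambda>t. cis (2 * pi * t)) \<in> uniform_measure lborel {0..1} \<rightarrow>\<^sub>M restrict_space borel (sphere 0 1)"
    by (intro measurable_restrict_space2) auto
  let ?T = "{t. cis (2 * pi * t) \<in> N}"
  have T: "?T \<in> sets borel" using measurable_sets[OF meas N(1)] by (simp add: vimage_def)
  have "N \<in> null_sets borel_circle \<longleftrightarrow> ?T \<in> null_sets (uniform_measure lborel {0..1})"
    using N by (simp add: null_sets_distr_iff[OF meas'] sets_restrict_space_iff vimage_def)
  also have "\<dots> \<longleftrightarrow> emeasure lborel ({0..1} \<inter> ?T) = 0"
    using T by (simp add: null_sets_def ennreal_divide_eq_0_iff)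
  also have "\<dots> \<longleftrightarrow> {0..1} \<inter> ?T \<in> null_sets lborel"
    using T by (simp add: null_sets_def)
  also have "\<dots> \<longleftrightarrow> negligible ({0..1} \<inter> ?T)"
    using T by (simp add: negligible_iff_null_sets null_sets_completion_iff)
  also have "\<dots> \<longleftrightarrow> negligible ?T"
  proof
    assume n: "negligible ({0..1} \<inter> ?T)"
    have "?T \<subseteq> (\<Union>k\<in>range real_of_int. (+) k ` ({0..1} \<inter> ?T))"
    proof
      fix t assume t: "t \<in> ?T"
      have "cis (2 * pi * t) = cis (2 * pi * frac t)"
        unfolding cis_turn_eq_iff by (intro exI[of _ "\<lfloor>t\<rfloor>"]) (simp add: frac_def)
      moreover have "0 \<le> frac t" "frac t \<le> 1" using frac_ge_0[of t] frac_lt_1[of t] by auto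
      ultimately have "frac t \<in> {0..1} \<inter> ?T" using t by auto
      then show "t \<in> (\<Union>k\<in>range real_of_int. (+) k ` ({0..1} \<inter> ?T))"
        by (intro UN_I[of "real_of_int \<lfloor>t\<rfloor>"] image_eqI[of _ _ "frac t"]) (auto simp: frac_def)
    qed
    moreover have "negligible (\<Union>k\<in>range real_of_int. (+) k ` ({0..1} \<inter> ?T))"
      by (rule negligible_countable_Union) (auto intro: negligible_translation n)
    ultimately show "negligible ?T" by (rule negligible_subset[rotated])
  qed (auto intro: negligible_subset)
  finally show ?thesis .
qed

context disc_moebius
begin

lemma mob_sphere_mem: "z \<in> sphere 0 1 \<Longrightarrow> mob u a z \<in> sphere 0 1"
  using mob_sphere by simp

lemma mob_continuous_cball: "continuous_on (cball 0 1) (mob u a)"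
  by (rule continuous_on_subset[OF holomorphic_on_imp_continuous_on[OF mob_holomorphic]])
     (use radius in auto)

lemma mob_vimage_borel:
  assumes "S \<in> sets borel" shows "mob u a -` S \<inter> sphere 0 1 \<in> sets borel"
proof -
  have "mob u a \<in> borel_measurable (restrict_space borel (sphere 0 1))"
    by (rule borel_measurable_continuous_on_restrict)
       (rule continuous_on_subset[OF mob_continuous_cball], auto)
  from measurable_sets[OF this assms] show ?thesis
    by (simp add: space_restrict_space sets_restrict_space_iff)
qed

text \<open>The inverse map lifts to a differentiable function of the angle, and differentiable
  functions of a real variable preserve negligible sets. Angles are determined only up to integers,
  hence the union over translates.\<close>

lemma mob_vimage_null_borel:
  assumes N: "N \<in> null_sets borel_circle"
  shows "mob u a -` N \<inter> sphere 0 1 \<in> null_sets borel_circle"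
proof -
  interpret I: disc_moebius "cnj u" "- u * a" by (rule inverse_moebius)
  have Nb: "N \<in> sets borel" "N \<subseteq> sphere 0 1"
    using N by (auto simp: null_sets_def sets_restrict_space_iff)
  let ?T = "{t. cis (2 * pi * t) \<in> N}" and ?P = "mob u a -` N \<inter> sphere 0 1"
  have T: "negligible ?T" using N null_borel_circle[OF Nb] by simp
  obtain \<psi> where \<psi>: "\<psi> differentiable_on UNIV"
    "\<And>t. mob (cnj u) (- u * a) (cis (2 * pi * t)) = cis (2 * pi * \<psi> t)"
    using I.mob_lift by blast
  have "negligible (\<psi> ` ?T)"
    by (rule negligible_differentiable_image_negligible[OF _ T])
       (auto intro: differentiable_on_subset[OF \<psi>(1)])
  then have "negligible (\<Union>k\<in>range real_of_int. (+) k ` \<psi> ` ?T)"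
    by (intro negligible_countable_Union) (auto intro: negligible_translation)
  moreover have "{t. cis (2 * pi * t) \<in> ?P} \<subseteq> (\<Union>k\<in>range real_of_int. (+) k ` \<psi> ` ?T)"
  proof
    fix t assume "t \<in> {t. cis (2 * pi * t) \<in> ?P}"
    then have m: "mob u a (cis (2 * pi * t)) \<in> N" by simp
    obtain s where s: "mob u a (cis (2 * pi * t)) = cis (2 * pi * s)"
      using circle_eq_cis_turn[OF mob_sphere_mem[of "cis (2 * pi * t)"]] by auto
    then have "cis (2 * pi * t) = cis (2 * pi * \<psi> s)"
      using mob_inverse[of "cis (2 * pi * t)"] \<psi>(2)[of s] by simp
    then obtain k :: int where k: "t = \<psi> s + real_of_int k" unfolding cis_turn_eq_iff by blast
    have "s \<in> ?T" using m s by simp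
    then show "t \<in> (\<Union>k\<in>range real_of_int. (+) k ` \<psi> ` ?T)" using k by force
  qed
  ultimately have "negligible {t. cis (2 * pi * t) \<in> ?P}" by (rule negligible_subset)
  then show ?thesis using null_borel_circle[OF mob_vimage_borel[OF Nb(1)]] by simp
qed

lemma mob_vimage_null:
  assumes "N \<in> null_sets circle"
  shows "mob u a -` N \<inter> sphere 0 1 \<in> null_sets circle"
proof -
  have "\<exists>N'\<in>null_sets borel_circle. N \<subseteq> N'"
    using assms unfolding circle_def null_sets_completion_iff2 .
  then obtain N' where N': "N' \<in> null_sets borel_circle" "N \<subseteq> N'" by (rule bexE)
  show ?thesis
    unfolding circle_def null_sets_completion_iff2
    by (rule bexI[OF _ mob_vimage_null_borel[OF N'(1)]]) (use N'(2) in auto)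
qed

text \<open>As \<open>circle\<close> is complete, Borel measurability has to be combined with
  preservation of null sets: the preimage of a subset of a null set must be measurable as
  well.\<close>

lemma mob_measurable: "mob u a \<in> circle \<rightarrow>\<^sub>M circle"
proof (rule measurableI)
  show "mob u a x \<in> space circle" if "x \<in> space circle" for x
    using that mob_sphere_mem by (simp add: space_circle)
  fix A assume "A \<in> sets circle"
  then obtain S N N' where S: "A = S \<union> N" "N \<subseteq> N'" "N' \<in> null_sets borel_circle" "S \<in> sets borel_circle"
    unfolding circle_def by (rule sets_completionE)
  have "S \<in> sets borel" using S(4) by (simp add: sets_restrict_space_iff)
  then have "mob u a -` S \<inter> sphere 0 1 \<in> sets borel_circle"
    using mob_vimage_borel[of S] by (simp add: sets_restrict_space_iff)
  then show "mob u a -` A \<inter> space circle \<in> sets circle"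
    unfolding space_circle unfolding circle_def
    by (intro sets_completionI[where N = "mob u a -` N \<inter> sphere 0 1", OF _ _ mob_vimage_null_borel[OF S(3)]])
       (use S in auto)
qed

section \<open>Images of sets and change of variables\<close>

lemma mob_image:
  assumes "A \<subseteq> sphere 0 1"
  shows "mob u a ` A = mob (cnj u) (- u * a) -` A \<inter> sphere 0 1"
proof -
  interpret I: disc_moebius "cnj u" "- u * a" by (rule inverse_moebius)
  show ?thesis
  proof (intro equalityI subsetI)
    fix y assume "y \<in> mob u a ` A"
    then obtain x where x: "x \<in> A" "y = mob u a x" by blast
    then have "x \<in> sphere 0 1" using assms by blast
    then show "y \<in> mob (cnj u) (- u * a) -` A \<inter> sphere 0 1"
      using x mob_inverse[of x] mob_sphere_mem[of x] by simp
  next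
    fix y assume "y \<in> mob (cnj u) (- u * a) -` A \<inter> sphere 0 1"
    then show "y \<in> mob u a ` A"
      using mob_inverse'[of y] by (intro image_eqI[of _ _ "mob (cnj u) (- u * a) y"]) auto
  qed
qed

lemma mob_image_sets: "A \<in> sets circle \<Longrightarrow> mob u a ` A \<in> sets circle"
  using measurable_sets[OF disc_moebius.mob_measurable[OF inverse_moebius], of A]
  by (simp add: mob_image[OF sets_circle_subset] space_circle)

lemma mob_image_null: "A \<in> null_sets circle \<Longrightarrow> mob u a ` A \<in> null_sets circle"
  using disc_moebius.mob_vimage_null[OF inverse_moebius, of A]
  by (simp add: mob_image[OF sets_circle_subset] null_sets_def)

lemma bdd_meas_mob: assumes "g \<in> bdd_meas" shows "(\<lambda>x. g (mob u a x)) \<in> bdd_meas"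
proof -
  obtain C where C: "g \<in> borel_measurable circle" "0 \<le> C" "\<forall>x\<in>sphere 0 1. cmod (g x) \<le> C"
    by (rule bdd_measE[OF assms])
  show ?thesis
    by (rule bdd_measI[OF measurable_compose[OF mob_measurable C(1)], of C]) (use C mob_sphere_mem in blast)
qed

text \<open>The factor of the change of variables is only needed as a Radon-Nikodym density of the image
  measure, so its explicit form (a Poisson kernel) plays no role.\<close>

lemma pairing_mob:
  assumes A: "A \<in> sets circle" and h: "integrable circle h"
  shows "\<exists>h'. integrable circle h' \<and>
     (\<forall>k\<in>bdd_meas. pairing A (\<lambda>x. k (mob u a x)) h = pairing (mob u a ` A) k h')"
proof -
  interpret I: disc_moebius "cnj u" "- u * a" by (rule inverse_moebius)
  let ?m = "mob u a" and ?i = "mob (cnj u) (- u * a)"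
  define \<mu> where "\<mu> = distr circle circle ?m"
  have "finite_measure \<mu>"
    unfolding \<mu>_def by (rule circle.finite_measure_distr[OF mob_measurable])
  moreover have ac: "absolutely_continuous circle \<mu>"
    unfolding absolutely_continuous_def
  proof
    fix N assume N: "N \<in> null_sets circle"
    then show "N \<in> null_sets \<mu>"
      using mob_vimage_null[OF N]
      by (simp add: \<mu>_def null_sets_distr_iff[OF mob_measurable] space_circle) (simp add: null_sets_def)
  qed
  moreover have sets: "sets \<mu> = sets circle" by (simp add: \<mu>_def)
  ultimately obtain D where D: "D \<in> borel_measurable circle"
    "AE x in circle. RN_deriv circle \<mu> x = ennreal (D x)" "\<And>x. 0 \<le> D x"
    using circle.real_RN_deriv by metis
  have \<mu>: "\<mu> = density circle (\<lambda>x. ennreal (D x))"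
  proof -
    have "\<mu> = density circle (RN_deriv circle \<mu>)"
      by (rule circle.density_RN_deriv[OF ac sets, symmetric])
    also have "\<dots> = density circle (\<lambda>x. ennreal (D x))"
      using D by (intro density_cong) auto
    finally show ?thesis .
  qed
  \<comment> \<open>The test function carried over to the image circle, so that composing it with
    the Moebius map returns \<open>h\<close>.\<close>
  define ht where "ht = (\<lambda>y. h (?i y))"
  have hm: "h \<in> borel_measurable circle" using h by auto
  have htm: "ht \<in> borel_measurable circle"
    unfolding ht_def by (rule measurable_compose[OF I.mob_measurable hm])
  have ht: "ht (?m x) = h x" if "x \<in> sphere 0 1" for x
    using mob_inverse[of x] that by (simp add: ht_def)
  have int_eq: "(LINT x|circle. F (?m x)) = (LINT x|circle. D x *\<^sub>R F x)"
    if F: "F \<in> borel_measurable circle" for F :: "complex \<Rightarrow> complex"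
  proof -
    have "(LINT x|circle. F (?m x)) = (LINT x|\<mu>. F x)"
      unfolding \<mu>_def by (rule integral_distr[symmetric, OF mob_measurable F])
    also have "\<dots> = (LINT x|circle. D x *\<^sub>R F x)"
      unfolding \<mu> by (rule integral_density[OF F D(1)]) (simp add: D(3))
    finally show ?thesis .
  qed
  have "integrable circle (\<lambda>x. ht (?m x))"
    by (rule Bochner_Integration.integrable_cong[THEN iffD2, OF refl _ h]) (simp add: ht space_circle)
  then have "integrable \<mu> ht"
    unfolding \<mu>_def by (simp add: integrable_distr_eq[OF mob_measurable htm])
  then have "integrable circle (\<lambda>x. D x *\<^sub>R ht x)"
    unfolding \<mu> by (subst (asm) integrable_density[OF htm D(1)]) (simp_all add: D(3))
  moreover have "pairing A (\<lambda>x. k (?m x)) h = pairing (?m ` A) k (\<lambda>x. D x *\<^sub>R ht x)" if k: "k \<in> bdd_meas" for k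
  proof -
    let ?F = "\<lambda>y. indicator (?m ` A) y *\<^sub>R (k y * ht y)"
    have "pairing A (\<lambda>x. k (?m x)) h = (LINT x|circle. ?F (?m x))"
      unfolding pairing_def set_lebesgue_integral_def
    proof (rule Bochner_Integration.integral_cong[OF refl])
      fix x assume "x \<in> space circle"
      then have x: "x \<in> sphere 0 1" by (simp add: space_circle)
      then have "?m x \<in> ?m ` A \<longleftrightarrow> x \<in> A"
        using mob_inverse[of x] mob_sphere_mem[OF x] by (simp add: mob_image[OF sets_circle_subset[OF A]])
      then show "indicator A x *\<^sub>R (k (?m x) * h x) = ?F (?m x)"
        by (simp add: ht[OF x] indicator_def)
    qed
    also have "\<dots> = (LINT x|circle. D x *\<^sub>R ?F x)"
      by (intro int_eq borel_measurable_scaleR borel_measurable_indicator borel_measurable_times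
          bdd_meas_measurable k htm mob_image_sets A)
    also have "\<dots> = pairing (?m ` A) k (\<lambda>x. D x *\<^sub>R ht x)"
      unfolding pairing_def set_lebesgue_integral_def
      by (rule Bochner_Integration.integral_cong[OF refl]) simp
    finally show ?thesis .
  qed
  ultimately show ?thesis by blast
qed

text \<open>By the chain rule the derivative of the composition is Q' at the image point times a
  factor bounded on the closed disc, and the weight at z is at most a constant times the weight at
  the image. The bounds are stated for value and derivative and not for \<open>norm_dist\<close>,
  since the composition is not a polynomial.\<close>

lemma compose_mob_bound:
  assumes w: "majorant w"
  shows "\<exists>C\<ge>0. \<forall>Q. cmod (poly Q (mob u a 0)) \<le> C * norm_dist (B0 w) (\<lambda>z. 0) (pol Q) \<and>
    (\<forall>z\<in>ball 0 1. bloch_weight w z * cmod (deriv (\<lambda>z. poly Q (mob u a z)) z)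
        \<le> C * norm_dist (B0 w) (\<lambda>z. 0) (pol Q))"
proof -
  have "continuous_on (cball 0 1) (deriv (mob u a))"
    by (rule continuous_on_subset[OF holomorphic_on_imp_continuous_on[OF holomorphic_deriv[OF mob_holomorphic open_ball]]])
       (use radius in auto)
  from compact_continuous_norm_bound[OF compact_cball this] obtain B where
    B: "\<forall>z\<in>cball 0 1. cmod (deriv (mob u a) z) \<le> B" by blast
  have B0: "0 \<le> B" using bspec[OF B, of 0] norm_ge_zero[of "deriv (mob u a) 0"] by (simp del: norm_ge_zero)
  define c where "c = 8 / (1 - (cmod a)\<^sup>2)"
  have c: "1 \<le> c" using a_sq by (simp add: c_def field_simps)
  define m0 where "m0 = mob u a 0"
  have m0: "m0 \<in> ball 0 1" using one_minus_mob(1)[of 0] by (simp add: m0_def)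
  have bm0: "0 < bloch_weight w m0" by (rule bloch_weight_pos[OF w m0])
  \<comment> \<open>The first entry bounds the value at the image of 0, through Q(0) and the
    weighted increment; the second bounds the weighted derivative.\<close>
  define C where "C = max (1 + 1 / bloch_weight w m0) (B * c)"
  have "0 \<le> C" using B0 c by (simp add: C_def le_max_iff_disj)
  moreover have "cmod (poly Q m0) \<le> C * norm_dist (B0 w) (\<lambda>z. 0) (pol Q)" for Q
  proof -
    let ?N = "norm_dist (B0 w) (\<lambda>z. 0) (pol Q)"
    have N: "0 \<le> ?N" by (rule Metric_space.nonneg[OF Metric_space_B0[OF w]])
    have "bloch_weight w m0 * cmod (poly Q m0 - poly Q 0) \<le> ?N" by (rule weighted_increment_le[OF w m0])
    then have "cmod (poly Q m0 - poly Q 0) \<le> ?N / bloch_weight w m0" using bm0 by (simp add: field_simps)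
    moreover have "cmod (poly Q 0) \<le> ?N"
      using norm_dist_B0_at_0[OF w zero_in_B0[OF w] pol_in_B0[OF w, of Q]] by (simp add: pol_def)
    moreover have "cmod (poly Q m0) \<le> cmod (poly Q m0 - poly Q 0) + cmod (poly Q 0)"
      using norm_triangle_ineq[of "poly Q m0 - poly Q 0" "poly Q 0"] by simp
    ultimately have "cmod (poly Q m0) \<le> (1 + 1 / bloch_weight w m0) * ?N" by (simp add: algebra_simps)
    also have "\<dots> \<le> C * ?N" using N by (intro mult_right_mono) (auto simp: C_def)
    finally show ?thesis .
  qed
  moreover have "bloch_weight w z * cmod (deriv (\<lambda>z. poly Q (mob u a z)) z)
      \<le> C * norm_dist (B0 w) (\<lambda>z. 0) (pol Q)" if z: "z \<in> ball 0 1" for Q z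
  proof -
    let ?N = "norm_dist (B0 w) (\<lambda>z. 0) (pol Q)" and ?m = "mob u a z"
    have N: "0 \<le> ?N" by (rule Metric_space.nonneg[OF Metric_space_B0[OF w]])
    have m: "?m \<in> ball 0 1" using one_minus_mob(1)[of z] z by simp
    have "(mob u a has_field_derivative deriv (mob u a) z) (at z)"
      using holomorphic_derivI[OF mob_holomorphic open_ball] z radius(1) by simp
    from DERIV_chain2[OF poly_DERIV this]
    have d: "deriv (\<lambda>z. poly Q (mob u a z)) z = poly (pderiv Q) ?m * deriv (mob u a) z"
      by (rule DERIV_imp_deriv)
    have "bloch_weight w z \<le> c * bloch_weight w ?m"
      unfolding bloch_weight_def c_def
      by (rule weight_quotient_comparison[OF w]) (use z m one_minus_mob[of z] c in \<open>auto simp: c_def\<close>)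
    then have "bloch_weight w z * cmod (poly (pderiv Q) ?m) \<le> c * bloch_weight w ?m * cmod (poly (pderiv Q) ?m)"
      by (rule mult_right_mono) simp
    also have "\<dots> = c * (bloch_weight w ?m * cmod (poly (pderiv Q) ?m))" by simp
    also have "\<dots> \<le> c * ?N"
      using zero_dist_deriv[OF w m, of Q] norm_ge_zero[of "poly Q 0"] c by (intro mult_left_mono) linarith+
    finally have "B * (bloch_weight w z * cmod (poly (pderiv Q) ?m)) \<le> B * (c * ?N)"
      by (rule mult_left_mono[OF _ B0])
    moreover have "bloch_weight w z * cmod (poly (pderiv Q) ?m) * cmod (deriv (mob u a) z)
        \<le> bloch_weight w z * cmod (poly (pderiv Q) ?m) * B"
      using B z bloch_weight_nonneg[OF w, of z] by (intro mult_left_mono) auto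
    ultimately have "bloch_weight w z * cmod (deriv (\<lambda>z. poly Q (mob u a z)) z) \<le> B * c * ?N"
      by (simp add: d norm_mult algebra_simps)
    also have "\<dots> \<le> C * ?N" using N by (intro mult_right_mono) (auto simp: C_def)
    finally show ?thesis .
  qed
  ultimately show ?thesis unfolding m0_def by blast
qed

text \<open>Composing an approximating polynomial Q with the map gives a function holomorphic beyond
  the closed disc, which is then replaced by a polynomial R with uniformly close values and
  derivatives.\<close>

lemma kernel_mob:
  assumes w: "majorant w" and A: "A \<in> sets circle" and g: "g \<in> bdd_meas"
    and ap: "approx (mob u a ` A) w (\<lambda>z. 0) g"
  shows "approx A w (\<lambda>z. 0) (\<lambda>x. g (mob u a x))"
  unfolding approx_def
proof (intro allI impI)
  fix e :: real and H :: "(complex \<Rightarrow> complex) set"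
  assume e: "e > 0" and H: "finite H" "\<forall>h\<in>H. integrable circle h"
  obtain C where C: "0 \<le> C"
    "\<forall>Q. cmod (poly Q (mob u a 0)) \<le> C * norm_dist (B0 w) (\<lambda>z. 0) (pol Q) \<and>
    (\<forall>z\<in>ball 0 1. bloch_weight w z * cmod (deriv (\<lambda>z. poly Q (mob u a z)) z)
        \<le> C * norm_dist (B0 w) (\<lambda>z. 0) (pol Q))"
    using compose_mob_bound[OF w] by (elim exE conjE) (rule that)
  define J where "J = (\<Sum>h\<in>H. LINT x|circle. cmod (h x))"
  have J: "0 \<le> J" "h \<in> H \<Longrightarrow> (LINT x|circle. cmod (h x)) \<le> J" for h
    unfolding J_def using H(1) by (auto intro!: sum_nonneg member_le_sum)
  define b0 where "b0 = bloch_weight w 0"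
  have b0: "0 < b0" unfolding b0_def by (rule bloch_weight_pos[OF w]) simp
  \<comment> \<open>\<open>d\<close> is the tolerance for Q and \<open>\<eta>\<close> the one for R.
    The norm costs 2 C d + (1 + b0) \<eta> and each pairing costs at most d + J \<eta>; the parts
    with d and with \<eta> receive half of e each.\<close>
  define d where "d = e / 2 / (1 + 2 * C)"
  define \<eta> where "\<eta> = e / 2 / (1 + b0 + J)"
  have d: "0 < d" using e C(1) by (simp add: d_def)
  have \<eta>: "0 < \<eta>" using e b0 J(1) by (simp add: \<eta>_def)
  have "(1 + 2 * C) * d = e / 2"
    unfolding d_def by (subst times_divide_eq_right, rule nonzero_mult_div_cancel_left) (use C(1) in auto)
  then have dC: "d + 2 * (C * d) = e / 2" by (simp add: algebra_simps)
  have "(1 + b0 + J) * \<eta> = e / 2"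
    unfolding \<eta>_def by (subst times_divide_eq_right, rule nonzero_mult_div_cancel_left) (use b0 J(1) in auto)
  then have \<eta>J: "\<eta> + b0 * \<eta> + J * \<eta> = e / 2" by (simp add: algebra_simps)
  have nn: "0 \<le> C * d" "0 \<le> b0 * \<eta>" "0 \<le> J * \<eta>" using C(1) d b0 \<eta> J(1) by auto
  obtain t where t: "\<And>h. h \<in> H \<Longrightarrow> integrable circle (t h)"
    "\<And>h k. h \<in> H \<Longrightarrow> k \<in> bdd_meas \<Longrightarrow>
       pairing A (\<lambda>x. k (mob u a x)) h = pairing (mob u a ` A) k (t h)"
    using pairing_mob[OF A] H(2) by metis
  have "finite (t ` H)" "\<forall>h\<in>t ` H. integrable circle h" using H(1) t(1) by auto
  from approxD[OF ap d this] obtain Q where Q: "norm_dist (B0 w) (\<lambda>z. 0) (pol Q) < d"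
    "\<forall>h\<in>t ` H. cmod (pairing (mob u a ` A) (\<lambda>x. g x - poly Q x) h) < d" .
  let ?N = "norm_dist (B0 w) (\<lambda>z. 0) (pol Q)"
  have CN: "C * ?N \<le> C * d" using C(1) Q(1) by (intro mult_left_mono) auto
  define F where "F = (\<lambda>z. poly Q (mob u a z))"
  have "(poly Q \<circ> mob u a) holomorphic_on ball 0 radius"
    by (rule holomorphic_on_compose[OF mob_holomorphic]) (intro holomorphic_intros)
  then have F: "F holomorphic_on ball 0 radius" by (simp add: F_def o_def)
  obtain R where R: "\<forall>z\<in>cball 0 1. cmod (F z - poly R z) < \<eta> \<and> cmod (deriv F z - poly (pderiv R) z) < \<eta>"
    using poly_approx_holomorphic[OF F radius(1) \<eta>] by blast
  have close: "cmod x \<le> cmod y + cmod (y - x)" for x y :: complex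
    using norm_triangle_ineq4[of y "y - x"] by simp
  have "norm_dist (B0 w) (\<lambda>z. 0) (pol R) \<le> (C * d + \<eta>) + (C * d + b0 * \<eta>)"
  proof (rule zero_dist_le[OF w])
    have "cmod (F 0) \<le> C * ?N" using C(2) by (simp add: F_def)
    moreover have "cmod (F 0 - poly R 0) < \<eta>" using R by simp
    ultimately show "cmod (poly R 0) \<le> C * d + \<eta>" using close[of "poly R 0" "F 0"] CN by linarith
    fix z :: complex assume z: "z \<in> ball 0 1"
    let ?b = "bloch_weight w z"
    have b: "0 \<le> ?b" "?b \<le> b0"
      using bloch_weight_pos[OF w z] bloch_weight_antimono[OF w, of 0 z] z by (auto simp: b0_def)
    have "?b * cmod (poly (pderiv R) z) \<le> ?b * cmod (deriv F z) + ?b * cmod (deriv F z - poly (pderiv R) z)"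
      using mult_left_mono[OF close[of "poly (pderiv R) z" "deriv F z"] b(1)] by (simp add: distrib_left)
    moreover have "?b * cmod (deriv F z) \<le> C * ?N" using C(2) z by (simp add: F_def)
    moreover have "?b * cmod (deriv F z - poly (pderiv R) z) \<le> b0 * \<eta>"
      using bspec[OF R, of z] z b by (intro mult_mono) auto
    ultimately show "?b * cmod (poly (pderiv R) z) \<le> C * d + b0 * \<eta>" using CN by linarith
  qed
  then have 1: "norm_dist (B0 w) (\<lambda>z. 0) (pol R) < e"
    using dC \<eta>J nn d e by linarith
  have 2: "cmod (pairing A (\<lambda>x. g (mob u a x) - poly R x) h) < e" if h: "h \<in> H" for h
  proof -
    have hi: "integrable circle h" using H(2) h by blast
    let ?k = "\<lambda>x. g x - poly Q x"
    have k: "?k \<in> bdd_meas" by (intro bdd_meas_diff g bdd_meas_poly)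
    have Fb: "F \<in> bdd_meas" unfolding F_def by (rule bdd_meas_mob[OF bdd_meas_poly])
    have km: "(\<lambda>x. ?k (mob u a x)) \<in> bdd_meas" by (rule bdd_meas_mob[OF k])
    have FR: "(\<lambda>x. F x - poly R x) \<in> bdd_meas" by (intro bdd_meas_diff Fb bdd_meas_poly)
    have "(\<lambda>x. g (mob u a x) - poly R x) = (\<lambda>x. ?k (mob u a x) + (F x - poly R x))"
      by (simp add: F_def)
    then have eq: "pairing A (\<lambda>x. g (mob u a x) - poly R x) h =
        pairing (mob u a ` A) ?k (t h) + pairing A (\<lambda>x. F x - poly R x) h"
      using pairing_add[OF A km FR hi] t(2)[OF h k] by simp
    have "cmod (pairing (mob u a ` A) ?k (t h)) < d" using Q(2) h by blast
    moreover have "cmod (pairing A (\<lambda>x. F x - poly R x) h) \<le> \<eta> * (LINT x|circle. cmod (h x))"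
      by (rule pairing_bound[OF A FR hi]) (use R in \<open>auto intro: less_imp_le\<close>)
    moreover have "\<eta> * (LINT x|circle. cmod (h x)) \<le> \<eta> * J"
      using J(2)[OF h] \<eta> by (intro mult_left_mono) auto
    ultimately show ?thesis
      using norm_triangle_ineq[of "pairing (mob u a ` A) ?k (t h)" "pairing A (\<lambda>x. F x - poly R x) h"]
        dC \<eta>J nn \<eta> e mult.commute[of \<eta> J] unfolding eq by linarith
  qed
  show "\<exists>Q. norm_dist (B0 w) (\<lambda>z. 0) (pol Q) < e \<and>
      (\<forall>h\<in>H. cmod (pairing A (\<lambda>x. g (mob u a x) - poly Q x) h) < e)"
    using 1 2 by blast
qed

end

subsection \<open>Rigidity and simultaneous approximation in terms of the kernel\<close>

lemma rigidity_set_iff: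
  assumes w: "majorant w" and A: "A \<in> sets circle"
  shows "rigidity_set A w \<longleftrightarrow>
    (\<forall>g\<in>bdd_meas. approx A w (\<lambda>z. 0) g \<longrightarrow> (AE x in circle. x \<in> A \<longrightarrow> g x = 0))"
proof
  assume R: "rigidity_set A w"
  show "\<forall>g\<in>bdd_meas. approx A w (\<lambda>z. 0) g \<longrightarrow> (AE x in circle. x \<in> A \<longrightarrow> g x = 0)"
  proof (intro ballI impI)
    fix g assume g: "g \<in> bdd_meas" "approx A w (\<lambda>z. 0) g"
    have "(\<lambda>z::complex. 0::complex, cls A g) = (\<lambda>z. 0, cls A (\<lambda>x. 0))"
    proof (rule inj_onD[of fst "carr (P_space A w)"])
      show "inj_on fst (carr (P_space A w))" using R by (simp add: rigidity_set_def)
    qed (simp_all add: P_space_iff_approx[OF w A zero_in_B0[OF w]] g kernel_zero[OF w])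
    then show "AE x in circle. x \<in> A \<longrightarrow> g x = 0" using cls_eq_iff[OF A g(1) bdd_meas_const[of 0]] by simp
  qed
next
  assume K: "\<forall>g\<in>bdd_meas. approx A w (\<lambda>z. 0) g \<longrightarrow> (AE x in circle. x \<in> A \<longrightarrow> g x = 0)"
  have "inj_on fst (carr (P_space A w))"
  proof (rule inj_onI)
    fix p q assume "p \<in> carr (P_space A w)" "q \<in> carr (P_space A w)" "fst p = fst q"
    then obtain f g h where p: "p = (f, cls A g)" "q = (f, cls A h)" "f \<in> carr (B0 w)"
      and g: "g \<in> bdd_meas" "approx A w f g" and h: "h \<in> bdd_meas" "approx A w f h"
      unfolding P_space_carr[OF w A] by auto
    have "approx A w (\<lambda>z. 0) (\<lambda>x. g x - h x)"
      using approx_lincomb[OF w A p(3) p(3) g(1) h(1) g(2) h(2), of "-1"] by simp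
    then have "AE x in circle. x \<in> A \<longrightarrow> g x - h x = 0" using K g(1) h(1) by (auto intro: bdd_meas_diff)
    then have "cls A g = cls A h" by (simp add: cls_eq_iff[OF A g(1) h(1)])
    then show "p = q" by (simp add: p)
  qed
  with A show "rigidity_set A w" by (simp add: rigidity_set_def)
qed

lemma SA_property_iff:
  assumes w: "majorant w" and S: "S \<in> sets circle"
  shows "SA_property S w \<longleftrightarrow> (\<forall>g\<in>bdd_meas. approx S w (\<lambda>z. 0) g)"
proof
  assume "SA_property S w"
  then have "carr (P_space S w) = carr (B0 w) \<times> carr (Linf S)"
    by (simp add: SA_property_def direct_sum_def)
  then show "\<forall>g\<in>bdd_meas. approx S w (\<lambda>z. 0) g"
    using P_space_iff_approx[OF w S zero_in_B0[OF w]] zero_in_B0[OF w] cls_in_Linf[OF S] by blast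
next
  assume K: "\<forall>g\<in>bdd_meas. approx S w (\<lambda>z. 0) g"
  have "approx S w f g" if f: "f \<in> carr (B0 w)" and g: "g \<in> bdd_meas" for f g
  proof (rule approx_closure[OF w S f g])
    fix e :: real and H :: "(complex \<Rightarrow> complex) set" assume e: "e > 0"
    obtain Q where Q: "norm_dist (B0 w) f (pol Q) < e" using pol_dense[OF w f e] by blast
    \<comment> \<open>Adding the kernel element (0, g - Q) to the pair (Q, Q) gives (Q, g); density
      of the polynomials then replaces Q by \<open>f\<close>.\<close>
    have d: "(\<lambda>x. g x - poly Q x) \<in> bdd_meas" by (intro bdd_meas_diff g bdd_meas_poly)
    have "approx S w (\<lambda>z. pol Q z + 1 * 0) (\<lambda>x. poly Q x + 1 * (g x - poly Q x))"
      by (rule approx_lincomb[OF w S pol_in_B0[OF w] zero_in_B0[OF w] bdd_meas_poly d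
            approx_poly[OF w] bspec[OF K d]])
    then have "approx S w (pol Q) g" by simp
    then show "\<exists>f'\<in>carr (B0 w). \<exists>g'\<in>bdd_meas. approx S w f' g' \<and> norm_dist (B0 w) f f' < e \<and>
        (\<forall>h\<in>H. cmod (pairing S (\<lambda>x. g x - g' x) h) < e)"
      using Q g e pol_in_B0[OF w] by (intro bexI[of _ "pol Q"] bexI[of _ g]) (auto simp: pairing_def)
  qed
  then have "carr (P_space S w) = {(f, cls S g) | f g. f \<in> carr (B0 w) \<and> g \<in> bdd_meas}"
    unfolding P_space_carr[OF w S] by blast
  also have "\<dots> = carr (B0 w) \<times> carr (Linf S)"
  proof -
    have "\<exists>g\<in>bdd_meas. G = cls S g" if "G \<in> carr (Linf S)" for G
      using Linf_cases[OF S that] by blast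
    then show ?thesis using cls_in_Linf[OF S] by fast
  qed
  finally show "SA_property S w" using S by (simp add: SA_property_def direct_sum_def)
qed

text \<open>A kernel function over the image pulls back to one over \<open>A\<close> and vanishes
  there by rigidity; the exceptional null set is then mapped forward to a null set.\<close>

lemma (in disc_moebius) rigidity_set_image:
  assumes w: "majorant w" and A: "A \<in> sets circle" and R: "rigidity_set A w"
  shows "rigidity_set (mob u a ` A) w"
  unfolding rigidity_set_iff[OF w mob_image_sets[OF A]]
proof (intro ballI impI)
  fix g assume g: "g \<in> bdd_meas" "approx (mob u a ` A) w (\<lambda>z. 0) g"
  have "AE x in circle. x \<in> A \<longrightarrow> g (mob u a x) = 0"
    using R kernel_mob[OF w A g] bdd_meas_mob[OF g(1)] by (simp add: rigidity_set_iff[OF w A])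
  then obtain N where N: "N \<in> null_sets circle" "{x \<in> space circle. \<not> (x \<in> A \<longrightarrow> g (mob u a x) = 0)} \<subseteq> N"
    by (auto simp: eventually_ae_filter)
  from AE_not_in[OF mob_image_null[OF N(1)]]
  show "AE x in circle. x \<in> mob u a ` A \<longrightarrow> g x = 0"
  proof eventually_elim
    case (elim y)
    show ?case
    proof
      assume "y \<in> mob u a ` A"
      then obtain x where x: "x \<in> A" "y = mob u a x" by blast
      moreover have "x \<in> space circle" using x sets.sets_into_space[OF A] by blast
      ultimately show "g y = 0" using N(2) elim by blast
    qed
  qed
qed

lemma (in disc_moebius) SA_property_image:
  assumes w: "majorant w" and S: "S \<in> sets circle" and SA: "SA_property S w"
  shows "SA_property (mob u a ` S) w"
  unfolding SA_property_iff[OF w mob_image_sets[OF S]]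
proof
  interpret I: disc_moebius "cnj u" "- u * a" by (rule inverse_moebius)
  let ?i = "mob (cnj u) (- u * a)"
  fix g assume g: "g \<in> bdd_meas"
  have inv_img: "?i ` mob u a ` S = S"
  proof -
    have "(\<lambda>x. ?i (mob u a x)) ` S = (\<lambda>x. x) ` S"
    proof (rule image_cong[OF refl])
      show "?i (mob u a x) = x" if "x \<in> S" for x
        using that sets_circle_subset[OF S] by (intro mob_inverse) auto
    qed
    then show ?thesis by (simp add: image_image)
  qed
  have gm: "(\<lambda>x. g (mob u a x)) \<in> bdd_meas" by (rule bdd_meas_mob[OF g])
  then have "approx (?i ` mob u a ` S) w (\<lambda>z. 0) (\<lambda>x. g (mob u a x))"
    unfolding inv_img using SA by (simp add: SA_property_iff[OF w S])
  from I.kernel_mob[OF w mob_image_sets[OF S] gm this]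
  show "approx (mob u a ` S) w (\<lambda>z. 0) g"
  proof (rule approx_cong[OF _ mob_image_sets[OF S] I.bdd_meas_mob[OF gm] g])
    show "AE x in circle. x \<in> mob u a ` S \<longrightarrow> g (mob u a (?i x)) = g x"
    proof (rule AE_I2, rule impI)
      fix x assume "x \<in> space circle"
      then have "mob u a (?i x) = x" by (intro mob_inverse') (simp add: space_circle)
      then show "g (mob u a (?i x)) = g x" by (rule arg_cong)
    qed
  qed
qed

lemma disc_automorphism_image:
  assumes "disc_automorphism \<phi>"
  obtains u a where "disc_moebius u a" "\<And>A. A \<in> sets circle \<Longrightarrow> \<phi> ` A = mob u a ` A"
proof -
  obtain u a where m: "disc_moebius u a" "\<forall>z\<in>cball 0 1. \<phi> z = mob u a z"
    by (rule disc_automorphism_mob[OF assms])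
  have "\<phi> ` A = mob u a ` A" if "A \<in> sets circle" for A
    using m(2) sets_circle_subset[OF that] sphere_cball[of 0 1] by (intro image_cong refl) blast
  with m(1) show ?thesis by (rule that)
qed

subsection \<open>The splitting\<close>

lemma nrm_B0_nonneg: assumes "majorant w" "f \<in> carr (B0 w)" shows "0 \<le> nrm (B0 w) f"
proof -
  have "norm_dist (B0 w) f (\<lambda>z. 0) = nrm (B0 w) f"
    using assms zero_in_B0[OF assms(1)] by (simp add: norm_dist_def) (simp add: B0_def)
  then show ?thesis using Metric_space.nonneg[OF Metric_space_B0[OF assms(1)], of f "\<lambda>z. 0"] by simp
qed

lemma Linf_nrm_mono:
  assumes "E \<in> sets circle" "A \<in> sets circle" "A \<subseteq> E" "g \<in> bdd_meas"
  shows "nrm (Linf A) (cls A g) \<le> nrm (Linf E) (cls E g)"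
  unfolding Linf_nrm_cls[OF assms(1,4)] Linf_nrm_cls[OF assms(2,4)]
proof (rule cInf_superset_mono)
  obtain C where "g \<in> borel_measurable circle" "0 \<le> C" "\<forall>x\<in>sphere 0 1. cmod (g x) \<le> C"
    by (rule bdd_measE[OF assms(4)])
  then have "C \<in> {C. 0 \<le> C \<and> (AE x in circle. x \<in> E \<longrightarrow> cmod (g x) \<le> C)}"
    by (auto simp: space_circle intro!: AE_I2)
  then show "{C. 0 \<le> C \<and> (AE x in circle. x \<in> E \<longrightarrow> cmod (g x) \<le> C)} \<noteq> {}" by blast
  show "bdd_below {C. 0 \<le> C \<and> (AE x in circle. x \<in> A \<longrightarrow> cmod (g x) \<le> C)}"
    by (rule bdd_belowI[of _ 0]) auto
  show "{C. 0 \<le> C \<and> (AE x in circle. x \<in> E \<longrightarrow> cmod (g x) \<le> C)} \<subseteq>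
      {C. 0 \<le> C \<and> (AE x in circle. x \<in> A \<longrightarrow> cmod (g x) \<le> C)}"
    using assms(3) by (auto elim!: eventually_mono)
qed

text \<open>A bound on \<open>A\<close> plus a bound on \<open>S\<close> bounds g on
  \<open>E\<close>. The sum, and not the maximum, is the form that matches the norm of
  \<open>\<oplus>\<^sub>N\<close>.\<close>

lemma Linf_nrm_Un:
  assumes E: "E \<in> sets circle" and AS: "measurable_partition E A S" and g: "g \<in> bdd_meas"
  shows "nrm (Linf E) (cls E g) \<le> nrm (Linf A) (cls A g) + nrm (Linf S) (cls S g)"
proof -
  define B where "B T = {C. 0 \<le> C \<and> (AE x in circle. x \<in> T \<longrightarrow> cmod (g x) \<le> C)}" for T
  have sets: "A \<in> sets circle" "S \<in> sets circle" "E = A \<union> S"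
    using AS by (auto simp: measurable_partition_def)
  have nrm: "nrm (Linf T) (cls T g) = Inf (B T)" if "T \<in> sets circle" for T
    unfolding B_def by (rule Linf_nrm_cls[OF that g])
  obtain C where "g \<in> borel_measurable circle" "0 \<le> C" "\<forall>x\<in>sphere 0 1. cmod (g x) \<le> C"
    by (rule bdd_measE[OF g])
  then have "C \<in> B T" for T by (auto simp: B_def space_circle intro!: AE_I2)
  then have ne: "B T \<noteq> {}" for T by blast
  have bdd: "bdd_below (B T)" for T by (rule bdd_belowI[of _ 0]) (auto simp: B_def)
  have le: "Inf (B E) \<le> c + d" if "c \<in> B A" "d \<in> B S" for c d
  proof (rule cInf_lower[OF _ bdd])
    have "AE x in circle. x \<in> A \<longrightarrow> cmod (g x) \<le> c" "AE x in circle. x \<in> S \<longrightarrow> cmod (g x) \<le> d"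
      using that by (auto simp: B_def)
    then have "AE x in circle. x \<in> E \<longrightarrow> cmod (g x) \<le> c + d"
      by eventually_elim (use that sets(3) in \<open>force simp: B_def\<close>)
    then show "c + d \<in> B E" using that by (auto simp: B_def)
  qed
  have "Inf (B E) - c \<le> Inf (B S)" if "c \<in> B A" for c
    by (rule cInf_greatest[OF ne]) (use le[OF that] in \<open>simp add: algebra_simps\<close>)
  then have "Inf (B E) - Inf (B S) \<le> Inf (B A)"
    by (intro cInf_greatest[OF ne]) (simp add: algebra_simps)
  then show ?thesis by (simp add: nrm sets(1,2) E)
qed

lemma AE_not_mem_null: "X \<in> sets circle \<Longrightarrow> (AE x in circle. x \<notin> X) \<Longrightarrow> X \<in> null_sets circle"
  by (simp add: AE_iff_null_sets)

locale kernel_splitting =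
  fixes w :: "real \<Rightarrow> real" and E A S :: "complex set"
  assumes w: "majorant w" and E: "E \<in> sets circle" and AS: "measurable_partition E A S"
    and kernel: "\<And>g. g \<in> bdd_meas \<Longrightarrow>
      approx E w (\<lambda>z. 0) g \<longleftrightarrow> (AE x in circle. x \<in> A \<longrightarrow> g x = 0)"
begin

lemma parts: "A \<in> sets circle" "S \<in> sets circle" "A \<subseteq> E" "S \<subseteq> E" "E = A \<union> S" "A \<inter> S = {}"
  using AS by (auto simp: measurable_partition_def)

text \<open>What happens on \<open>S\<close> is free. If Q approximates on \<open>A\<close>, add to
  the pair (Q, Q) the kernel element whose second component is g - Q on \<open>S\<close> and 0 on
  \<open>A\<close>: the first component is unchanged, and the new second component equals g on
  \<open>S\<close> and Q on \<open>A\<close>.\<close>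

lemma approx_iff:
  assumes f: "f \<in> carr (B0 w)" and g: "g \<in> bdd_meas"
  shows "approx E w f g \<longleftrightarrow> approx A w f g"
proof
  assume "approx E w f g" then show "approx A w f g" by (rule approx_subset[OF _ parts(1,3)])
next
  assume ap: "approx A w f g"
  show "approx E w f g"
  proof (rule approx_closure[OF w E f g])
    fix e :: real and H :: "(complex \<Rightarrow> complex) set"
    assume e: "e > 0" and H: "finite H" "\<forall>h\<in>H. integrable circle h"
    obtain Q where Q: "norm_dist (B0 w) f (pol Q) < e" "\<forall>h\<in>H. cmod (pairing A (\<lambda>x. g x - poly Q x) h) < e"
      by (rule approxD[OF ap e H])
    let ?k = "\<lambda>x. indicator S x * (g x - poly Q x)"
    let ?g = "\<lambda>x. poly Q x + 1 * ?k x"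
    have k: "?k \<in> bdd_meas"
      by (intro bdd_meas_mult bdd_meas_diff bdd_meas_indicator parts g bdd_meas_poly)
    then have g': "?g \<in> bdd_meas" by (intro bdd_meas_add bdd_meas_cmult bdd_meas_poly)
    have "approx E w (\<lambda>z. 0) ?k"
      unfolding kernel[OF k] using parts(6) by (intro AE_I2) (auto simp: indicator_def)
    from approx_lincomb[OF w E pol_in_B0[OF w] zero_in_B0[OF w] bdd_meas_poly k approx_poly[OF w] this, of Q 1]
    have "approx E w (pol Q) ?g" by simp
    moreover have "cmod (pairing E (\<lambda>x. g x - ?g x) h) < e" if h: "h \<in> H" for h
    proof -
      have "pairing E (\<lambda>x. g x - ?g x) h = pairing E (\<lambda>x. indicator A x * (g x - poly Q x)) h"
      proof (rule pairing_cong[OF E])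
        show "AE x in circle. x \<in> E \<longrightarrow> g x - ?g x = indicator A x * (g x - poly Q x)"
          using parts(5,6) by (intro AE_I2) (auto simp: indicator_def)
        show "integrable circle h" using h H(2) by blast
      qed (intro bdd_meas_mult bdd_meas_diff bdd_meas_indicator parts g g' bdd_meas_poly)+
      also have "\<dots> = pairing A (\<lambda>x. g x - poly Q x) h"
        by (simp add: pairing_mult_shift pairing_indicator[OF parts(3)])
      finally show ?thesis using Q(2) h by simp
    qed
    ultimately show "\<exists>f'\<in>carr (B0 w). \<exists>g'\<in>bdd_meas. approx E w f' g' \<and> norm_dist (B0 w) f f' < e \<and>
        (\<forall>h\<in>H. cmod (pairing E (\<lambda>x. g x - g' x) h) < e)"
      using Q(1) g' pol_in_B0[OF w] by blast
  qed
qed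

lemma rigid: "rigidity_set A w"
  unfolding rigidity_set_iff[OF w parts(1)]
  using kernel approx_iff[OF zero_in_B0[OF w]] by simp

lemma SA: "SA_property S w"
  unfolding SA_property_iff[OF w parts(2)]
proof
  fix g assume g: "g \<in> bdd_meas"
  let ?k = "\<lambda>x. indicator S x * g x"
  have k: "?k \<in> bdd_meas" by (intro bdd_meas_mult bdd_meas_indicator parts g)
  have "approx E w (\<lambda>z. 0) ?k"
    unfolding kernel[OF k] using parts(6) by (intro AE_I2) (auto simp: indicator_def)
  then have "approx S w (\<lambda>z. 0) ?k" by (rule approx_subset[OF _ parts(2,4)])
  then show "approx S w (\<lambda>z. 0) g"
    by (rule approx_cong[OF _ parts(2) k g]) (auto simp: indicator_def)
qed

lemma P_space_carr_split:
  "carr (P_space E w) = {(f, cls E g) | f g. f \<in> carr (B0 w) \<and> g \<in> bdd_meas \<and> approx A w f g}"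
  unfolding P_space_carr[OF w E] using approx_iff by auto

lemma splitting_isomorphism:
  "banach_isomorphism (\<lambda>(f, G). ((f, restr A G), restr S G)) (P_space E w) (P_space A w \<oplus>\<^sub>N Linf S)"
    (is "banach_isomorphism ?T ?V ?W")
proof -
  have T: "?T (f, cls E g) = ((f, cls A g), cls S g)" if "g \<in> bdd_meas" for f g
    using restr_cls[OF E _ _ that] parts by simp
  have carrW: "carr ?W = carr (P_space A w) \<times> carr (Linf S)" by (simp add: direct_sum_def)
  have "inj_on ?T (carr ?V)"
  proof (rule inj_onI)
    fix p q assume "p \<in> carr ?V" "q \<in> carr ?V" and eq: "?T p = ?T q"
    then obtain f g f' g' where p: "p = (f, cls E g)" "g \<in> bdd_meas" and q: "q = (f', cls E g')" "g' \<in> bdd_meas"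
      unfolding P_space_carr_split by blast
    have "f = f'" "cls A g = cls A g'" "cls S g = cls S g'"
      using eq by (simp_all only: p(1) q(1) T[OF p(2)] T[OF q(2)] prod.inject)
    then have "AE x in circle. x \<in> A \<longrightarrow> g x = g' x" "AE x in circle. x \<in> S \<longrightarrow> g x = g' x"
      using cls_eq_iff p(2) q(2) parts(1,2) by auto
    then have "AE x in circle. x \<in> E \<longrightarrow> g x = g' x" by eventually_elim (use parts(5) in auto)
    then show "p = q" using \<open>f = f'\<close> by (simp add: p(1) q(1) cls_eq_iff[OF E p(2) q(2)])
  qed
  moreover have "?T ` carr ?V = carr ?W"
  proof (intro equalityI subsetI)
    fix y assume "y \<in> ?T ` carr ?V"
    then obtain f g where "y = ?T (f, cls E g)" "f \<in> carr (B0 w)" and g: "g \<in> bdd_meas" "approx A w f g"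
      unfolding P_space_carr_split by blast
    then show "y \<in> carr ?W"
      unfolding carrW T[OF g(1)] using P_space_iff_approx[OF w parts(1)] cls_in_Linf[OF parts(2) g(1)] by simp
  next
    fix y assume "y \<in> carr ?W"
    then obtain f G K where y: "y = ((f, G), K)" "(f, G) \<in> carr (P_space A w)" "K \<in> carr (Linf S)"
      unfolding carrW by auto
    obtain g where g: "G = cls A g" "f \<in> carr (B0 w)" "g \<in> bdd_meas" "approx A w f g"
      using y(2) unfolding P_space_carr[OF w parts(1)] by blast
    obtain k where k: "k \<in> bdd_meas" "K = cls S k" using Linf_cases[OF parts(2) y(3)] .
    \<comment> \<open>Surjectivity by gluing: the given functions on \<open>A\<close> and on
      \<open>S\<close> together form one on \<open>E\<close>, and only its part on \<open>A\<close>
      decides membership.\<close>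
    define l where "l = (\<lambda>x. indicator A x * g x + indicator S x * k x)"
    have l: "l \<in> bdd_meas"
      unfolding l_def by (intro bdd_meas_add bdd_meas_mult bdd_meas_indicator parts g k)
    have lA: "AE x in circle. x \<in> A \<longrightarrow> g x = l x" and lS: "AE x in circle. x \<in> S \<longrightarrow> k x = l x"
      using parts(6) by (auto simp: l_def indicator_def intro!: AE_I2)
    have "approx A w f l" by (rule approx_cong[OF g(4) parts(1) g(3) l lA])
    then have "(f, cls E l) \<in> carr ?V" unfolding P_space_carr_split using g(2) l by blast
    moreover have "?T (f, cls E l) = y"
      using lA lS unfolding T[OF l] y(1) g(1) k(2)
      by (simp add: cls_eq_iff[OF parts(1) g(3) l, symmetric] cls_eq_iff[OF parts(2) k(1) l, symmetric])
    ultimately show "y \<in> ?T ` carr ?V" by force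
  qed
  moreover have "?T (add ?V p q) = add ?W (?T p) (?T q)" if pq: "p \<in> carr ?V" "q \<in> carr ?V" for p q
  proof -
    obtain f g f' g' where p: "p = (f, cls E g)" "g \<in> bdd_meas" and q: "q = (f', cls E g')" "g' \<in> bdd_meas"
      using pq unfolding P_space_carr_split by blast
    have add_P: "add (P_space X w) (f, G) (f', G') = (add (B0 w) f f', add (Linf X) G G')" for X G G'
      by (simp add: P_space_def direct_sum_def)
    have "?T (add ?V p q) = ((add (B0 w) f f', cls A (\<lambda>x. g x + g' x)), cls S (\<lambda>x. g x + g' x))"
      unfolding p(1) q(1) add_P Linf_add_cls[OF E p(2) q(2)] by (rule T[OF bdd_meas_add[OF p(2) q(2)]])
    also have "\<dots> = add ?W (?T p) (?T q)"
      unfolding p(1) q(1) T[OF p(2)] T[OF q(2)]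
      using Linf_add_cls[OF parts(1) p(2) q(2)] Linf_add_cls[OF parts(2) p(2) q(2)] add_P[of A]
      by (simp add: direct_sum_def)
    finally show ?thesis .
  qed
  moreover have "?T (smul ?V c p) = smul ?W c (?T p)" if pV: "p \<in> carr ?V" for c p
  proof -
    obtain f g where p: "p = (f, cls E g)" "g \<in> bdd_meas"
      using pV unfolding P_space_carr_split by blast
    have smul_P: "smul (P_space X w) c (f, G) = (smul (B0 w) c f, smul (Linf X) c G)" for X G
      by (simp add: P_space_def direct_sum_def)
    have "?T (smul ?V c p) = ((smul (B0 w) c f, cls A (\<lambda>x. c * g x)), cls S (\<lambda>x. c * g x))"
      unfolding p(1) smul_P Linf_smul_cls[OF E p(2)] by (rule T[OF bdd_meas_cmult[OF p(2)]])
    also have "\<dots> = smul ?W c (?T p)"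
      unfolding p(1) T[OF p(2)]
      using Linf_smul_cls[OF parts(1) p(2)] Linf_smul_cls[OF parts(2) p(2)] smul_P[of A]
      by (simp add: direct_sum_def)
    finally show ?thesis .
  qed
  \<comment> \<open>The lower bound is subadditivity over the two parts; the factor 2 arises because
    the norms on \<open>A\<close> and on \<open>S\<close> are each at most the norm on
    \<open>E\<close>.\<close>
  moreover have "1 * nrm ?V p \<le> nrm ?W (?T p) \<and> nrm ?W (?T p) \<le> 2 * nrm ?V p" if pV: "p \<in> carr ?V" for p
  proof -
    obtain f g where p: "p = (f, cls E g)" "f \<in> carr (B0 w)" "g \<in> bdd_meas"
      using pV unfolding P_space_carr_split by blast
    have nV: "nrm ?V p = nrm (B0 w) f + nrm (Linf E) (cls E g)"
      by (simp add: p(1) P_space_def direct_sum_def)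
    have nW: "nrm ?W (?T p) = nrm (B0 w) f + nrm (Linf A) (cls A g) + nrm (Linf S) (cls S g)"
      unfolding p(1) T[OF p(3)] by (simp add: P_space_def direct_sum_def)
    show ?thesis
      unfolding nV nW
      using Linf_nrm_Un[OF E AS p(3)] Linf_nrm_mono[OF E parts(1,3) p(3)]
        Linf_nrm_mono[OF E parts(2,4) p(3)] nrm_B0_nonneg[OF w p(2)] by simp
  qed
  ultimately show ?thesis
    unfolding banach_isomorphism_def bij_betw_def
    by (intro conjI ballI allI exI[of _ "1::real"] exI[of _ "2::real"]) auto
qed

text \<open>By surjectivity of the isomorphism some kernel function over \<open>E\<close> equals 1
  on \<open>S'\<close>; kernel functions vanish on \<open>A\<close>, so \<open>S'\<close> and
  \<open>A\<close> meet in a null set. Conversely the indicator of \<open>S\<close> lies in the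
  kernel over \<open>E\<close>, hence also in that over \<open>A'\<close>, where rigidity makes it
  0; so \<open>A'\<close> and \<open>S\<close> meet in a null set.\<close>

lemma splitting_unique:
  assumes AS': "measurable_partition E A' S'" and R: "rigidity_set A' w"
    and iso: "banach_isomorphism (\<lambda>(f, G). ((f, restr A' G), restr S' G)) (P_space E w) (P_space A' w \<oplus>\<^sub>N Linf S')"
      (is "banach_isomorphism ?T _ ?W")
  shows "same_mod_null A' A \<and> same_mod_null S' S"
proof -
  have parts': "A' \<in> sets circle" "S' \<in> sets circle" "A' \<subseteq> E" "S' \<subseteq> E" "E = A' \<union> S'" "A' \<inter> S' = {}"
    using AS' by (auto simp: measurable_partition_def)
  have "S' \<inter> A \<in> null_sets circle"
  proof -
    have "((\<lambda>z. 0, cls A' (\<lambda>x. 0)), cls S' (\<lambda>x. 1)) \<in> carr ?W"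
      using P_space_iff_approx[OF w parts'(1) zero_in_B0[OF w] bdd_meas_const] kernel_zero[OF w]
        cls_in_Linf[OF parts'(2) bdd_meas_const] by (simp add: direct_sum_def)
    also have "carr ?W = ?T ` carr (P_space E w)" using iso by (simp add: banach_isomorphism_def bij_betw_def)
    finally obtain f g where fg: "((\<lambda>z. 0, cls A' (\<lambda>x. 0)), cls S' (\<lambda>x. 1)) = ?T (f, cls E g)"
      and g: "g \<in> bdd_meas" "approx E w f g"
      unfolding P_space_carr[OF w E] by blast
    have "f = (\<lambda>z. 0)" and c: "cls S' (\<lambda>x. 1) = cls S' g"
      using fg restr_cls[OF E parts'(2,4) g(1)] by auto
    with g have "AE x in circle. x \<in> A \<longrightarrow> g x = 0" using kernel by simp
    moreover have "AE x in circle. x \<in> S' \<longrightarrow> 1 = g x"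
      using c cls_eq_iff[OF parts'(2) bdd_meas_const g(1)] by simp
    ultimately have "AE x in circle. x \<notin> S' \<inter> A" by eventually_elim auto
    then show ?thesis using parts(1) parts'(2) by (intro AE_not_mem_null) auto
  qed
  moreover have "A' \<inter> S \<in> null_sets circle"
  proof -
    have i: "indicator S \<in> bdd_meas" by (rule bdd_meas_indicator[OF parts(2)])
    have "approx E w (\<lambda>z. 0) (indicator S)"
      unfolding kernel[OF i] using parts(6) by (intro AE_I2) (auto simp: indicator_def)
    then have "approx A' w (\<lambda>z. 0) (indicator S)" by (rule approx_subset[OF _ parts'(1,3)])
    then have "AE x in circle. x \<in> A' \<longrightarrow> (indicator S x :: complex) = 0"
      using R i by (simp add: rigidity_set_iff[OF w parts'(1)])
    then have "AE x in circle. x \<notin> A' \<inter> S" by eventually_elim (auto simp: indicator_def)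
    then show ?thesis using parts(2) parts'(1) by (intro AE_not_mem_null) auto
  qed
  ultimately have "(S' \<inter> A) \<union> (A' \<inter> S) \<in> null_sets circle" by (rule null_sets.Un)
  moreover have "(A' - A) \<union> (A - A') = (S' \<inter> A) \<union> (A' \<inter> S)" "(S' - S) \<union> (S - S') = (S' \<inter> A) \<union> (A' \<inter> S)"
    using parts(5,6) parts'(5,6) by blast+
  ultimately show ?thesis by (simp add: same_mod_null_def)
qed

end

theorem theorem2p2:
  fixes w :: "real \<Rightarrow> real" and E :: "complex set"
  assumes "majorant w" and "E \<in> sets circle" and "emeasure circle E > 0"
  shows "\<exists>A S. measurable_partition E A S \<and>
      rigidity_set A w \<and> SA_property S w \<and>
      banach_isomorphism (\<lambda>(f, G). ((f, restr A G), restr S G))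
        (P_space E w) (P_space A w \<oplus>\<^sub>N Linf S) \<and>
      (\<forall>\<phi>. disc_automorphism \<phi> \<longrightarrow> rigidity_set (\<phi> ` A) w \<and> SA_property (\<phi> ` S) w) \<and>
      (\<forall>A' S'. measurable_partition E A' S' \<and>
          rigidity_set A' w \<and> SA_property S' w \<and>
          banach_isomorphism (\<lambda>(f, G). ((f, restr A' G), restr S' G))
            (P_space E w) (P_space A' w \<oplus>\<^sub>N Linf S')
        \<longrightarrow> same_mod_null A' A \<and> same_mod_null S' S)"
proof -
  obtain S where S: "S \<in> sets circle" "S \<subseteq> E"
    "\<forall>g\<in>bdd_meas. approx E w (\<lambda>z. 0) g \<longleftrightarrow> (AE x in circle. x \<in> E - S \<longrightarrow> g x = 0)"
    using kernel_support[OF assms(1,2)] by (elim exE conjE) (rule that)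
  interpret kernel_splitting w E "E - S" S
    by unfold_locales (use assms(1,2) S in \<open>auto simp: measurable_partition_def\<close>)
  have conf: "rigidity_set (\<phi> ` (E - S)) w \<and> SA_property (\<phi> ` S) w" if \<phi>: "disc_automorphism \<phi>" for \<phi>
  proof -
    obtain u a where "disc_moebius u a" and img: "\<And>A. A \<in> sets circle \<Longrightarrow> \<phi> ` A = mob u a ` A"
      using disc_automorphism_image[OF \<phi>] by metis
    then interpret disc_moebius u a by simp
    show ?thesis
      unfolding img[OF parts(1)] img[OF parts(2)]
      by (intro conjI rigidity_set_image[OF w parts(1) rigid] SA_property_image[OF w parts(2) SA])
  qed
  show ?thesis
  proof (rule exI[of _ "E - S"], rule exI[of _ S], intro conjI)
    show "\<forall>\<phi>. disc_automorphism \<phi> \<longrightarrow> rigidity_set (\<phi> ` (E - S)) w \<and> SA_property (\<phi> ` S) w"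
      using conf by blast
    show "\<forall>A' S'. measurable_partition E A' S' \<and> rigidity_set A' w \<and> SA_property S' w \<and>
          banach_isomorphism (\<lambda>(f, G). ((f, restr A' G), restr S' G))
            (P_space E w) (P_space A' w \<oplus>\<^sub>N Linf S')
        \<longrightarrow> same_mod_null A' (E - S) \<and> same_mod_null S' S"
      by (intro allI impI, elim conjE, rule splitting_unique)
  qed (rule AS rigid SA splitting_isomorphism)+
qed

end
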